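(* Let $n\ge 1$ and let $I=(f_1,\dots,f_n)\subset K[x_1,\dots,x_n]$ be a generic ideal, with $f_i$ generic homogeneous of degree $\deg(f_i)=d_i\ge 1$, and suppose that for every $1\le i\le n$ $$d_i\ \ge\ \Big(\sum_{j=1}^{i-1}d_j\Big)-i-1 .$$ Then the initial ideal $\operatorname{in}(I)$ with respect to the graded reverse lexicographic order is almost reverse lexicographic.
   Context: $K$ is an infinite field that is an extension of a base field $F$. The monomial order is the graded reverse lexicographic order with $x_1>x_2>\cdots>x_n$. A homogeneous polynomial $f$ of degree $d$ in a polynomial ring over $K$ is generic over $F$ if $f=\sum_\alpha c_\alpha x^\alpha$, the sum running over all monomials of degree $d$ of the ring, with coefficients $c_\alpha\in K$ algebraically independent over $F$. An ideal is generic if it is generated by generic polynomials $f_1,\dots,f_r$ all of whose coefficients (taken together) are algebraically independent over $F$. A monomial ideal $J$ with minimal monomial generators $x^{\alpha_1},\dots,x^{\alpha_r}$ is almost reverse lexicographic if, for every $i$, $J$ contains every monomial $x^\alpha$ with $\deg x^\alpha=\deg x^{\alpha_i}$ and $x^\alpha>x^{\alpha_i}$. $\operatorname{in}(I)$ denotes the ideal generated by the leading monomials of the elements of $I$. *)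

theory Defs
  imports "HOL-Library.Poly_Mapping"
begin

text \<open>
  A monomial is its exponent vector, of type nat =>0 nat; a polynomial is a finitely supported
  family of coefficients indexed by monomials.  The ring K[x_1, ..., x_n] is the set
  \<open>poly_ring n\<close> of those polynomials in which only the variables with index in {1..n} occur.
\<close>

type_synonym mon = "nat \<Rightarrow>\<^sub>0 nat"
type_synonym 'a mpol = "mon \<Rightarrow>\<^sub>0 'a"

definition mdeg :: "mon \<Rightarrow> nat" where
  "mdeg m = (\<Sum>i\<in>Poly_Mapping.keys m. Poly_Mapping.lookup m i)"

definition monomials :: "nat \<Rightarrow> mon set" where
  "monomials n = {m. Poly_Mapping.keys m \<subseteq> {1..n}}"

definition monomials_deg :: "nat \<Rightarrow> nat \<Rightarrow> mon set" where
  "monomials_deg n d = {m \<in> monomials n. mdeg m = d}"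

definition poly_ring :: "nat \<Rightarrow> 'a::field mpol set" where
  "poly_ring n = {p. Poly_Mapping.keys p \<subseteq> monomials n}"

definition xpow :: "mon \<Rightarrow> 'a::field mpol" where
  "xpow m = Poly_Mapping.single m 1"

definition ideal_gen :: "nat \<Rightarrow> 'a::field mpol set \<Rightarrow> 'a mpol set" where
  "ideal_gen n S = {(\<Sum>s\<in>T. g s * s) | T g. finite T \<and> T \<subseteq> S \<and> (\<forall>s\<in>T. g s \<in> poly_ring n)}"

text \<open>
  Graded reverse lexicographic order with x_1 > x_2 > ...: among monomials of equal degree,
  a < b iff at the last variable where they differ a has the larger exponent.
\<close>

definition grevlex_less :: "mon \<Rightarrow> mon \<Rightarrow> bool" where
  "grevlex_less a b \<longleftrightarrow> mdeg a < mdeg b \<or>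
     (mdeg a = mdeg b \<and> (\<exists>k. Poly_Mapping.lookup a k > Poly_Mapping.lookup b k \<and>
        (\<forall>j>k. Poly_Mapping.lookup a j = Poly_Mapping.lookup b j)))"

definition lead_mon :: "'a::field mpol \<Rightarrow> mon" where
  "lead_mon p = (THE m. m \<in> Poly_Mapping.keys p \<and> (\<forall>m'\<in>Poly_Mapping.keys p. m' \<noteq> m \<longrightarrow> grevlex_less m' m))"

definition initial_ideal :: "nat \<Rightarrow> 'a::field mpol set \<Rightarrow> 'a mpol set" where
  "initial_ideal n I = ideal_gen n {xpow (lead_mon p) | p. p \<in> I \<and> p \<noteq> 0}"

definition minimal_mon_gens :: "nat \<Rightarrow> 'a::field mpol set \<Rightarrow> mon set \<Rightarrow> bool" where
  "minimal_mon_gens n J A \<longleftrightarrow> finite A \<and> A \<subseteq> monomials n \<and> J = ideal_gen n (xpow ` A) \<and>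
     (\<forall>B. B \<subset> A \<longrightarrow> ideal_gen n (xpow ` B) \<noteq> J)"

text \<open>
  The existential quantifier makes J a monomial ideal; the minimal set A of monomial
  generators is uniquely determined by J.
\<close>

definition almost_revlex :: "nat \<Rightarrow> 'a::field mpol set \<Rightarrow> bool" where
  "almost_revlex n J \<longleftrightarrow> (\<exists>A. minimal_mon_gens n J A \<and>
     (\<forall>a\<in>A. \<forall>b\<in>monomials n. mdeg b = mdeg a \<and> grevlex_less a b \<longrightarrow> xpow b \<in> J))"

definition is_subfield :: "'a::field set \<Rightarrow> bool" where
  "is_subfield F \<longleftrightarrow> 0 \<in> F \<and> 1 \<in> F \<and> (\<forall>a\<in>F. \<forall>b\<in>F. a + b \<in> F \<and> a * b \<in> F) \<and>
     (\<forall>a\<in>F. - a \<in> F \<and> inverse a \<in> F)"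

text \<open>
  Algebraic independence over F of the family c indexed by A (hence c is injective on A).
  The witness p is a polynomial over F in variables indexed by A.
\<close>

definition poly_eval :: "('v \<Rightarrow> 'a::field) \<Rightarrow> (('v \<Rightarrow>\<^sub>0 nat) \<Rightarrow>\<^sub>0 'a) \<Rightarrow> 'a" where
  "poly_eval c p = (\<Sum>m\<in>Poly_Mapping.keys p. Poly_Mapping.lookup p m *
     (\<Prod>v\<in>Poly_Mapping.keys m. c v ^ Poly_Mapping.lookup m v))"

definition alg_indep :: "'a::field set \<Rightarrow> 'v set \<Rightarrow> ('v \<Rightarrow> 'a) \<Rightarrow> bool" where
  "alg_indep F A c \<longleftrightarrow>
     (\<forall>p. (\<forall>m\<in>Poly_Mapping.keys p. Poly_Mapping.keys m \<subseteq> A \<and> Poly_Mapping.lookup p m \<in> F) \<longrightarrow>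
        poly_eval c p = 0 \<longrightarrow> p = 0)"

text \<open>
  f 1, ..., f r are generic forms in x_1, ..., x_n of degrees d 1, ..., d r, with all their
  coefficients c (i, m) jointly algebraically independent over F.
\<close>

definition generic_forms ::
  "'a::field set \<Rightarrow> nat \<Rightarrow> nat \<Rightarrow> (nat \<Rightarrow> nat) \<Rightarrow> (nat \<Rightarrow> 'a mpol) \<Rightarrow> bool" where
  "generic_forms F n r d f \<longleftrightarrow> (\<exists>c. alg_indep F (SIGMA i:{1..r}. monomials_deg n (d i)) c \<and>
     (\<forall>i\<in>{1..r}. f i = (\<Sum>m\<in>monomials_deg n (d i). Poly_Mapping.single m (c (i, m)))))"

text \<open>The sum in \<open>generic_forms\<close> is finite, and leading monomials are well defined.\<close>

lemma finite_monomials_deg: "finite (monomials_deg n d)"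
proof -
  have "Poly_Mapping.lookup ` monomials_deg n d \<subseteq>
      {h. \<forall>i. (i \<in> {1..n} \<longrightarrow> h i \<in> {0..d}) \<and> (i \<notin> {1..n} \<longrightarrow> h i = 0)}"
  proof safe
    fix m i assume m: "m \<in> monomials_deg n d"
    show "Poly_Mapping.lookup m i \<in> {0..d}"
    proof (cases "i \<in> Poly_Mapping.keys m")
      case True
      then have "Poly_Mapping.lookup m i \<le> mdeg m"
        unfolding mdeg_def by (intro member_le_sum) auto
      with m show ?thesis by (auto simp: monomials_deg_def)
    qed (auto simp: in_keys_iff)
  next
    fix m i assume "m \<in> monomials_deg n d" "i \<notin> {1..n}"
    then show "Poly_Mapping.lookup m i = 0"
      by (auto simp: monomials_deg_def monomials_def in_keys_iff)
  qed
  moreover have "finite {h. \<forall>i. (i \<in> {1..n} \<longrightarrow> h i \<in> {0..d}) \<and> (i \<notin> {1..n} \<longrightarrow> h i = (0::nat))}"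
    by (rule finite_set_of_finite_funs) auto
  ultimately have "finite (Poly_Mapping.lookup ` monomials_deg n d)" by (rule finite_subset)
  then show ?thesis by (rule finite_imageD) (auto intro: inj_onI simp: lookup_inject)
qed

lemma grevlex_less_total: "a \<noteq> b \<Longrightarrow> grevlex_less a b \<or> grevlex_less b a"
proof -
  assume "a \<noteq> b"
  then obtain i where i: "Poly_Mapping.lookup a i \<noteq> Poly_Mapping.lookup b i" by (meson poly_mapping_eqI)
  let ?D = "{i. Poly_Mapping.lookup a i \<noteq> Poly_Mapping.lookup b i}"
  have "?D \<subseteq> Poly_Mapping.keys a \<union> Poly_Mapping.keys b" by (auto simp: in_keys_iff)
  then have fin: "finite ?D" by (rule finite_subset) simp
  define k where "k = Max ?D"
  have "k \<in> ?D" unfolding k_def using i fin by (intro Max_in) auto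
  then have k: "Poly_Mapping.lookup a k \<noteq> Poly_Mapping.lookup b k" by simp
  have eq: "Poly_Mapping.lookup a j = Poly_Mapping.lookup b j" if "j > k" for j
  proof (rule ccontr)
    assume "\<not> ?thesis"
    then have "j \<le> k" unfolding k_def using fin by (intro Max_ge) auto
    with that show False by simp
  qed
  consider "mdeg a \<noteq> mdeg b"
    | "mdeg a = mdeg b" "Poly_Mapping.lookup a k > Poly_Mapping.lookup b k"
    | "mdeg a = mdeg b" "Poly_Mapping.lookup a k < Poly_Mapping.lookup b k"
    using k by linarith
  then show ?thesis
  proof cases
    case 1
    then show ?thesis by (simp add: grevlex_less_def) linarith
  next
    case 2
    then have "grevlex_less a b" unfolding grevlex_less_def using eq by blast
    then show ?thesis ..
  next
    case 3
    then have "grevlex_less b a"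
      unfolding grevlex_less_def using eq[symmetric] by auto
    then show ?thesis ..
  qed
qed

lemma grevlex_less_irrefl: "\<not> grevlex_less a a"
  by (simp add: grevlex_less_def)

lemma grevlex_less_trans:
  assumes "grevlex_less a b" "grevlex_less b c" shows "grevlex_less a c"
proof (cases "mdeg a < mdeg b \<or> mdeg b < mdeg c")
  case True
  with assms show ?thesis by (auto simp: grevlex_less_def)
next
  case False
  with assms obtain k l where
    k: "Poly_Mapping.lookup a k > Poly_Mapping.lookup b k" "\<forall>j>k. Poly_Mapping.lookup a j = Poly_Mapping.lookup b j" and
    l: "Poly_Mapping.lookup b l > Poly_Mapping.lookup c l" "\<forall>j>l. Poly_Mapping.lookup b j = Poly_Mapping.lookup c j" and
    d: "mdeg a = mdeg c"
    by (auto simp: grevlex_less_def)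
  have "Poly_Mapping.lookup a (max k l) > Poly_Mapping.lookup c (max k l)"
  proof (cases k l rule: linorder_cases)
    case less
    then show ?thesis using k(2) l(1) by (simp add: max_def)
  next
    case equal
    then show ?thesis using k(1) l(1) by simp
  next
    case greater
    then show ?thesis using k(1) l(2) by (simp add: max_def)
  qed
  moreover have "\<forall>j>max k l. Poly_Mapping.lookup a j = Poly_Mapping.lookup c j" using k l by simp
  ultimately show ?thesis using d unfolding grevlex_less_def by blast
qed

lemma grevlex_less_asym: "grevlex_less a b \<Longrightarrow> \<not> grevlex_less b a"
  using grevlex_less_trans[of a b a] grevlex_less_irrefl[of a] by argo

lemma lead_mon_ex1:
  fixes p :: "'a::field mpol"
  assumes "p \<noteq> 0"
  shows "\<exists>!m. m \<in> Poly_Mapping.keys p \<and> (\<forall>m'\<in>Poly_Mapping.keys p. m' \<noteq> m \<longrightarrow> grevlex_less m' m)"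
proof -
  have max: "\<exists>m\<in>S. \<forall>m'\<in>S. m' \<noteq> m \<longrightarrow> grevlex_less m' m" if "finite S" "S \<noteq> {}" for S
    using that
  proof (induction rule: finite_ne_induct)
    case (insert x S)
    then obtain m where m: "m \<in> S" "\<forall>m'\<in>S. m' \<noteq> m \<longrightarrow> grevlex_less m' m" by blast
    with insert.hyps have "x \<noteq> m" by blast
    then consider "grevlex_less x m" | "grevlex_less m x"
      using grevlex_less_total by blast
    then show ?case
    proof cases
      case 1
      with m show ?thesis by (intro bexI[of _ m]) auto
    next
      case 2
      have "grevlex_less m' x" if "m' \<in> S" for m'
        using that m 2 grevlex_less_trans[of m' m x] by (cases "m' = m") simp_all
      then show ?thesis by (intro bexI[of _ x]) auto
    qed
  qed auto
  have "Poly_Mapping.keys p \<noteq> {}" using assms by simp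
  from max[OF finite_keys this]
  obtain m where m: "m \<in> Poly_Mapping.keys p"
    "\<forall>m'\<in>Poly_Mapping.keys p. m' \<noteq> m \<longrightarrow> grevlex_less m' m"
    by blast
  show ?thesis
  proof (intro ex1I[of _ m] conjI)
    fix m'
    assume m': "m' \<in> Poly_Mapping.keys p \<and> (\<forall>m''\<in>Poly_Mapping.keys p. m'' \<noteq> m' \<longrightarrow> grevlex_less m'' m')"
    show "m' = m"
      using m m' grevlex_less_asym[of m m'] by metis
  qed (use m in auto)
qed

end

theory Submission
  imports Defs "Jordan_Normal_Form.Determinant"
begin

text \<open>
  Put \<open>\<sigma>_i = \<Sum>j\<le>i. (d j - 1)\<close>. Starting from \<open>B_0 = {1}\<close>, let \<open>B_{i+1}\<close> consist of the monomials
  \<open>b x_{i+1}^j\<close> with \<open>b \<in> B_i\<close> and \<open>j < d_{i+1} + \<sigma>_i - 2 deg b\<close>, except that the string over the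
  largest \<open>b\<close> of degree \<open>d_{i+1}\<close> is empty if \<open>d_{i+1} < \<sigma>_i\<close>. The strings are symmetric about \<open>\<sigma>_{i+1} / 2\<close>,
  and, because \<open>d_{i+1} \<ge> \<sigma>_i - 2\<close>, in each degree they are what remains of \<open>B_i \<cdot> {x_{i+1}^j}\<close> after
  its largest elements are removed. Hence the complement of \<open>B_n\<close> is almost reverse
  lexicographic, and it remains to see that \<open>B_n\<close> is the set of standard monomials.

  That \<open>B_i\<close> spans the quotient by \<open>i\<close> generic forms in \<open>i\<close> variables is an open condition on the
  coefficients, so one suitable specialisation suffices. Since \<open>x_i\<close> acts on the strings of
  \<open>B_i\<close> like a strong Lefschetz element, one may take \<open>f_{i+1}\<close> to be a binary form in \<open>x_i\<close> and \<open>x_{i+1}\<close>.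
  Linear independence follows by counting: modulo the first \<open>i\<close> forms, the multiples of \<open>f_{i+1}\<close> in
  degree \<open>e\<close> are spanned by as many elements as there are old standard monomials of degree
  \<open>e - d_{i+1}\<close>, and by the symmetry this is the number of monomials removed in degree \<open>e\<close>.
\<close>

subsection \<open>Matrices with algebraically independent entries\<close>

text \<open>Write \<open>d\<close> for the degree of the new form and \<open>sigma\<close> for the
  socle degree of the earlier ones. The length \<open>d + sigma - 2 deg b\<close> comes from a
  count: each old standard monomial of degree \<open>l\<close> should yield one new leading monomial
  of degree \<open>d + l\<close>. By symmetry it can be charged to a \<open>b\<close> of degree
  \<open>sigma - l\<close>, whose string is then cut in degree
  \<open>d + l = d + sigma - deg b\<close>. If \<open>d < sigma\<close>, this fails for the monomial
  1: its partner, of degree \<open>sigma\<close>, cannot be cut in degree \<open>d\<close>. The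
  largest old standard monomial of degree \<open>d\<close> is removed instead, and
  \<open>sigma - d \<le> 2\<close> ensures that one such exchange suffices. Spanning is checked only
  for \<open>i\<close> forms in \<open>i\<close> variables, where specialisations can be written
  down. Further variables are adjoined one at a time, because a multiple of the last variable is
  smaller than a monomial of the same degree that is free of it. Specialised coefficients may be any
  field elements, even generic ones: the determinants involved have integer coefficients, so they
  are polynomials over \<open>F\<close>.\<close>

lemma right_inverse_imp_left_inverse:
  fixes A B :: "'s \<Rightarrow> 's \<Rightarrow> 'a::field"
  assumes fin: "finite S"
    and AB: "\<And>s t. s \<in> S \<Longrightarrow> t \<in> S \<Longrightarrow> (\<Sum>u\<in>S. A s u * B u t) = (if s = t then 1 else 0)"
    and st: "s \<in> S" "t \<in> S"
  shows "(\<Sum>u\<in>S. B s u * A u t) = (if s = t then 1 else 0)"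
proof -
  obtain h where h: "bij_betw h {0..<card S} S"
    using ex_bij_betw_nat_finite[OF fin] by blast
  let ?n = "card S"
  let ?M = "\<lambda>C. mat ?n ?n (\<lambda>(i, j). C (h i) (h j)) :: 'a mat"
  have re: "(\<Sum>k = 0..<?n. g (h k)) = (\<Sum>u\<in>S. g u)" for g :: "'s \<Rightarrow> 'a"
    using sum.reindex_bij_betw[OF h] .
  have hS: "h i \<in> S" if "i < ?n" for i
    using h that by (auto simp: bij_betw_def)
  have inj: "h i = h j \<longleftrightarrow> i = j" if "i < ?n" "j < ?n" for i j
    using h that inj_on_eq_iff[of h "{0..<?n}" i j] by (simp add: bij_betw_def)
  have prod: "(?M C * ?M D) $$ (i, j) = (\<Sum>u\<in>S. C (h i) u * D u (h j))"
    if "i < ?n" "j < ?n" for C D i j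
    using that by (simp add: scalar_prod_def re[symmetric])
  have "?M A * ?M B = 1\<^sub>m ?n"
  proof (rule eq_matI)
    fix i j assume "i < dim_row (1\<^sub>m ?n :: 'a mat)" "j < dim_col (1\<^sub>m ?n :: 'a mat)"
    then have ij: "i < ?n" "j < ?n" by simp_all
    show "(?M A * ?M B) $$ (i, j) = 1\<^sub>m ?n $$ (i, j)"
      unfolding prod[OF ij] AB[OF hS[OF ij(1)] hS[OF ij(2)]] inj[OF ij] using ij by simp
  qed simp_all
  then have BA: "?M B * ?M A = 1\<^sub>m ?n"
    by (intro mat_mult_left_right_inverse[of "?M A" ?n]) simp_all
  have "s \<in> h ` {0..<?n}" "t \<in> h ` {0..<?n}"
    using h st by (simp_all add: bij_betw_def)
  then obtain i j where "i < ?n" "j < ?n" "h i = s" "h j = t"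
    by auto
  then show ?thesis
    using prod[of i j B A] inj[of i j] unfolding BA by auto
qed

text \<open>An injection of \<open>U\<close> into \<open>T\<close>, with zero padding outside its
  image, makes both matrices square. The right inverse \<open>V\<close> is then also a left inverse,
  so a row vector killed by it vanishes. This is how a cardinality bound becomes linear
  independence.\<close>

lemma left_kernel_trivial_of_right_inverse:
  fixes A :: "'t \<Rightarrow> 'u \<Rightarrow> 'a::field" and V :: "'u \<Rightarrow> 't \<Rightarrow> 'a"
  assumes fin: "finite T" "finite U" and card: "card U \<le> card T"
    and AV: "\<And>s t. s \<in> T \<Longrightarrow> t \<in> T \<Longrightarrow> (\<Sum>u\<in>U. A s u * V u t) = (if s = t then 1 else 0)"
    and b: "\<And>t. t \<in> T \<Longrightarrow> (\<Sum>u\<in>U. b u * V u t) = 0"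
    and u: "u \<in> U"
  shows "b u = 0"
proof -
  obtain h where h: "h ` U \<subseteq> T" "inj_on h U"
    using card_le_inj[OF fin(2,1) card] by blast
  define r where "r = the_inv_into U h"
  have r: "r (h u) = u" if "u \<in> U" for u
    using that h(2) by (simp add: r_def the_inv_into_f_f)
  have sub: "(\<Sum>s\<in>T. if s \<in> h ` U then g (r s) else 0) = (\<Sum>u\<in>U. g u)" for g :: "'u \<Rightarrow> 'a"
  proof -
    have "(\<Sum>s\<in>T. if s \<in> h ` U then g (r s) else 0) = (\<Sum>s\<in>h ` U. g (r s))"
      using h(1) fin by (simp add: sum.If_cases Int_absorb1)
    also have "\<dots> = (\<Sum>u\<in>U. g u)"
      using h(2) by (subst sum.reindex) (auto simp: r)
    finally show ?thesis .
  qed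
  define A' where "A' = (\<lambda>t s. if s \<in> h ` U then A t (r s) else 0)"
  define V' where "V' = (\<lambda>s t. if s \<in> h ` U then V (r s) t else 0)"
  define b' where "b' = (\<lambda>s. if s \<in> h ` U then b (r s) else 0)"
  have A'V': "(\<Sum>s\<in>T. A' t s * V' s t') = (\<Sum>u\<in>U. A t u * V u t')" for t t'
    unfolding sub[symmetric] by (intro sum.cong) (auto simp: A'_def V'_def)
  have b'V': "(\<Sum>s\<in>T. b' s * V' s t) = (\<Sum>u\<in>U. b u * V u t)" for t
    unfolding sub[symmetric] by (intro sum.cong) (auto simp: b'_def V'_def)
  have left: "(\<Sum>s\<in>T. V' t s * A' s t') = (if t = t' then 1 else 0)" if "t \<in> T" "t' \<in> T" for t t'
    by (rule right_inverse_imp_left_inverse) (use that fin A'V' AV in auto)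
  have hu: "h u \<in> T"
    using u h by auto
  have "b' (h u) = (\<Sum>s\<in>T. if s = h u then b' s else 0)"
    using hu fin by (simp add: sum.delta)
  also have "\<dots> = (\<Sum>s\<in>T. b' s * (if s = h u then 1 else 0))"
    by (intro sum.cong) simp_all
  also have "\<dots> = (\<Sum>s\<in>T. b' s * (\<Sum>t\<in>T. V' s t * A' t (h u)))"
    using hu by (intro sum.cong) (simp_all add: left)
  also have "\<dots> = (\<Sum>t\<in>T. (\<Sum>s\<in>T. b' s * V' s t) * A' t (h u))"
    by (simp add: sum_distrib_left sum_distrib_right mult.assoc) (rule sum.swap)
  also have "\<dots> = 0"
    by (simp add: b'V' b)
  finally show ?thesis
    using u by (simp add: b'_def r)
qed

section \<open>Polynomials in the coefficient variables and their determinants\<close>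

lemma poly_eval_superset:
  assumes "finite A" "Poly_Mapping.keys p \<subseteq> A"
  shows "poly_eval c p = (\<Sum>m\<in>A. Poly_Mapping.lookup p m *
     (\<Prod>v\<in>Poly_Mapping.keys m. c v ^ Poly_Mapping.lookup m v))"
  unfolding poly_eval_def using assms
  by (intro sum.mono_neutral_left) (auto simp: in_keys_iff)

lemma poly_eval_add: "poly_eval c (p + q) = poly_eval c p + poly_eval c q"
proof -
  let ?A = "Poly_Mapping.keys p \<union> Poly_Mapping.keys q"
  have "Poly_Mapping.keys (p + q) \<subseteq> ?A"
    by (rule Poly_Mapping.keys_add)
  then show ?thesis
    by (simp add: poly_eval_superset[of ?A] lookup_add distrib_right sum.distrib)
qed

lemma poly_eval_zero [simp]: "poly_eval c 0 = 0"
  by (simp add: poly_eval_def)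

lemma poly_eval_sum: "poly_eval c (\<Sum>x\<in>X. g x) = (\<Sum>x\<in>X. poly_eval c (g x))"
  by (induction X rule: infinite_finite_induct) (simp_all add: poly_eval_add)

lemma poly_eval_single:
  "poly_eval c (Poly_Mapping.single m a) =
    a * (\<Prod>v\<in>Poly_Mapping.keys m. c v ^ Poly_Mapping.lookup m v)"
  by (simp add: poly_eval_def)

lemma monomial_eval_sum_single:
  fixes c :: "'v \<Rightarrow> 'a::comm_semiring_1"
  assumes "finite I" and m: "m = (\<Sum>i\<in>I. Poly_Mapping.single (w i) (1::nat))"
  shows "(\<Prod>v\<in>Poly_Mapping.keys m. c v ^ Poly_Mapping.lookup m v) = (\<Prod>i\<in>I. c (w i))"
proof -
  have k: "Poly_Mapping.keys m \<subseteq> w ` I"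
    unfolding m using keys_sum[of "\<lambda>i. Poly_Mapping.single (w i) (1::nat)" I] by auto
  have l: "Poly_Mapping.lookup m v = card {i \<in> I. w i = v}" for v
    using assms(1) unfolding m
    by (simp add: lookup_sum lookup_single when_def sum.If_cases Int_def)
  have "(\<Prod>v\<in>Poly_Mapping.keys m. c v ^ Poly_Mapping.lookup m v) =
      (\<Prod>v\<in>w ` I. c v ^ Poly_Mapping.lookup m v)"
    using assms(1) k by (intro prod.mono_neutral_left) (auto simp: in_keys_iff)
  also have "\<dots> = (\<Prod>v\<in>w ` I. \<Prod>i | i \<in> I \<and> w i = v. c (w i))"
    by (simp add: l)
  also have "\<dots> = (\<Prod>i\<in>I. c (w i))"
    by (rule prod.group[symmetric, THEN sym]) (use assms(1) in auto)
  finally show ?thesis .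
qed

lemma alg_indep_mono: "alg_indep F A c \<Longrightarrow> B \<subseteq> A \<Longrightarrow> alg_indep F B c"
  unfolding alg_indep_def by blast

text \<open>\<open>None\<close> stands for an entry that is identically zero, \<open>Some v\<close>
  for the indeterminate \<open>v\<close>. Determinants of matrices with such entries have integer
  coefficients.\<close>

definition entry_eval :: "('v \<Rightarrow> 'a::zero) \<Rightarrow> 'v option \<Rightarrow> 'a" where
  "entry_eval c x = (case x of None \<Rightarrow> 0 | Some v \<Rightarrow> c v)"

lemma is_subfield_sum: "is_subfield F \<Longrightarrow> (\<And>x. x \<in> X \<Longrightarrow> g x \<in> F) \<Longrightarrow> (\<Sum>x\<in>X. g x) \<in> F"
  by (induction X rule: infinite_finite_induct) (auto simp: is_subfield_def)

text \<open>The Leibniz expansion is a polynomial whose coefficients are sums of signs, hence lie in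
  \<open>F\<close> wherever the values of \<open>c0\<close> lie. It is nonzero because its value at
  \<open>c0\<close> is, so it cannot vanish at algebraically independent elements.\<close>

lemma det_specialization_nonzero:
  fixes c c0 :: "'v \<Rightarrow> 'a::field" and q :: "nat \<Rightarrow> nat \<Rightarrow> 'v option"
  assumes F: "is_subfield F" and indep: "alg_indep F A c"
    and q: "\<And>i j v. i < n \<Longrightarrow> j < n \<Longrightarrow> q i j = Some v \<Longrightarrow> v \<in> A"
    and nz: "det (mat n n (\<lambda>(i, j). entry_eval c0 (q i j))) \<noteq> 0"
  shows "det (mat n n (\<lambda>(i, j). entry_eval c (q i j))) \<noteq> 0"
proof -
  \<comment> \<open>\<open>ok\<close> selects the permutations that avoid zero entries;
    \<open>mo\<close> is the monomial such a permutation contributes.\<close>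
  define ok where "ok = (\<lambda>\<pi>. \<forall>i<n. q i (\<pi> i) \<noteq> None)"
  define mo where "mo = (\<lambda>\<pi>. \<Sum>i\<in>{0..<n}. Poly_Mapping.single (the (q i (\<pi> i))) (1::nat))"
  define P where "P = {\<pi>. \<pi> permutes {0..<n}}"
  define p :: "('v \<Rightarrow>\<^sub>0 nat) \<Rightarrow>\<^sub>0 'a" where
    "p = (\<Sum>\<pi>\<in>P. if ok \<pi> then Poly_Mapping.single (mo \<pi>) (signof \<pi>) else 0)"
  have ev: "poly_eval g p = det (mat n n (\<lambda>(i, j). entry_eval g (q i j)))" for g
  proof -
    have "poly_eval g (if ok \<pi> then Poly_Mapping.single (mo \<pi>) (signof \<pi>) else 0) =
      signof \<pi> * (\<Prod>i = 0..<n. mat n n (\<lambda>(i, j). entry_eval g (q i j)) $$ (i, \<pi> i))"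
      if "\<pi> \<in> P" for \<pi>
    proof -
      have lt: "\<pi> i < n" if "i < n" for i
        using \<open>\<pi> \<in> P\<close> that permutes_in_image[of \<pi> "{0..<n}" i] by (simp add: P_def)
      show ?thesis
      proof (cases "ok \<pi>")
        case True
        then show ?thesis
          by (auto simp: poly_eval_single monomial_eval_sum_single[OF _ mo_def[THEN fun_cong]]
              lt ok_def entry_eval_def intro!: prod.cong)
      next
        case False
        then obtain i where "i < n" "q i (\<pi> i) = None"
          by (auto simp: ok_def)
        then have "(\<Prod>i = 0..<n. mat n n (\<lambda>(i, j). entry_eval g (q i j)) $$ (i, \<pi> i)) = 0"
          by (intro prod_zero) (auto simp: lt entry_eval_def intro!: bexI[of _ i])
        with False show ?thesis by simp
      qed
    qed
    then show ?thesis
      unfolding p_def poly_eval_sum det_def by (auto simp: P_def intro!: sum.cong)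
  qed
  \<comment> \<open>Several permutations may give the same monomial and cancel, so nonvanishing is
    read off from the value at \<open>c0\<close>.\<close>
  have "p \<noteq> 0"
    using nz ev[of c0] by auto
  moreover have "Poly_Mapping.keys m \<subseteq> A" if "m \<in> Poly_Mapping.keys p" for m
  proof -
    have "m \<in> (\<Union>\<pi>\<in>P. Poly_Mapping.keys (if ok \<pi> then Poly_Mapping.single (mo \<pi>) (signof \<pi> :: 'a) else 0))"
      using subsetD[OF keys_sum that[unfolded p_def]] .
    then obtain \<pi> where pi: "\<pi> \<in> P" "ok \<pi>" "m = mo \<pi>"
      by (auto split: if_splits)
    have "the (q i (\<pi> i)) \<in> A" if "i < n" for i
      using that pi q[of i "\<pi> i"] permutes_in_image[of \<pi> "{0..<n}" i]
      by (auto simp: ok_def P_def)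
    moreover have "Poly_Mapping.keys m \<subseteq> (\<lambda>i. the (q i (\<pi> i))) ` {0..<n}"
      unfolding pi(3) mo_def
      using keys_sum[of "\<lambda>i. Poly_Mapping.single (the (q i (\<pi> i))) (1::nat)" "{0..<n}"] by auto
    ultimately show ?thesis by auto
  qed
  moreover have "Poly_Mapping.lookup p m \<in> F" for m
    unfolding p_def lookup_sum
    by (rule is_subfield_sum[OF F])
       (use F in \<open>auto simp: lookup_single when_def sign_def is_subfield_def\<close>)
  ultimately have "poly_eval c p \<noteq> 0"
    using indep unfolding alg_indep_def by blast
  then show ?thesis
    by (simp add: ev)
qed

text \<open>
  Expanding the determinant of \<open>lam * Q = 1\<close> along its rows selects a square submatrix
  of \<open>Q\<close> that is invertible at \<open>c0\<close>; it stays invertible at \<open>c\<close>.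
\<close>

lemma generic_left_inverse:
  fixes c c0 :: "'v \<Rightarrow> 'a::field" and q :: "'g \<Rightarrow> 's \<Rightarrow> 'v option"
  assumes F: "is_subfield F" and indep: "alg_indep F A c"
    and fin: "finite S" "finite G"
    and q: "\<And>g s v. g \<in> G \<Longrightarrow> s \<in> S \<Longrightarrow> q g s = Some v \<Longrightarrow> v \<in> A"
    and special: "\<And>s t. s \<in> S \<Longrightarrow> t \<in> S \<Longrightarrow>
      (\<Sum>g\<in>G. lam s g * entry_eval c0 (q g t)) = (if s = t then 1 else 0)"
  shows "\<exists>lam'. \<forall>s\<in>S. \<forall>t\<in>S.
      (\<Sum>g\<in>G. lam' s g * entry_eval c (q g t)) = (if s = t then 1 else 0)"
proof -
  let ?n = "card S"
  obtain h where h: "bij_betw h {0..<?n} S"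
    using ex_bij_betw_nat_finite[OF fin(1)] by blast
  have hS: "h i \<in> S" if "i < ?n" for i
    using h that by (auto simp: bij_betw_def)
  have inj: "h i = h j \<longleftrightarrow> i = j" if "i < ?n" "j < ?n" for i j
    using h that inj_on_eq_iff[of h "{0..<?n}" i j] by (simp add: bij_betw_def)
  define M where "M = (\<lambda>c \<gamma>. mat ?n ?n (\<lambda>(i, j). entry_eval c (q (\<gamma> i) (h j))) :: 'a mat)"
  define PG where "PG = PiE {0..<?n} (\<lambda>_. G)"
  define P where "P = {\<pi>. \<pi> permutes {0..<?n}}"
  have perm: "\<pi> i < ?n" if "\<pi> permutes {0..<?n}" "i < ?n" for \<pi> i
    using that permutes_in_image[of \<pi> "{0..<?n}" i] by simp
  have "1 = det (1\<^sub>m ?n :: 'a mat)"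
    by simp
  also have "1\<^sub>m ?n = mat ?n ?n (\<lambda>(i, j). \<Sum>g\<in>G. lam (h i) g * entry_eval c0 (q g (h j)))"
    by (intro eq_matI) (simp_all add: special hS inj)
  also have "det \<dots> = (\<Sum>\<pi>\<in>P. signof \<pi> *
      (\<Prod>i = 0..<?n. \<Sum>g\<in>G. lam (h i) g * entry_eval c0 (q g (h (\<pi> i)))))"
    unfolding det_def P_def by (auto simp: perm intro!: sum.cong prod.cong)
  also have "\<dots> = (\<Sum>\<pi>\<in>P. \<Sum>\<gamma>\<in>PG. signof \<pi> *
      (\<Prod>i = 0..<?n. lam (h i) (\<gamma> i) * entry_eval c0 (q (\<gamma> i) (h (\<pi> i)))))"
    using fin by (simp add: prod_sum_PiE PG_def sum_distrib_left)
  also have "\<dots> = (\<Sum>\<gamma>\<in>PG. \<Sum>\<pi>\<in>P. signof \<pi> *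
      (\<Prod>i = 0..<?n. lam (h i) (\<gamma> i) * entry_eval c0 (q (\<gamma> i) (h (\<pi> i)))))"
    by (rule sum.swap)
  also have "\<dots> = (\<Sum>\<gamma>\<in>PG. (\<Prod>i = 0..<?n. lam (h i) (\<gamma> i)) * det (M c0 \<gamma>))"
    unfolding det_def M_def P_def
    by (auto simp: perm prod.distrib sum_distrib_left mult_ac intro!: sum.cong prod.cong)
  finally obtain \<gamma> where \<gamma>: "\<gamma> \<in> PG" "det (M c0 \<gamma>) \<noteq> 0"
    by (metis (no_types, lifting) mult_zero_right sum.neutral zero_neq_one)
  have "\<gamma> i \<in> G" if "i < ?n" for i
    using \<gamma>(1) that by (auto simp: PG_def)
  note \<gamma>G = this
  define D where "D = det (M c \<gamma>)"
  have D: "D \<noteq> 0"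
    unfolding D_def M_def
  proof (rule det_specialization_nonzero[OF F indep, of _ _ c0])
    show "v \<in> A" if "i < ?n" "j < ?n" "q (\<gamma> i) (h j) = Some v" for i j v
      using q[OF \<gamma>G[OF that(1)] hS[OF that(2)] that(3)] .
  qed (use \<gamma>(2) in \<open>simp add: M_def\<close>)
  define N where "N = adj_mat (M c \<gamma>)"
  have MC: "M c \<gamma> \<in> carrier_mat ?n ?n"
    by (simp add: M_def)
  have NM: "N \<in> carrier_mat ?n ?n" "N * M c \<gamma> = D \<cdot>\<^sub>m 1\<^sub>m ?n"
    using adj_mat[OF MC] by (simp_all add: N_def D_def)
  define r where "r = the_inv_into {0..<?n} h"
  have r: "r s < ?n" "h (r s) = s" if "s \<in> S" for s
    using that h the_inv_into_into[of h "{0..<?n}" s "{0..<?n}"]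
    by (auto simp: r_def bij_betw_def f_the_inv_into_f)
  \<comment> \<open>The adjugate divided by the determinant inverts the chosen submatrix; summing
    over the fibre of \<open>\<gamma>\<close> converts its column indices back to indices in
    \<open>G\<close>.\<close>
  define lam' where "lam' = (\<lambda>s g. (\<Sum>i | i \<in> {0..<?n} \<and> \<gamma> i = g. N $$ (r s, i)) / D)"
  show ?thesis
  proof (intro exI[of _ lam'] ballI)
    fix s t assume st: "s \<in> S" "t \<in> S"
    have "(\<Sum>g\<in>G. lam' s g * entry_eval c (q g t)) =
        (\<Sum>g\<in>G. \<Sum>i | i \<in> {0..<?n} \<and> \<gamma> i = g. N $$ (r s, i) * entry_eval c (q (\<gamma> i) t)) / D"
      by (simp add: lam'_def sum_divide_distrib sum_distrib_right)
    also have "\<dots> = (\<Sum>i = 0..<?n. N $$ (r s, i) * entry_eval c (q (\<gamma> i) t)) / D"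
      by (subst sum.group) (use fin \<gamma>G in auto)
    also have "(\<Sum>i = 0..<?n. N $$ (r s, i) * entry_eval c (q (\<gamma> i) t)) = (N * M c \<gamma>) $$ (r s, r t)"
      using NM(1) r st by (simp add: M_def scalar_prod_def)
    also have "\<dots> = D * (if r s = r t then 1 else 0)"
      using NM r st by simp
    also have "\<dots> / D = (if s = t then 1 else 0)"
    proof -
      have "r s = r t \<longleftrightarrow> s = t"
        by (metis r(2) st)
      with D show ?thesis by simp
    qed
    finally show "(\<Sum>g\<in>G. lam' s g * entry_eval c (q g t)) = (if s = t then 1 else 0)" .
  qed
qed

subsection \<open>Monomials and graded pieces of ideals\<close>

lemma mdeg_superset: "finite A \<Longrightarrow> Poly_Mapping.keys m \<subseteq> A \<Longrightarrow> mdeg m = (\<Sum>i\<in>A. Poly_Mapping.lookup m i)"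
  unfolding mdeg_def by (rule sum.mono_neutral_left) (auto simp: in_keys_iff)

lemma mdeg_add [simp]: "mdeg (a + b) = mdeg a + mdeg b"
proof -
  let ?A = "Poly_Mapping.keys a \<union> Poly_Mapping.keys b"
  have "Poly_Mapping.keys (a + b) \<subseteq> ?A"
    by (rule Poly_Mapping.keys_add)
  then show ?thesis
    by (simp add: mdeg_superset[of ?A] lookup_add sum.distrib)
qed

lemma mdeg_zero [simp]: "mdeg 0 = 0"
  by (simp add: mdeg_def)

lemma mdeg_single [simp]: "mdeg (Poly_Mapping.single i j) = j"
  by (cases "j = 0") (simp_all add: mdeg_def)

lemma mdeg_eq_0_iff: "mdeg m = 0 \<longleftrightarrow> m = 0"
  by (auto simp: mdeg_def in_keys_iff intro: poly_mapping_eqI)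

lemma monomials_iff: "m \<in> monomials n \<longleftrightarrow> (\<forall>i. i \<notin> {1..n} \<longrightarrow> Poly_Mapping.lookup m i = 0)"
  by (auto simp: monomials_def in_keys_iff)

lemma zero_in_monomials [simp]: "0 \<in> monomials n"
  by (simp add: monomials_iff)

lemma monomials_add_iff [simp]: "a + b \<in> monomials n \<longleftrightarrow> a \<in> monomials n \<and> b \<in> monomials n"
  by (auto simp: monomials_iff lookup_add)

lemma single_in_monomials: "1 \<le> i \<Longrightarrow> i \<le> n \<Longrightarrow> Poly_Mapping.single i j \<in> monomials n"
  by (simp add: monomials_iff lookup_single when_def)

lemma monomials_mono: "n \<le> N \<Longrightarrow> m \<in> monomials n \<Longrightarrow> m \<in> monomials N"
  by (auto simp: monomials_iff)

lemma monomials_splitE: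
  assumes "m \<in> monomials N"
  obtains a w where "a \<in> monomials i" "Poly_Mapping.keys w \<subseteq> {i+1..N}" "m = a + w"
proof -
  define a where "a = (\<Sum>k\<in>Poly_Mapping.keys m \<inter> {..i}. Poly_Mapping.single k (Poly_Mapping.lookup m k))"
  have a: "Poly_Mapping.lookup a k = (if k \<le> i then Poly_Mapping.lookup m k else 0)" for k
    by (auto simp: a_def lookup_sum lookup_single when_def in_keys_iff)
  have "m = a + (m - a)"
    by (rule poly_mapping_eqI) (simp add: lookup_add lookup_minus a)
  moreover have "a \<in> monomials i"
    using assms by (auto simp: monomials_iff a)
  moreover have "Poly_Mapping.keys (m - a) \<subseteq> {i+1..N}"
  proof
    fix x assume "x \<in> Poly_Mapping.keys (m - a)"
    then have x: "i < x" "Poly_Mapping.lookup m x \<noteq> 0"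
      by (auto simp: in_keys_iff lookup_minus a split: if_splits)
    then have "x \<in> {1..N}"
      using assms by (auto simp: monomials_iff)
    with x show "x \<in> {i+1..N}" by simp
  qed
  ultimately show thesis
    using that by blast
qed

lemma monomials_split_unique:
  assumes "a \<in> monomials i" "b \<in> monomials i"
    and "Poly_Mapping.keys w \<subseteq> {i+1..N}" "Poly_Mapping.keys w' \<subseteq> {i+1..N}"
    and eq: "a + w = b + w'"
  shows "a = b" "w = w'"
proof -
  have *: "Poly_Mapping.lookup a k + Poly_Mapping.lookup w k = Poly_Mapping.lookup b k + Poly_Mapping.lookup w' k" for k
    using arg_cong[OF eq, of "\<lambda>m. Poly_Mapping.lookup m k"] by (simp add: lookup_add)
  have w: "Poly_Mapping.lookup w k = 0" "Poly_Mapping.lookup w' k = 0" if "k \<le> i" for k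
    using assms that by (auto simp: subset_iff in_keys_iff)
  have ab: "Poly_Mapping.lookup a k = 0" "Poly_Mapping.lookup b k = 0" if "\<not> k \<le> i" for k
    using assms that by (auto simp: monomials_iff)
  show "a = b"
    by (rule poly_mapping_eqI) (metis * w ab add_0_right)
  with eq show "w = w'" by simp
qed

lemma single_splitE:
  fixes w :: mon
  assumes "Poly_Mapping.keys w \<subseteq> {i+1..N}"
  obtains w' where "Poly_Mapping.keys w' \<subseteq> {i+2..N}"
    "w = Poly_Mapping.single (Suc i) (Poly_Mapping.lookup w (Suc i)) + w'"
proof -
  define w' where "w' = w - Poly_Mapping.single (Suc i) (Poly_Mapping.lookup w (Suc i))"
  have "w = Poly_Mapping.single (Suc i) (Poly_Mapping.lookup w (Suc i)) + w'"
    by (rule poly_mapping_eqI) (simp add: w'_def lookup_add lookup_minus lookup_single when_def)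
  moreover have "Poly_Mapping.keys w' \<subseteq> {i+2..N}"
  proof
    fix k assume "k \<in> Poly_Mapping.keys w'"
    then have k: "k \<noteq> Suc i" "k \<in> Poly_Mapping.keys w"
      by (auto simp: w'_def in_keys_iff lookup_minus lookup_single when_def split: if_splits)
    then have "k \<in> {i+1..N}" using assms by blast
    with k show "k \<in> {i+2..N}" by auto
  qed
  ultimately show thesis using that by blast
qed

lemma monomials_SucE:
  assumes "m \<in> monomials (Suc i)"
  obtains a j where "a \<in> monomials i" "m = a + Poly_Mapping.single (Suc i) j"
proof -
  obtain a w where a: "a \<in> monomials i" "Poly_Mapping.keys w \<subseteq> {i+1..Suc i}" "m = a + w"
    using monomials_splitE[OF assms] by blast
  obtain w' where w': "Poly_Mapping.keys w' \<subseteq> {i+2..Suc i}"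
    "w = Poly_Mapping.single (Suc i) (Poly_Mapping.lookup w (Suc i)) + w'"
    using single_splitE[OF a(2)] by blast
  then have "w' = 0" by simp
  with w' a show thesis using that by auto
qed

section \<open>The order on monomials, and supports of products\<close>

lemma grevlex_less_add_right [simp]: "grevlex_less (a + w) (b + w) \<longleftrightarrow> grevlex_less a b"
  by (simp add: grevlex_less_def lookup_add)

lemma grevlex_less_last:
  assumes "mdeg a = mdeg b" "a \<in> monomials (Suc i)" "b \<in> monomials (Suc i)"
    and "Poly_Mapping.lookup a (Suc i) > Poly_Mapping.lookup b (Suc i)"
  shows "grevlex_less a b"
  unfolding grevlex_less_def using assms
  by (intro disjI2 conjI exI[of _ "Suc i"]) (auto simp: monomials_iff)

text \<open>\<open>grevlex_less\<close> also compares monomials of different degrees; the reductions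
  below are homogeneous, so equality of degrees is built in.\<close>

definition grevlex_below :: "mon \<Rightarrow> mon \<Rightarrow> bool" where
  "grevlex_below a b \<longleftrightarrow> mdeg a = mdeg b \<and> (a = b \<or> grevlex_less a b)"

lemma grevlex_below_refl [simp]: "grevlex_below a a"
  by (simp add: grevlex_below_def)

lemma grevlex_below_trans: "grevlex_below a b \<Longrightarrow> grevlex_below b c \<Longrightarrow> grevlex_below a c"
  unfolding grevlex_below_def by (metis grevlex_less_trans)

lemma grevlex_below_add_right: "grevlex_below a b \<Longrightarrow> grevlex_below (a + w) (b + w)"
  by (auto simp: grevlex_below_def)

lemma grevlex_max_exists:
  assumes "finite S" "S \<noteq> {}"
  shows "\<exists>m\<in>S. \<forall>m'\<in>S. m' = m \<or> grevlex_less m' m"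
  using assms
proof (induction rule: finite_ne_induct)
  case (insert x S)
  then obtain m where m: "m \<in> S" "\<forall>m'\<in>S. m' = m \<or> grevlex_less m' m" by blast
  then show ?case
    using grevlex_less_total[of x m] grevlex_less_trans[of _ m x] by (metis insert_iff)
qed simp

lemma sum_singles: "p = (\<Sum>m\<in>Poly_Mapping.keys p. Poly_Mapping.single m (Poly_Mapping.lookup p m))"
  by (rule poly_mapping_eqI) (auto simp: lookup_sum lookup_single when_def in_keys_iff)

lemma keys_subsetI: "(\<And>m. m \<notin> X \<Longrightarrow> Poly_Mapping.lookup p m = 0) \<Longrightarrow> Poly_Mapping.keys p \<subseteq> X"
  by (metis in_keys_iff subsetI)

lemma lookup_eq_0: "Poly_Mapping.keys p \<subseteq> X \<Longrightarrow> m \<notin> X \<Longrightarrow> Poly_Mapping.lookup p m = 0"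
  by (auto simp: in_keys_iff)

lemma keys_single_mult:
  fixes p :: "'a::semiring_0 mpol"
  shows "Poly_Mapping.keys (Poly_Mapping.single \<mu> a * p) \<subseteq> (\<lambda>m. \<mu> + m) ` Poly_Mapping.keys p"
  using keys_mult[of "Poly_Mapping.single \<mu> a" p] by (auto split: if_splits)

lemma lookup_single_mult_add:
  fixes p :: "'a::semiring_0 mpol"
  shows "Poly_Mapping.lookup (Poly_Mapping.single \<mu> a * p) (\<mu> + m) = a * Poly_Mapping.lookup p m"
proof -
  have "Poly_Mapping.lookup (Poly_Mapping.single \<mu> a * p) (\<mu> + m) =
      Poly_Mapping.lookup (\<Sum>l\<in>Poly_Mapping.keys p. Poly_Mapping.single (\<mu> + l) (a * Poly_Mapping.lookup p l)) (\<mu> + m)"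
    by (subst (1) sum_singles[of p]) (simp only: sum_distrib_left mult_single)
  also have "\<dots> = a * Poly_Mapping.lookup p m"
    by (auto simp: lookup_sum lookup_single when_def in_keys_iff)
  finally show ?thesis .
qed

lemma lookup_mult_expand:
  fixes g p :: "'a::semiring_0 mpol"
  shows "Poly_Mapping.lookup (g * p) s =
    (\<Sum>\<mu>\<in>Poly_Mapping.keys g. Poly_Mapping.lookup (Poly_Mapping.single \<mu> (Poly_Mapping.lookup g \<mu>) * p) s)"
  by (subst (1) sum_singles[of g]) (simp only: sum_distrib_right lookup_sum)

text \<open>
  All forms share one coefficient family \<open>c\<close>: setting the variables after the \<open>N\<close>-th to zero restricts \<open>c\<close>
  to fewer monomials, so truncations of generic forms stay generic. \<open>gideal c i N e\<close> is the
  degree \<open>e\<close> part of the ideal of the first \<open>i\<close> forms.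
\<close>

locale form_degrees =
  fixes d :: "nat \<Rightarrow> nat"
begin

definition gform :: "(nat \<times> mon \<Rightarrow> 'a::field) \<Rightarrow> nat \<Rightarrow> nat \<Rightarrow> 'a mpol" where
  "gform c N j = (\<Sum>m\<in>monomials_deg N (d j). Poly_Mapping.single m (c (j, m)))"

text \<open>The additive form of the degree condition forces \<open>g j = 0\<close> when
  \<open>e < d j\<close>; a truncated difference would admit constants there.\<close>

definition gcoeffs :: "nat \<Rightarrow> nat \<Rightarrow> nat \<Rightarrow> (nat \<Rightarrow> 'a::field mpol) \<Rightarrow> bool" where
  "gcoeffs i N e g \<longleftrightarrow> (\<forall>j\<in>{1..i}. \<forall>\<mu>\<in>Poly_Mapping.keys (g j). \<mu> \<in> monomials N \<and> mdeg \<mu> + d j = e)"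

definition gideal :: "(nat \<times> mon \<Rightarrow> 'a::field) \<Rightarrow> nat \<Rightarrow> nat \<Rightarrow> nat \<Rightarrow> 'a mpol set" where
  "gideal c i N e = {p. \<exists>g. gcoeffs i N e g \<and> p = (\<Sum>j=1..i. g j * gform c N j)}"

text \<open>The sum need not be direct: that \<open>X\<close> spans modulo the ideal and that it is
  independent are proved separately.\<close>

definition gspan :: "(nat \<times> mon \<Rightarrow> 'a::field) \<Rightarrow> nat \<Rightarrow> nat \<Rightarrow> nat \<Rightarrow> mon set \<Rightarrow> 'a mpol set" where
  "gspan c i N e X = {p + q | p q. p \<in> gideal c i N e \<and> Poly_Mapping.keys q \<subseteq> X}"

lemma lookup_gform: "Poly_Mapping.lookup (gform c N j) m = (if m \<in> monomials_deg N (d j) then c (j, m) else 0)"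
  by (auto simp: gform_def lookup_sum lookup_single when_def finite_monomials_deg)

lemma keys_gform: "Poly_Mapping.keys (gform c N j) \<subseteq> monomials_deg N (d j)"
  by (rule keys_subsetI) (simp add: lookup_gform)

lemma gcoeffsD: "gcoeffs i N e g \<Longrightarrow> 1 \<le> j \<Longrightarrow> j \<le> i \<Longrightarrow> \<mu> \<in> Poly_Mapping.keys (g j) \<Longrightarrow>
    \<mu> \<in> monomials N \<and> mdeg \<mu> + d j = e"
  by (simp add: gcoeffs_def)

lemma gidealI:
  assumes "\<And>j \<mu>. 1 \<le> j \<Longrightarrow> j \<le> i \<Longrightarrow> \<mu> \<in> Poly_Mapping.keys (g j) \<Longrightarrow> \<mu> \<in> monomials N \<and> mdeg \<mu> + d j = e"
    and "p = (\<Sum>j=1..i. g j * gform c N j)"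
  shows "p \<in> gideal c i N e"
  unfolding gideal_def gcoeffs_def mem_Collect_eq
  by (intro exI[of _ g] conjI ballI) (use assms in auto)

lemma gidealE:
  assumes "p \<in> gideal c i N e"
  obtains g where "gcoeffs i N e g" "p = (\<Sum>j=1..i. g j * gform c N j)"
  using assms unfolding gideal_def by auto

lemma gideal_zero [simp]: "0 \<in> gideal c i N e"
  by (rule gidealI[of _ "\<lambda>_. 0"]) auto

lemma gideal_none [simp]: "gideal c 0 N e = {0}"
  by (auto simp: gideal_def gcoeffs_def)

lemma gideal_add:
  assumes "p \<in> gideal c i N e" "q \<in> gideal c i N e"
  shows "p + q \<in> gideal c i N e"
proof -
  obtain g where g: "gcoeffs i N e g"
    "p = (\<Sum>j=1..i. g j * gform c N j)" using assms(1) by (rule gidealE)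
  obtain h where h: "gcoeffs i N e h"
    "q = (\<Sum>j=1..i. h j * gform c N j)" using assms(2) by (rule gidealE)
  show ?thesis
  proof (rule gidealI[of _ "\<lambda>j. g j + h j"])
    fix j \<mu> assume "1 \<le> j" "j \<le> i" "\<mu> \<in> Poly_Mapping.keys (g j + h j)"
    then show "\<mu> \<in> monomials N \<and> mdeg \<mu> + d j = e"
      using Poly_Mapping.keys_add[of "g j" "h j"] gcoeffsD[OF g(1), of j \<mu>] gcoeffsD[OF h(1), of j \<mu>] by blast
  qed (simp add: g(2) h(2) distrib_right sum.distrib)
qed

lemma gideal_single_mult:
  assumes "p \<in> gideal c i N e" "\<mu> \<in> monomials N"
  shows "Poly_Mapping.single \<mu> a * p \<in> gideal c i N (mdeg \<mu> + e)"
proof -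
  obtain g where g: "gcoeffs i N e g"
    "p = (\<Sum>j=1..i. g j * gform c N j)" using assms(1) by (rule gidealE)
  show ?thesis
  proof (rule gidealI[of _ "\<lambda>j. Poly_Mapping.single \<mu> a * g j"])
    fix j \<nu> assume j: "1 \<le> j" "j \<le> i" and "\<nu> \<in> Poly_Mapping.keys (Poly_Mapping.single \<mu> a * g j)"
    then obtain m where "m \<in> Poly_Mapping.keys (g j)" "\<nu> = \<mu> + m"
      using keys_single_mult by blast
    then show "\<nu> \<in> monomials N \<and> mdeg \<nu> + d j = mdeg \<mu> + e"
      using gcoeffsD[OF g(1) j] assms(2) by (auto simp: add.assoc)
  qed (simp add: g(2) sum_distrib_left mult.assoc)
qed

lemma gideal_smult: "p \<in> gideal c i N e \<Longrightarrow> Poly_Mapping.single 0 a * p \<in> gideal c i N e"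
  using gideal_single_mult[of p c i N e 0 a] by simp

lemma single_zero_minus_one_mult: "Poly_Mapping.single 0 (-1) * p = - (p :: 'a::field mpol)"
  by (simp add: single_uminus)

lemma gideal_uminus: "p \<in> gideal c i N e \<Longrightarrow> - p \<in> gideal c i N e"
  using gideal_smult[of p c i N e "-1"] by (simp add: single_zero_minus_one_mult)

lemma gideal_diff: "p \<in> gideal c i N e \<Longrightarrow> q \<in> gideal c i N e \<Longrightarrow> p - q \<in> gideal c i N e"
  using gideal_add[of p c i N e "- q"] gideal_uminus by fastforce

lemma gideal_sum: "(\<And>x. x \<in> X \<Longrightarrow> g x \<in> gideal c i N e) \<Longrightarrow> (\<Sum>x\<in>X. g x) \<in> gideal c i N e"
  by (induction X rule: infinite_finite_induct) (auto intro: gideal_add)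

lemma gideal_generator:
  assumes "1 \<le> j" "j \<le> i" "\<mu> \<in> monomials N"
  shows "Poly_Mapping.single \<mu> a * gform c N j \<in> gideal c i N (mdeg \<mu> + d j)"
proof (rule gidealI[of _ "\<lambda>k. if k = j then Poly_Mapping.single \<mu> a else 0"])
  show "Poly_Mapping.single \<mu> a * gform c N j =
      (\<Sum>k = 1..i. (if k = j then Poly_Mapping.single \<mu> a else 0) * gform c N k)"
    using assms by (simp add: if_distrib[of "\<lambda>x. x * _"] cong: if_cong)
qed (use assms in \<open>auto split: if_splits\<close>)

lemma gideal_keys: "p \<in> gideal c i N e \<Longrightarrow> Poly_Mapping.keys p \<subseteq> monomials_deg N e"
proof
  fix m assume p: "p \<in> gideal c i N e" and m: "m \<in> Poly_Mapping.keys p"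
  obtain g where g: "gcoeffs i N e g"
    "p = (\<Sum>j=1..i. g j * gform c N j)" using p by (rule gidealE)
  obtain j where j: "j \<in> {1..i}" "m \<in> Poly_Mapping.keys (g j * gform c N j)"
    using subsetD[OF keys_sum m[unfolded g(2)]] by blast
  then obtain a b where "a \<in> Poly_Mapping.keys (g j)" "b \<in> Poly_Mapping.keys (gform c N j)" "m = a + b"
    using keys_mult by blast
  then show "m \<in> monomials_deg N e"
    using gcoeffsD[OF g(1), of j a] j(1) keys_gform[of c N j] by (auto simp: monomials_deg_def)
qed

lemma gideal_mono:
  assumes "i \<le> i'" "p \<in> gideal c i N e" shows "p \<in> gideal c i' N e"
proof -
  obtain g where g: "gcoeffs i N e g"
    "p = (\<Sum>j=1..i. g j * gform c N j)" using assms(2) by (rule gidealE)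
  show ?thesis
  proof (rule gidealI[of _ "\<lambda>j. if j \<le> i then g j else 0"])
    have "p = (\<Sum>j\<in>{1..i}. (if j \<le> i then g j else 0) * gform c N j)"
      unfolding g(2) by (rule sum.cong) auto
    also have "\<dots> = (\<Sum>j\<in>{1..i'}. (if j \<le> i then g j else 0) * gform c N j)"
      using assms(1) by (intro sum.mono_neutral_left) auto
    finally show "p = (\<Sum>j = 1..i'. (if j \<le> i then g j else 0) * gform c N j)" .
  qed (use gcoeffsD[OF g(1)] in \<open>auto split: if_splits\<close>)
qed

lemma gspanI: "p \<in> gideal c i N e \<Longrightarrow> Poly_Mapping.keys q \<subseteq> X \<Longrightarrow> p + q \<in> gspan c i N e X"
  unfolding gspan_def by blast

lemma gspanE:
  assumes "r \<in> gspan c i N e X"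
  obtains p q where "p \<in> gideal c i N e" "Poly_Mapping.keys q \<subseteq> X" "r = p + q"
  using assms unfolding gspan_def by blast

lemma gspan_gideal: "p \<in> gideal c i N e \<Longrightarrow> p \<in> gspan c i N e X"
  using gspanI[of p c i N e 0 X] by simp

lemma gspan_keys: "Poly_Mapping.keys q \<subseteq> X \<Longrightarrow> q \<in> gspan c i N e X"
  using gspanI[of 0 c i N e q X] by simp

lemma gspan_mono: "X \<subseteq> Y \<Longrightarrow> p \<in> gspan c i N e X \<Longrightarrow> p \<in> gspan c i N e Y"
  unfolding gspan_def by blast

lemma gspan_mono_gideal: "i \<le> i' \<Longrightarrow> p \<in> gspan c i N e X \<Longrightarrow> p \<in> gspan c i' N e X"
  unfolding gspan_def using gideal_mono by blast

lemma gspan_add: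
  assumes "p \<in> gspan c i N e X" "q \<in> gspan c i N e X"
  shows "p + q \<in> gspan c i N e X"
proof -
  obtain p1 q1 where 1: "p1 \<in> gideal c i N e" "Poly_Mapping.keys q1 \<subseteq> X" "p = p1 + q1"
    using assms(1) by (rule gspanE)
  obtain p2 q2 where 2: "p2 \<in> gideal c i N e" "Poly_Mapping.keys q2 \<subseteq> X" "q = p2 + q2"
    using assms(2) by (rule gspanE)
  have "Poly_Mapping.keys (q1 + q2) \<subseteq> X"
    using 1 2 Poly_Mapping.keys_add[of q1 q2] by blast
  from gspanI[OF gideal_add[OF 1(1) 2(1)] this] show ?thesis
    by (simp add: 1 2 algebra_simps)
qed

lemma gspan_single_mult:
  assumes "p \<in> gspan c i N e X" "\<mu> \<in> monomials N" "\<And>x. x \<in> X \<Longrightarrow> \<mu> + x \<in> Y"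
  shows "Poly_Mapping.single \<mu> a * p \<in> gspan c i N (mdeg \<mu> + e) Y"
proof -
  obtain p1 q1 where 1: "p1 \<in> gideal c i N e" "Poly_Mapping.keys q1 \<subseteq> X" "p = p1 + q1"
    using assms(1) by (rule gspanE)
  have "Poly_Mapping.keys (Poly_Mapping.single \<mu> a * q1) \<subseteq> Y"
    using keys_single_mult[of \<mu> a q1] 1(2) assms(3) by blast
  from gspanI[OF gideal_single_mult[OF 1(1) assms(2), of a] this] show ?thesis
    by (simp add: 1 distrib_left)
qed

lemma gspan_smult: "p \<in> gspan c i N e X \<Longrightarrow> Poly_Mapping.single 0 a * p \<in> gspan c i N e X"
  using gspan_single_mult[of p c i N e X 0 X a] by simp

lemma gspan_diff:
  assumes "p \<in> gspan c i N e X" "q \<in> gspan c i N e X"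
  shows "p - q \<in> gspan c i N e X"
  using gspan_add[OF assms(1) gspan_smult[OF assms(2), of "-1"]]
  by (simp add: single_zero_minus_one_mult)

lemma gspan_sum: "(\<And>x. x \<in> A \<Longrightarrow> g x \<in> gspan c i N e X) \<Longrightarrow> (\<Sum>x\<in>A. g x) \<in> gspan c i N e X"
  by (induction A rule: infinite_finite_induct) (auto intro: gspan_add gspan_gideal)

lemma gspan_of_keys:
  assumes "\<And>m. m \<in> Poly_Mapping.keys r \<Longrightarrow> Poly_Mapping.single m 1 \<in> gspan c i N e X"
  shows "r \<in> gspan c i N e X"
proof -
  have "Poly_Mapping.single m (Poly_Mapping.lookup r m) \<in> gspan c i N e X" if "m \<in> Poly_Mapping.keys r" for m
    using gspan_smult[OF assms[OF that], of "Poly_Mapping.lookup r m"] by (simp add: mult_single)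
  then show ?thesis
    by (subst sum_singles) (rule gspan_sum)
qed

lemma gspan_trans:
  assumes "p \<in> gspan c i N e X" "\<And>x. x \<in> X \<Longrightarrow> Poly_Mapping.single x 1 \<in> gspan c i N e Y"
  shows "p \<in> gspan c i N e Y"
proof -
  obtain p1 q1 where 1: "p1 \<in> gideal c i N e" "Poly_Mapping.keys q1 \<subseteq> X" "p = p1 + q1"
    using assms(1) by (rule gspanE)
  have "q1 \<in> gspan c i N e Y"
    by (rule gspan_of_keys, rule assms(2)) (use 1(2) in auto)
  from gspan_add[OF gspan_gideal[OF 1(1)] this] show ?thesis
    by (simp add: 1(3))
qed

section \<open>Macaulay matrices and the transfer from special to generic coefficients\<close>

definition gindex :: "nat \<Rightarrow> nat \<Rightarrow> nat \<Rightarrow> (nat \<times> mon) set" where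
  "gindex i N e = (SIGMA j:{1..i}. {\<mu> \<in> monomials N. mdeg \<mu> + d j = e})"

text \<open>This is the Macaulay matrix: the row \<open>(j, \<mu>)\<close> is the multiple of the
  \<open>j\<close>-th form by \<open>\<mu>\<close>, and its entry in column \<open>s\<close> is the
  coefficient variable of the quotient \<open>s - \<mu>\<close>, or zero if there is no such
  quotient among the monomials of the form.\<close>

definition gentry :: "nat \<Rightarrow> nat \<times> mon \<Rightarrow> mon \<Rightarrow> (nat \<times> mon) option" where
  "gentry N = (\<lambda>(j, \<mu>) s. if \<exists>\<nu>\<in>monomials_deg N (d j). s = \<mu> + \<nu> then Some (j, s - \<mu>) else None)"

lemma finite_gindex: "finite (gindex i N e)"
proof -
  have "gindex i N e \<subseteq> (SIGMA j:{1..i}. monomials_deg N (e - d j))"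
    by (auto simp: gindex_def monomials_deg_def)
  then show ?thesis
    by (rule finite_subset) (auto simp: finite_monomials_deg)
qed

lemma lookup_single_mult_gform:
  "Poly_Mapping.lookup (Poly_Mapping.single \<mu> a * gform c N j) s = a * entry_eval c (gentry N (j, \<mu>) s)"
proof (cases "\<exists>\<nu>\<in>monomials_deg N (d j). s = \<mu> + \<nu>")
  case True
  then show ?thesis
    by (auto simp: gentry_def entry_eval_def lookup_single_mult_add lookup_gform)
next
  case False
  then have "s \<notin> Poly_Mapping.keys (Poly_Mapping.single \<mu> a * gform c N j)"
    using keys_single_mult[of \<mu> a "gform c N j"] keys_gform[of c N j] by blast
  with False show ?thesis
    by (simp add: gentry_def entry_eval_def in_keys_iff)
qed

lemma lookup_gideal_sum:
  assumes "gcoeffs i N e g"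
  shows "Poly_Mapping.lookup (\<Sum>j=1..i. g j * gform c N j) s =
    (\<Sum>x\<in>gindex i N e. Poly_Mapping.lookup (g (fst x)) (snd x) * entry_eval c (gentry N x s))"
proof -
  have fin: "finite {\<mu> \<in> monomials N. mdeg \<mu> + d j = e}" for j
    by (rule finite_subset[OF _ finite_monomials_deg[of N "e - d j"]]) (auto simp: monomials_deg_def)
  have "Poly_Mapping.lookup (g j * gform c N j) s =
      (\<Sum>\<mu> | \<mu> \<in> monomials N \<and> mdeg \<mu> + d j = e.
        Poly_Mapping.lookup (g j) \<mu> * entry_eval c (gentry N (j, \<mu>) s))"
    if "j \<in> {1..i}" for j
    unfolding trans[OF lookup_mult_expand sum.cong[OF refl lookup_single_mult_gform]]
  proof (rule sum.mono_neutral_left[OF fin])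
    show "Poly_Mapping.keys (g j) \<subseteq> {\<mu> \<in> monomials N. mdeg \<mu> + d j = e}"
      using assms that by (auto simp: gcoeffs_def)
  qed (simp add: in_keys_iff)
  then have "Poly_Mapping.lookup (\<Sum>j=1..i. g j * gform c N j) s =
      (\<Sum>j\<in>{1..i}. \<Sum>\<mu> | \<mu> \<in> monomials N \<and> mdeg \<mu> + d j = e.
        Poly_Mapping.lookup (g j) \<mu> * entry_eval c (gentry N (j, \<mu>) s))"
    unfolding lookup_sum by (rule sum.cong[OF refl])
  also have "\<dots> = (\<Sum>x\<in>gindex i N e. Poly_Mapping.lookup (g (fst x)) (snd x) * entry_eval c (gentry N x s))"
    unfolding gindex_def using fin by (subst sum.Sigma) (auto simp: split_def)
  finally show ?thesis .
qed

text \<open>Spanning by \<open>X\<close> means that the columns outside \<open>X\<close> of the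
  Macaulay matrix admit a left inverse. Such a left inverse at \<open>c0\<close> is read off from
  the given representations, and \<open>generic_left_inverse\<close> carries it over to
  \<open>c\<close>; terms in \<open>X\<close> may take any values.\<close>

lemma gspan_generic:
  fixes c c0 :: "nat \<times> mon \<Rightarrow> 'a::field"
  assumes F: "is_subfield F" and indep: "alg_indep F (SIGMA j:{1..i}. monomials_deg N (d j)) c"
    and X: "X \<subseteq> monomials_deg N e"
    and special: "\<And>m. m \<in> monomials_deg N e \<Longrightarrow> Poly_Mapping.single m 1 \<in> gspan c0 i N e X"
    and m: "m \<in> monomials_deg N e"
  shows "Poly_Mapping.single m 1 \<in> gspan c i N e X"
proof (cases "m \<in> X")
  case True
  then show ?thesis by (intro gspan_keys) simp
next
  case False
  define S where "S = monomials_deg N e - X"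
  have finS: "finite S"
    by (simp add: S_def finite_monomials_deg)
  have "\<exists>g. gcoeffs i N e g \<and>
      (\<forall>t\<in>S. Poly_Mapping.lookup (\<Sum>j=1..i. g j * gform c0 N j) t = (if s = t then 1 else 0))"
    if s: "s \<in> S" for s
  proof -
    obtain p q where pq: "p \<in> gideal c0 i N e" "Poly_Mapping.keys q \<subseteq> X" "Poly_Mapping.single s 1 = p + q"
      using special[of s] s unfolding S_def by (auto elim: gspanE)
    obtain g where g: "gcoeffs i N e g"
      "p = (\<Sum>j=1..i. g j * gform c0 N j)" using pq(1) by (rule gidealE)
    have "Poly_Mapping.lookup p t = (if s = t then 1 else 0)" if "t \<in> S" for t
      using arg_cong[OF pq(3), of "\<lambda>p. Poly_Mapping.lookup p t"] lookup_eq_0[OF pq(2), of t] that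
      by (simp add: S_def lookup_add lookup_single when_def split: if_splits)
    with g show ?thesis by blast
  qed
  then obtain g where g: "\<And>s. s \<in> S \<Longrightarrow> gcoeffs i N e (g s)"
    "\<And>s t. s \<in> S \<Longrightarrow> t \<in> S \<Longrightarrow> Poly_Mapping.lookup (\<Sum>j=1..i. g s j * gform c0 N j) t = (if s = t then 1 else 0)"
    by metis
  have sp: "(\<Sum>x\<in>gindex i N e. Poly_Mapping.lookup (g s (fst x)) (snd x) * entry_eval c0 (gentry N x t)) = (if s = t then 1 else 0)"
    if "s \<in> S" "t \<in> S" for s t
    using g(2)[OF that] lookup_gideal_sum[OF g(1)[OF that(1)], of c0 t] by simp
  have q: "v \<in> (SIGMA j:{1..i}. monomials_deg N (d j))" if "x \<in> gindex i N e" "s \<in> S" "gentry N x s = Some v" for x s v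
    using that by (auto simp: gentry_def gindex_def split: prod.splits if_splits)
  have "\<exists>lam. \<forall>s\<in>S. \<forall>t\<in>S.
      (\<Sum>x\<in>gindex i N e. lam s x * entry_eval c (gentry N x t)) = (if s = t then 1 else 0)"
  proof (rule generic_left_inverse[OF F indep finS finite_gindex])
    show "v \<in> (SIGMA j:{1..i}. monomials_deg N (d j))"
      if "x \<in> gindex i N e" "s \<in> S" "gentry N x s = Some v" for x s v
      by (rule q[OF that])
    show "(\<Sum>x\<in>gindex i N e. Poly_Mapping.lookup (g s (fst x)) (snd x) * entry_eval c0 (gentry N x t)) =
        (if s = t then 1 else 0)" if "s \<in> S" "t \<in> S" for s t
      by (rule sp[OF that])
  qed
  then obtain lam where lam: "\<forall>s\<in>S. \<forall>t\<in>S.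
      (\<Sum>x\<in>gindex i N e. lam s x * entry_eval c (gentry N x t)) = (if s = t then 1 else 0)"
    by blast
  define p where "p = (\<Sum>x\<in>gindex i N e. Poly_Mapping.single (snd x) (lam m x) * gform c N (fst x))"
  have p: "p \<in> gideal c i N e"
    unfolding p_def
  proof (rule gideal_sum)
    fix x assume "x \<in> gindex i N e"
    then show "Poly_Mapping.single (snd x) (lam m x) * gform c N (fst x) \<in> gideal c i N e"
      using gideal_generator[of "fst x" i "snd x" N "lam m x" c] by (auto simp: gindex_def)
  qed
  have mS: "m \<in> S"
    using m False by (simp add: S_def)
  have "Poly_Mapping.lookup p t = (if m = t then 1 else 0)" if "t \<in> S" for t
    using bspec[OF bspec[OF lam mS] that] unfolding p_def lookup_sum by (simp add: lookup_single_mult_gform)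
  moreover have "Poly_Mapping.lookup p t = 0" if "t \<notin> monomials_deg N e" for t
    using lookup_eq_0[OF gideal_keys[OF p] that] .
  ultimately have "Poly_Mapping.lookup (Poly_Mapping.single m 1 - p) t = 0" if "t \<notin> X" for t
    using that m
    by (cases "t \<in> monomials_deg N e") (auto simp: lookup_minus lookup_single when_def S_def)
  then have "Poly_Mapping.keys (Poly_Mapping.single m 1 - p) \<subseteq> X"
    by (rule keys_subsetI)
  from gspanI[OF p this] show ?thesis by simp
qed

end

subsection \<open>The candidate standard monomials\<close>

text \<open>The choice is meaningful only if \<open>B\<close> has an element of degree
  \<open>e\<close>. In \<open>height\<close> this is secured by the guard
  \<open>d (Suc i) < sigma i\<close> together with \<open>std_all_degrees\<close>.\<close>

definition top_mon :: "mon set \<Rightarrow> nat \<Rightarrow> mon" where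
  "top_mon B e = (SOME b. b \<in> B \<and> mdeg b = e \<and> (\<forall>b'\<in>B. mdeg b' = e \<longrightarrow> b' = b \<or> grevlex_less b' b))"

lemma top_mon:
  assumes "finite B" "b \<in> B" "mdeg b = e"
  shows "top_mon B e \<in> B" "mdeg (top_mon B e) = e"
    "b' \<in> B \<Longrightarrow> mdeg b' = e \<Longrightarrow> b' = top_mon B e \<or> grevlex_less b' (top_mon B e)"
proof -
  have "\<exists>m\<in>{b \<in> B. mdeg b = e}. \<forall>m'\<in>{b \<in> B. mdeg b = e}. m' = m \<or> grevlex_less m' m"
    using assms by (intro grevlex_max_exists) auto
  then have "\<exists>b. b \<in> B \<and> mdeg b = e \<and> (\<forall>b'\<in>B. mdeg b' = e \<longrightarrow> b' = b \<or> grevlex_less b' b)"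
    by blast
  then have *: "top_mon B e \<in> B \<and> mdeg (top_mon B e) = e \<and>
      (\<forall>b'\<in>B. mdeg b' = e \<longrightarrow> b' = top_mon B e \<or> grevlex_less b' (top_mon B e))"
    unfolding top_mon_def by (rule someI_ex)
  then show "top_mon B e \<in> B" "mdeg (top_mon B e) = e"
    "b' \<in> B \<Longrightarrow> mdeg b' = e \<Longrightarrow> b' = top_mon B e \<or> grevlex_less b' (top_mon B e)"
    by blast+
qed

context form_degrees
begin

text \<open>\<open>sigma i\<close> is the socle degree of a complete intersection of degrees \<open>d 1, ..., d i\<close>.\<close>

definition sigma :: "nat \<Rightarrow> nat" where
  "sigma i = (\<Sum>j=1..i. d j - 1)"

text \<open>Truncated subtraction makes the string empty as soon as \<open>2 * mdeg b\<close>
  reaches \<open>d (Suc i) + sigma i\<close>; strings too close to the socle thus disappear without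
  a separate case.\<close>

definition height :: "nat \<Rightarrow> mon set \<Rightarrow> mon \<Rightarrow> nat" where
  "height i B b = (if d (Suc i) < sigma i \<and> b = top_mon B (d (Suc i)) then 0
     else d (Suc i) + sigma i - 2 * mdeg b)"

primrec std :: "nat \<Rightarrow> mon set" where
  "std 0 = {0}"
| "std (Suc i) = {b + Poly_Mapping.single (Suc i) j | b j. b \<in> std i \<and> j < height i (std i) b}"

abbreviation ht :: "nat \<Rightarrow> mon \<Rightarrow> nat" where
  "ht i \<equiv> height i (std i)"

text \<open>These are the candidate standard monomials for the first \<open>i\<close> forms in
  \<open>N\<close> variables: variables after the \<open>i\<close>-th occur freely.\<close>

definition normals :: "nat \<Rightarrow> nat \<Rightarrow> mon set" where
  "normals i N = {b + w | b w. b \<in> std i \<and> Poly_Mapping.keys w \<subseteq> {i+1..N}}"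

lemma sigma_0 [simp]: "sigma 0 = 0"
  by (simp add: sigma_def)

lemma sigma_Suc: "sigma (Suc i) = sigma i + (d (Suc i) - 1)"
  by (simp add: sigma_def)

lemma std_SucE:
  assumes "m \<in> std (Suc i)"
  obtains b j where "b \<in> std i" "j < ht i b" "m = b + Poly_Mapping.single (Suc i) j"
  using assms by auto

lemma std_SucI: "b \<in> std i \<Longrightarrow> j < ht i b \<Longrightarrow> b + Poly_Mapping.single (Suc i) j \<in> std (Suc i)"
  by auto

declare std.simps(2) [simp del]

lemma std_subset: "b \<in> std i \<Longrightarrow> b \<in> monomials i"
proof (induction i arbitrary: b)
  case (Suc i)
  from Suc.prems obtain b' j where b': "b' \<in> std i" "b = b' + Poly_Mapping.single (Suc i) j"
    by (auto elim: std_SucE)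
  then show ?case
    using Suc.IH[of b'] monomials_mono[of i "Suc i" b'] by (simp add: single_in_monomials)
qed simp

lemma keys_subset_monomials: "Poly_Mapping.keys w \<subseteq> {i+1..N} \<Longrightarrow> w \<in> monomials N"
  by (auto simp: monomials_def)

lemma normals_subset: "i \<le> N \<Longrightarrow> m \<in> normals i N \<Longrightarrow> m \<in> monomials N"
  unfolding normals_def using std_subset monomials_mono keys_subset_monomials by fastforce

lemma normals_self [simp]: "normals i i = std i"
  by (auto simp: normals_def)

lemma normals_0 [simp]: "normals 0 N = monomials N"
  by (auto simp: normals_def monomials_def)

lemma std_in_normals: "b \<in> std i \<Longrightarrow> b \<in> normals i N"
  unfolding normals_def by (rule CollectI, rule exI[of _ b], rule exI[of _ 0]) simp

lemma normals_add:
  assumes "m \<in> normals i N" "Poly_Mapping.keys v \<subseteq> {i+1..N'}" "N \<le> N'"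
  shows "m + v \<in> normals i N'"
proof -
  obtain b w where b: "b \<in> std i" "Poly_Mapping.keys w \<subseteq> {i+1..N}" "m = b + w"
    using assms(1) by (auto simp: normals_def)
  have "Poly_Mapping.keys (w + v) \<subseteq> {i+1..N'}"
    using Poly_Mapping.keys_add[of w v] b(2) assms(2,3) by fastforce
  then show ?thesis
    using b(1) unfolding b(3) normals_def by (auto simp: add.assoc)
qed

lemma normals_mono: "N \<le> N' \<Longrightarrow> m \<in> normals i N \<Longrightarrow> m \<in> normals i N'"
  using normals_add[of m i N 0 N'] by simp

lemma normals_iff:
  assumes "b \<in> monomials i" "Poly_Mapping.keys w \<subseteq> {i+1..N}"
  shows "b + w \<in> normals i N \<longleftrightarrow> b \<in> std i"
proof
  assume "b + w \<in> normals i N"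
  then obtain b' w' where b': "b' \<in> std i" "Poly_Mapping.keys w' \<subseteq> {i+1..N}" "b + w = b' + w'"
    by (auto simp: normals_def)
  then show "b \<in> std i"
    using monomials_split_unique(1)[OF assms(1) std_subset[OF b'(1)] assms(2) b'(2,3)] by simp
qed (use assms in \<open>auto simp: normals_def\<close>)

lemma std_Suc_iff:
  assumes "a \<in> monomials i"
  shows "a + Poly_Mapping.single (Suc i) j \<in> std (Suc i) \<longleftrightarrow> a \<in> std i \<and> j < ht i a"
proof
  assume "a + Poly_Mapping.single (Suc i) j \<in> std (Suc i)"
  then obtain b l where b: "b \<in> std i" "l < ht i b"
    "a + Poly_Mapping.single (Suc i) j = b + Poly_Mapping.single (Suc i) l"
    by (rule std_SucE)
  have k: "Poly_Mapping.keys (Poly_Mapping.single (Suc i) r) \<subseteq> {i+1..Suc i}" for r :: nat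
    by simp
  have "a = b" "Poly_Mapping.single (Suc i) j = Poly_Mapping.single (Suc i) l"
    using monomials_split_unique[OF assms std_subset[OF b(1)] k k b(3)] .
  moreover from this(2) have "j = l"
    by (metis lookup_single_eq)
  ultimately show "a \<in> std i \<and> j < ht i a"
    using b by simp
qed (auto intro: std_SucI)

lemma normals_Suc_iff:
  assumes "b \<in> std i" "Poly_Mapping.keys w \<subseteq> {i+1..N}"
  shows "b + w \<in> normals (Suc i) N \<longleftrightarrow> Poly_Mapping.lookup w (Suc i) < ht i b"
proof -
  obtain w' where w': "Poly_Mapping.keys w' \<subseteq> {i+2..N}"
    "w = Poly_Mapping.single (Suc i) (Poly_Mapping.lookup w (Suc i)) + w'"
    using single_splitE[OF assms(2)] by blast
  let ?a = "b + Poly_Mapping.single (Suc i) (Poly_Mapping.lookup w (Suc i))"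
  have b: "b \<in> monomials i"
    using std_subset[OF assms(1)] .
  then have a: "?a \<in> monomials (Suc i)"
    by (simp add: single_in_monomials monomials_mono[of i])
  have "b + w = ?a + w'"
    by (subst w'(2)) (simp add: add.assoc)
  then have "b + w \<in> normals (Suc i) N \<longleftrightarrow> ?a \<in> std (Suc i)"
    using normals_iff[OF a, of w' N] w'(1) by simp
  also have "\<dots> \<longleftrightarrow> Poly_Mapping.lookup w (Suc i) < ht i b"
    using std_Suc_iff[OF b] assms(1) by simp
  finally show ?thesis .
qed

lemma normals_Suc_subset: "m \<in> normals (Suc i) N \<Longrightarrow> i < N \<Longrightarrow> m \<in> normals i N"
proof -
  assume m: "m \<in> normals (Suc i) N" and iN: "i < N"
  obtain a w where a: "a \<in> std (Suc i)" "Poly_Mapping.keys w \<subseteq> {i+2..N}" "m = a + w"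
    using m by (auto simp: normals_def)
  obtain b j where b: "b \<in> std i" "a = b + Poly_Mapping.single (Suc i) j"
    using a(1) by (rule std_SucE)
  have "b + Poly_Mapping.single (Suc i) j \<in> normals i N"
    using iN by (intro normals_add[OF std_in_normals[OF b(1), of N]]) auto
  then show "m \<in> normals i N"
    unfolding a(3) b(2) using a(2) by - (rule normals_add[where N = N], auto)
qed

end

text \<open>\<open>d_large\<close> is the degree hypothesis in terms of socle degrees:
  \<open>sigma i\<close> exceeds the next degree by at most 2.\<close>

locale balanced_degrees = form_degrees +
  fixes n :: nat
  assumes d_pos: "1 \<le> i \<Longrightarrow> i \<le> n \<Longrightarrow> 1 \<le> d i"
    and d_large: "i < n \<Longrightarrow> sigma i \<le> d (Suc i) + 2"
begin

text \<open>This equation is the symmetry of a nonempty string: it starts in degree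
  \<open>mdeg b\<close> and ends in degree \<open>sigma (Suc i) - mdeg b\<close>.\<close>

lemma height_pos: "i < n \<Longrightarrow> 0 < ht i b \<Longrightarrow> ht i b + 2 * mdeg b = Suc (sigma (Suc i))"
  using d_pos[of "Suc i"] by (auto simp: height_def sigma_Suc split: if_splits)

lemma std_deg: "i \<le> n \<Longrightarrow> b \<in> std i \<Longrightarrow> mdeg b \<le> sigma i"
proof (induction i arbitrary: b)
  case (Suc i)
  from Suc.prems(2) obtain b' j where "b' \<in> std i" "j < ht i b'" "b = b' + Poly_Mapping.single (Suc i) j"
    by (rule std_SucE)
  then show ?case
    using height_pos[of i b'] Suc.prems(1) by simp
qed simp

lemma finite_std: "i \<le> n \<Longrightarrow> finite (std i)"
proof (rule finite_subset)
  assume i: "i \<le> n"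
  show "std i \<subseteq> (\<Union>e\<in>{..sigma i}. monomials_deg i e)"
    using std_subset std_deg[OF i] by (auto simp: monomials_deg_def)
qed (simp add: finite_monomials_deg)

text \<open>The string over the monomial 1 is never removed and already meets every degree up to the
  socle degree. Hence \<open>top_mon\<close> picks an actual element of \<open>std i\<close> where
  \<open>height\<close> depends on it.\<close>

lemma std_all_degrees: "i \<le> n \<Longrightarrow> 0 \<in> std i \<and> (\<forall>l\<le>sigma i. \<exists>b\<in>std i. mdeg b = l)"
proof (induction i)
  case (Suc i)
  then have IH: "0 \<in> std i" "\<And>l. l \<le> sigma i \<Longrightarrow> \<exists>b\<in>std i. mdeg b = l" and i: "i < n"
    by simp_all
  have "0 \<noteq> top_mon (std i) (d (Suc i))" if "d (Suc i) < sigma i"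
  proof -
    obtain b where "b \<in> std i" "mdeg b = d (Suc i)"
      using IH(2) \<open>d (Suc i) < sigma i\<close> less_imp_le by blast
    then have "mdeg (top_mon (std i) (d (Suc i))) = d (Suc i)"
      using finite_std[of i] i by (intro top_mon(2)) simp_all
    then show ?thesis
      using d_pos[of "Suc i"] i by auto
  qed
  then have ht0: "ht i 0 = d (Suc i) + sigma i"
    by (auto simp: height_def)
  have el: "Poly_Mapping.single (Suc i) l \<in> std (Suc i)" if "l \<le> sigma (Suc i)" for l
    using std_SucI[OF IH(1), of l] that ht0 d_pos[of "Suc i"] i by (simp add: sigma_Suc)
  show ?case
    using el[of 0] el mdeg_single by (metis le0 single_zero)
qed simp

lemma zero_in_std: "i \<le> n \<Longrightarrow> 0 \<in> std i"
  using std_all_degrees by blast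

lemma top_std:
  assumes "i < n" "d (Suc i) < sigma i"
  shows "top_mon (std i) (d (Suc i)) \<in> std i" "mdeg (top_mon (std i) (d (Suc i))) = d (Suc i)"
    "b \<in> std i \<Longrightarrow> mdeg b = d (Suc i) \<Longrightarrow> b = top_mon (std i) (d (Suc i)) \<or> grevlex_less b (top_mon (std i) (d (Suc i)))"
proof -
  obtain b0 where "b0 \<in> std i" "mdeg b0 = d (Suc i)"
    using std_all_degrees[of i] assms by (meson less_imp_le)
  note * = top_mon[OF finite_std[of i] this]
  show "top_mon (std i) (d (Suc i)) \<in> std i" "mdeg (top_mon (std i) (d (Suc i))) = d (Suc i)"
    "b \<in> std i \<Longrightarrow> mdeg b = d (Suc i) \<Longrightarrow> b = top_mon (std i) (d (Suc i)) \<or> grevlex_less b (top_mon (std i) (d (Suc i)))"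
    using * assms(1) by auto
qed

lemma std_symmetric:
  assumes "i \<le> n"
  obtains \<psi> where "\<And>b. b \<in> std i \<Longrightarrow> \<psi> b \<in> std i" "inj_on \<psi> (std i)"
    "\<And>b. b \<in> std i \<Longrightarrow> mdeg (\<psi> b) + mdeg b = sigma i"
proof (cases i)
  case 0
  then show thesis
    by (intro that[of id]) auto
next
  case (Suc k)
  \<comment> \<open>Each string is reversed: the exponent \<open>j\<close> of the last variable
    becomes \<open>ht k b - 1 - j\<close>, which complements degrees and is an involution.\<close>
  define \<psi> where "\<psi> = (\<lambda>m. let j = Poly_Mapping.lookup m i; b = m - Poly_Mapping.single i j
     in b + Poly_Mapping.single i (ht k b - 1 - j))"
  have \<psi>: "\<psi> (b + Poly_Mapping.single i j) = b + Poly_Mapping.single i (ht k b - 1 - j)" if "b \<in> std k" for b j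
  proof -
    have "Poly_Mapping.lookup b i = 0"
      using std_subset[OF that] Suc by (auto simp: monomials_iff)
    then show ?thesis
      by (simp add: \<psi>_def lookup_add)
  qed
  have mem: "\<psi> b \<in> std i" "\<psi> (\<psi> b) = b" "mdeg (\<psi> b) + mdeg b = sigma i" if b: "b \<in> std i" for b
  proof -
    obtain b' j where b': "b' \<in> std k" "j < ht k b'" "b = b' + Poly_Mapping.single i j"
      using b unfolding Suc by (rule std_SucE)
    have lt: "ht k b' - 1 - j < ht k b'" "ht k b' - 1 - (ht k b' - 1 - j) = j"
      using b'(2) by auto
    show "\<psi> b \<in> std i"
      using std_SucI[OF b'(1) lt(1)] unfolding b'(3) \<psi>[OF b'(1)] unfolding Suc .
    show "\<psi> (\<psi> b) = b"
      by (simp only: b'(3) \<psi>[OF b'(1)] lt(2))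
    show "mdeg (\<psi> b) + mdeg b = sigma i"
      using height_pos[of k b'] b'(2) assms unfolding b'(3) \<psi>[OF b'(1)] by (simp add: Suc)
  qed
  show thesis
    by (rule that[of \<psi>]) (use mem in \<open>auto intro: inj_on_inverseI[of _ \<psi>]\<close>)
qed

text \<open>Counts the new initial monomials of degree \<open>e\<close> against the old standard monomials of degree \<open>e - d (i+1)\<close>.\<close>

lemma std_shift_injection:
  assumes "i < n"
  obtains \<phi> where "\<And>b. b \<in> std i \<Longrightarrow> \<phi> b \<in> std i" "inj_on \<phi> (std i)"
    "\<And>b. b \<in> std i \<Longrightarrow> mdeg (\<phi> b) + ht i (\<phi> b) = d (Suc i) + mdeg b"
proof -
  obtain \<psi> where \<psi>: "\<And>b. b \<in> std i \<Longrightarrow> \<psi> b \<in> std i" "inj_on \<psi> (std i)"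
    "\<And>b. b \<in> std i \<Longrightarrow> mdeg (\<psi> b) + mdeg b = sigma i"
    using std_symmetric[of i] assms by (metis less_imp_le)
  show thesis
  proof (cases "d (Suc i) < sigma i")
    case False
    show thesis
    proof (rule that[OF \<psi>(1,2)])
      fix b assume "b \<in> std i"
      then show "mdeg (\<psi> b) + ht i (\<psi> b) = d (Suc i) + mdeg b"
        using \<psi>(3)[of b] False by (simp add: height_def)
    qed
  next
    case True
    let ?t = "top_mon (std i) (d (Suc i))"
    note t = top_std[OF assms True]
    have z: "0 \<in> std i"
      using zero_in_std assms by simp
    \<comment> \<open>String reversal has two wrong values. The monomial 1 goes to the socle
      monomial, whose string is cut in degree \<open>sigma i\<close> instead of
      \<open>d (Suc i)\<close>; the preimage of the exceptional base goes to a string cut in degree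
      \<open>d (Suc i)\<close> instead of \<open>sigma i\<close>. Exchanging the two values corrects
      both.\<close>
    define \<phi> where "\<phi> = (\<lambda>b. if b = 0 then ?t else if \<psi> b = ?t then \<psi> 0 else \<psi> b)"
    show thesis
    proof (rule that[of \<phi>])
      show "\<phi> b \<in> std i" if "b \<in> std i" for b
        using that t(1) z \<psi>(1) by (simp add: \<phi>_def)
      show "inj_on \<phi> (std i)"
        using \<psi>(2) z by (auto simp: inj_on_def \<phi>_def split: if_splits)
      fix b assume b: "b \<in> std i"
      have pz: "mdeg (\<psi> 0) = sigma i"
        using \<psi>(3)[OF z] by simp
      consider "b = 0" | "b \<noteq> 0" "\<psi> b = ?t" | "b \<noteq> 0" "\<psi> b \<noteq> ?t" by blast
      then show "mdeg (\<phi> b) + ht i (\<phi> b) = d (Suc i) + mdeg b"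
      proof cases
        case 1
        then show ?thesis by (simp add: \<phi>_def height_def t(2) True)
      next
        case 2
        then show ?thesis
          using \<psi>(3)[OF b] t(2) True pz by (auto simp: \<phi>_def height_def)
      next
        case 3
        \<comment> \<open>Positive degree of \<open>b\<close> keeps \<open>\<psi> b\<close> below
          the socle degree, and with \<open>d_large\<close> the subtraction in \<open>height\<close>
          is then exact.\<close>
        then have "mdeg b > 0"
          by (simp add: mdeg_eq_0_iff zero_less_iff_neq_zero)
        with 3 show ?thesis
          using \<psi>(3)[OF b] d_large[OF assms] by (simp add: \<phi>_def height_def)
      qed
    qed
  qed
qed

text \<open>If the standard monomial has the larger power of the last variable, the order decides at
  once. Otherwise the lengths of the strings are incompatible unless \<open>b\<close> is the
  exceptional base; then \<open>d_large\<close> forces \<open>b'\<close> into the same degree, where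
  \<open>b\<close> was chosen largest.\<close>

lemma std_below_new:
  assumes "i < n" and b: "b \<in> std i" "ht i b \<le> j" and b': "b' \<in> std i" "j' < ht i b'"
    and deg: "mdeg b + j = mdeg b' + j'"
  shows "grevlex_less (b' + Poly_Mapping.single (Suc i) j') (b + Poly_Mapping.single (Suc i) j)"
proof (cases "j < j'")
  case True
  have mono: "b \<in> monomials (Suc i)" "b' \<in> monomials (Suc i)"
    using std_subset b b' monomials_mono[of i "Suc i"] by auto
  have "Poly_Mapping.lookup b (Suc i) = 0" "Poly_Mapping.lookup b' (Suc i) = 0"
    using std_subset b b' by (auto simp: monomials_iff)
  with True mono deg show ?thesis
    by (intro grevlex_less_last[of _ _ i]) (auto simp: lookup_add single_in_monomials)
next
  case False
  have ht': "ht i b' = d (Suc i) + sigma i - 2 * mdeg b'" "\<not> (d (Suc i) < sigma i \<and> b' = top_mon (std i) (d (Suc i)))"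
    using b'(2) by (auto simp: height_def split: if_splits)
  \<comment> \<open>Outside the exception, \<open>ht i b \<le> j\<close> and
    \<open>j' < ht i b'\<close> give \<open>mdeg b' < mdeg b\<close>, which contradicts
    \<open>j' \<le> j\<close>.\<close>
  have top: "d (Suc i) < sigma i" "b = top_mon (std i) (d (Suc i))"
    using b(2) b'(2) ht' False deg by (auto simp: height_def split: if_splits)
  note t = top_std[OF assms(1) top(1)]
  have "mdeg b = d (Suc i)"
    using t(2) top(2) by simp
  then have "mdeg b' = d (Suc i)" "j = j'"
    using b'(2) ht'(1) False deg d_large[OF assms(1)] by linarith+
  moreover have "b' \<noteq> b"
    using ht'(2) top by auto
  ultimately have "grevlex_less b' b"
    using t(3)[OF b'(1)] top(2) by auto
  then show ?thesis
    using \<open>j = j'\<close> by simp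
qed

end

subsection \<open>Spanning by specialisation\<close>

context form_degrees
begin

definition std_deg_set :: "nat \<Rightarrow> nat \<Rightarrow> mon set" where
  "std_deg_set i e = {b \<in> std i. mdeg b = e}"

lemma gideal_lift:
  assumes "N \<le> N'" "\<And>j. 1 \<le> j \<Longrightarrow> j \<le> i \<Longrightarrow> gform c' N' j = gform c N j" "p \<in> gideal c i N e"
  shows "p \<in> gideal c' i N' e"
proof -
  obtain g where g: "gcoeffs i N e g" "p = (\<Sum>j=1..i. g j * gform c N j)"
    using assms(3) by (rule gidealE)
  show ?thesis
  proof (rule gidealI[of _ g])
    show "p = (\<Sum>j=1..i. g j * gform c' N' j)"
      unfolding g(2) using assms(2) by (intro sum.cong) auto
  qed (use gcoeffsD[OF g(1)] monomials_mono[OF assms(1)] in blast)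
qed

lemma gspan_lift:
  assumes "N \<le> N'" "\<And>j. 1 \<le> j \<Longrightarrow> j \<le> i \<Longrightarrow> gform c' N' j = gform c N j" "p \<in> gspan c i N e X"
  shows "p \<in> gspan c' i N' e X"
  using assms(3) gideal_lift[OF assms(1,2)] unfolding gspan_def by blast

lemma gform_special:
  assumes "finite M" "M \<subseteq> monomials_deg N (d j)"
    and "\<And>m. m \<in> monomials_deg N (d j) \<Longrightarrow> m \<notin> M \<Longrightarrow> c (j, m) = 0"
  shows "gform c N j = (\<Sum>m\<in>M. Poly_Mapping.single m (c (j, m)))"
  unfolding gform_def by (rule sum.mono_neutral_right) (use assms finite_monomials_deg in auto)

end

locale generic_setup = balanced_degrees d n for d :: "nat \<Rightarrow> nat" and n +
  fixes F :: "'a::field set" and c :: "nat \<times> mon \<Rightarrow> 'a"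
  assumes F: "is_subfield F"
    and indep: "alg_indep F (SIGMA j:{1..n}. monomials_deg n (d j)) c"
begin

text \<open>The number of variables equals the number of forms here; further variables and the
  monomial order enter only with \<open>reduces\<close>.\<close>

definition spanning :: "nat \<Rightarrow> nat \<Rightarrow> bool" where
  "spanning i e \<longleftrightarrow> (\<forall>m\<in>monomials_deg i e. Poly_Mapping.single m 1 \<in> gspan c i i e (std_deg_set i e))"

lemma indep_restrict:
  assumes "i \<le> n" "N \<le> n"
  shows "alg_indep F (SIGMA j:{1..i}. monomials_deg N (d j)) c"
  by (rule alg_indep_mono[OF indep]) (use assms monomials_mono[of N n] in \<open>auto simp: monomials_deg_def\<close>)

lemma gspan_generic':
  fixes c0 :: "nat \<times> mon \<Rightarrow> 'a"
  assumes "i < n" "X \<subseteq> monomials_deg (Suc i) e"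
    and "\<And>m. m \<in> monomials_deg (Suc i) e \<Longrightarrow> Poly_Mapping.single m 1 \<in> gspan c0 (Suc i) (Suc i) e X"
    and "m \<in> monomials_deg (Suc i) e"
  shows "Poly_Mapping.single m 1 \<in> gspan c (Suc i) (Suc i) e X"
  by (rule gspan_generic[OF F indep_restrict assms(2), where ?c0.0 = c0])
    (use assms in \<open>auto simp: Suc_le_eq\<close>)

lemma std_deg_set_subset: "std_deg_set i e \<subseteq> monomials_deg i e"
  using std_subset by (auto simp: std_deg_set_def monomials_deg_def)

text \<open>The first \<open>i\<close> forms lose every term with a later variable and become the
  generic forms in \<open>i\<close> variables, so the induction hypothesis applies to them. The form
  with index \<open>Suc i\<close> receives the coefficients \<open>t\<close>.\<close>

definition specialize :: "nat \<Rightarrow> (mon \<Rightarrow> 'a) \<Rightarrow> nat \<times> mon \<Rightarrow> 'a" where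
  "specialize i t = (\<lambda>(j, m). if j \<le> i then if m \<in> monomials i then c (j, m) else 0 else t m)"

lemma gform_specialize: "j \<le> i \<Longrightarrow> gform (specialize i t) (Suc i) j = gform c i j"
  by (rule poly_mapping_eqI)
    (auto simp: lookup_gform specialize_def monomials_deg_def intro: monomials_mono[of i "Suc i"])

text \<open>Since the specialised old forms do not involve the new variable, the induction
  hypothesis acts on \<open>a\<close> alone and survives multiplication by a power of that
  variable.\<close>

lemma gspan_specialize_old:
  assumes sp: "\<And>l. spanning i l" and a: "a \<in> monomials i"
    and e: "mdeg a + j = e"
  shows "Poly_Mapping.single (a + Poly_Mapping.single (Suc i) j) 1 \<in>
    gspan (specialize i t) (Suc i) (Suc i) e {b + Poly_Mapping.single (Suc i) j | b. b \<in> std i \<and> mdeg b = mdeg a}"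
proof -
  have "Poly_Mapping.single a 1 \<in> gspan c i i (mdeg a) (std_deg_set i (mdeg a))"
    using sp[of "mdeg a"] a by (auto simp: spanning_def monomials_deg_def)
  then have "Poly_Mapping.single a 1 \<in> gspan (specialize i t) i (Suc i) (mdeg a) (std_deg_set i (mdeg a))"
    using gspan_lift[of i "Suc i" i "specialize i t" c] gform_specialize by auto
  then have "Poly_Mapping.single a 1 \<in> gspan (specialize i t) (Suc i) (Suc i) (mdeg a) (std_deg_set i (mdeg a))"
    by (rule gspan_mono_gideal[rotated]) simp
  from gspan_single_mult[OF this, of "Poly_Mapping.single (Suc i) j"
      "{b + Poly_Mapping.single (Suc i) j | b. b \<in> std i \<and> mdeg b = mdeg a}" 1]
  show ?thesis
    using e by (fastforce simp: mult_single add.commute std_deg_set_def single_in_monomials)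
qed

lemma gspan_specialize_all:
  assumes sp: "\<And>l. spanning i l"
    and X: "\<And>b. b \<in> std i \<Longrightarrow> mdeg b \<le> e \<Longrightarrow>
      Poly_Mapping.single (b + Poly_Mapping.single (Suc i) (e - mdeg b)) 1 \<in> gspan (specialize i t) (Suc i) (Suc i) e X"
    and m: "m \<in> monomials_deg (Suc i) e"
  shows "Poly_Mapping.single m 1 \<in> gspan (specialize i t) (Suc i) (Suc i) e X"
proof -
  have "m \<in> monomials (Suc i)" "mdeg m = e"
    using m by (auto simp: monomials_deg_def)
  then obtain a j where a: "a \<in> monomials i" "m = a + Poly_Mapping.single (Suc i) j"
    by (auto elim: monomials_SucE)
  then have e: "mdeg a + j = e"
    using \<open>mdeg m = e\<close> by simp
  show ?thesis
    unfolding a(2)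
  proof (rule gspan_trans[OF gspan_specialize_old[OF sp a(1) e]])
    fix x assume "x \<in> {b + Poly_Mapping.single (Suc i) j | b. b \<in> std i \<and> mdeg b = mdeg a}"
    then obtain b where "b \<in> std i" "mdeg b = mdeg a" "x = b + Poly_Mapping.single (Suc i) j" by blast
    then show "Poly_Mapping.single x 1 \<in> gspan (specialize i t) (Suc i) (Suc i) e X"
      using X[of b] e by auto
  qed
qed

lemma std_Suc_degI:
  assumes "b \<in> std i" "mdeg b \<le> e" "mdeg b + e < d (Suc i) + sigma i"
    "\<not> (d (Suc i) < sigma i \<and> b = top_mon (std i) (d (Suc i)))"
  shows "b + Poly_Mapping.single (Suc i) (e - mdeg b) \<in> std_deg_set (Suc i) e"
proof -
  have "ht i b = d (Suc i) + sigma i - 2 * mdeg b"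
    using assms(4) by (auto simp: height_def)
  then have "e - mdeg b < ht i b"
    using assms(2,3) by linarith
  then show ?thesis
    using std_SucI[OF assms(1)] assms(2) by (simp add: std_deg_set_def)
qed

text \<open>Below degree \<open>d (Suc i)\<close> no monomial has been cut off. In degree
  \<open>d (Suc i) < sigma i\<close> only the exceptional base has been, and specialising the new
  form to exactly this monomial puts it into the ideal.\<close>

lemma spanning_small:
  assumes sp: "\<And>l. spanning i l" and i: "i < n"
    and e: "e < d (Suc i) \<or> e = d (Suc i) \<and> d (Suc i) < sigma i"
  shows "spanning (Suc i) e"
proof -
  define top where "top = top_mon (std i) (d (Suc i))"
  define t where "t = (\<lambda>m. if m = top then 1 else 0 :: 'a)"
  have "Poly_Mapping.single m 1 \<in> gspan (specialize i t) (Suc i) (Suc i) e (std_deg_set (Suc i) e)"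
    if "m \<in> monomials_deg (Suc i) e" for m
  proof (rule gspan_specialize_all[OF sp _ that])
    fix b assume b: "b \<in> std i" "mdeg b \<le> e"
    show "Poly_Mapping.single (b + Poly_Mapping.single (Suc i) (e - mdeg b)) 1 \<in>
        gspan (specialize i t) (Suc i) (Suc i) e (std_deg_set (Suc i) e)"
    proof (cases "d (Suc i) < sigma i \<and> b = top")
      case True
      note tp = top_std[OF i conjunct1[OF True], folded top_def]
      have e: "e = d (Suc i)"
        using e b(2) True tp(2) by auto
      have "top \<in> monomials_deg (Suc i) (d (Suc i))"
        using tp(1,2) std_subset monomials_mono[of i "Suc i"] by (auto simp: monomials_deg_def)
      then have "gform (specialize i t) (Suc i) (Suc i) = Poly_Mapping.single top 1"
        by (subst gform_special[of "{top}"]) (auto simp: specialize_def t_def)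
      with gideal_generator[of "Suc i" "Suc i" 0 "Suc i" 1 "specialize i t"]
      have "Poly_Mapping.single top 1 \<in> gideal (specialize i t) (Suc i) (Suc i) e"
        by (simp add: e mult_single)
      then show ?thesis
        using True e tp(2) by (auto intro: gspan_gideal)
    next
      case False
      have "mdeg b \<le> sigma i"
        using std_deg b i by simp
      with False b e have "b + Poly_Mapping.single (Suc i) (e - mdeg b) \<in> std_deg_set (Suc i) e"
        unfolding top_def by (intro std_Suc_degI) auto
      then show ?thesis
        by (intro gspan_keys) simp
    qed
  qed
  then show ?thesis
    unfolding spanning_def using gspan_generic'[OF i std_deg_set_subset] by blast
qed

text \<open>There is no earlier variable for a binary form; the first form is specialised to the
  pure power of \<open>x_1\<close>, which divides every monomial in question.\<close>

lemma spanning_first: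
  assumes n: "0 < n" and e: "d 1 \<le> e" and sp: "\<And>l. spanning 0 l"
  shows "spanning 1 e"
proof -
  define t where "t = (\<lambda>m. if m = Poly_Mapping.single (1::nat) (d 1) then 1 else 0 :: 'a)"
  have "Poly_Mapping.single (1::nat) (d 1) \<in> monomials_deg 1 (d 1)"
    by (simp add: monomials_deg_def single_in_monomials)
  then have g: "gform (specialize 0 t) 1 1 = Poly_Mapping.single (Poly_Mapping.single (1::nat) (d 1)) 1"
    by (subst gform_special[of "{Poly_Mapping.single (1::nat) (d 1)}"]) (auto simp: specialize_def t_def)
  have "Poly_Mapping.single (Poly_Mapping.single (1::nat) (e - d 1)) 1 * gform (specialize 0 t) 1 1 \<in>
      gideal (specialize 0 t) 1 1 (mdeg (Poly_Mapping.single (1::nat) (e - d 1)) + d 1)"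
    by (rule gideal_generator) (simp_all add: single_in_monomials)
  then have "Poly_Mapping.single (Poly_Mapping.single (1::nat) e) 1 \<in> gideal (specialize 0 t) 1 1 e"
    unfolding g using e by (simp add: mult_single flip: single_add)
  then have *: "Poly_Mapping.single (Poly_Mapping.single (1::nat) e) 1 \<in> gspan (specialize 0 t) 1 1 e (std_deg_set 1 e)"
    by (rule gspan_gideal)
  have "Poly_Mapping.single m 1 \<in> gspan (specialize 0 t) (Suc 0) (Suc 0) e (std_deg_set (Suc 0) e)"
    if "m \<in> monomials_deg (Suc 0) e" for m
    by (rule gspan_specialize_all[OF sp _ that]) (use * in auto)
  then show ?thesis
    unfolding spanning_def One_nat_def using gspan_generic'[OF n std_deg_set_subset] by blast
qed

text \<open>In this degree two kinds of monomials must be eliminated: the \<open>b\<close> of degree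
  \<open>D + 1\<close>, by specialising the new form to \<open>x_i^D\<close>, and \<open>top\<close>
  times the new variable, by multiplying the known reduction of \<open>top\<close> in degree
  \<open>D\<close>. The two reductions are composed over the generic coefficients, so no single
  specialisation has to achieve both.\<close>

lemma spanning_gap:
  assumes sp: "\<And>l. spanning i l" and i: "i < n" and gap: "sigma i = d (Suc i) + 2"
  shows "spanning (Suc i) (Suc (d (Suc i)))"
proof -
  define D where "D = d (Suc i)"
  define top where "top = top_mon (std i) D"
  obtain k where k: "i = Suc k"
    using gap by (cases i) auto
  define t where "t = (\<lambda>m. if m = Poly_Mapping.single i D then 1 else 0 :: 'a)"
  \<comment> \<open>The only element of \<open>X\<close> that is not a target is \<open>top\<close>
    times the new variable.\<close>
  define X where "X = {b + Poly_Mapping.single (Suc i) (Suc D - mdeg b) | b. b \<in> std i \<and> mdeg b \<le> D}"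
  have "Poly_Mapping.single i D \<in> monomials_deg (Suc i) D"
    by (simp add: monomials_deg_def single_in_monomials k)
  then have g: "gform (specialize i t) (Suc i) (Suc i) = Poly_Mapping.single (Poly_Mapping.single i D) 1"
    by (subst gform_special[of "{Poly_Mapping.single i D}"]) (auto simp: specialize_def t_def D_def)
  have "Poly_Mapping.single m 1 \<in> gspan (specialize i t) (Suc i) (Suc i) (Suc D) X"
    if "m \<in> monomials_deg (Suc i) (Suc D)" for m
  proof (rule gspan_specialize_all[OF sp _ that])
    fix b assume b: "b \<in> std i" "mdeg b \<le> Suc D"
    show "Poly_Mapping.single (b + Poly_Mapping.single (Suc i) (Suc D - mdeg b)) 1 \<in>
        gspan (specialize i t) (Suc i) (Suc i) (Suc D) X"
    proof (cases "mdeg b \<le> D")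
      case True
      then show ?thesis
        using b by (intro gspan_keys) (auto simp: X_def)
    next
      case False
      obtain b0 j where b0: "b0 \<in> std k" "j < ht k b0" "b = b0 + Poly_Mapping.single i j"
        using b(1) unfolding k by (rule std_SucE)
      have mb: "mdeg b = Suc D"
        using False b(2) by simp
      \<comment> \<open>As \<open>sigma i = D + 2\<close>, a string of \<open>std i\<close> that
        meets degree \<open>D + 1\<close> starts in degree at most 1; its element there is divisible
        by \<open>x_i^D\<close>.\<close>
      have j: "mdeg b0 + j = Suc D" "D \<le> j"
        using height_pos[of k b0] b0 i gap mb by (auto simp: k D_def)
      let ?u = "b0 + Poly_Mapping.single i (j - D)"
      have "b0 \<in> monomials (Suc i)"
        using std_subset[OF b0(1)] monomials_mono[of k "Suc i"] k by simp
      then have "Poly_Mapping.single ?u 1 * gform (specialize i t) (Suc i) (Suc i) \<in>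
          gideal (specialize i t) (Suc i) (Suc i) (mdeg ?u + d (Suc i))"
        by (intro gideal_generator) (simp_all add: single_in_monomials k)
      moreover have "?u + Poly_Mapping.single i D = b"
        using j by (simp add: b0(3) add.assoc flip: single_add)
      moreover have "mdeg ?u + d (Suc i) = Suc D"
        using j by (simp add: D_def)
      ultimately have "Poly_Mapping.single b 1 \<in> gideal (specialize i t) (Suc i) (Suc i) (Suc D)"
        by (simp add: g mult_single)
      then show ?thesis
        using mb by (simp add: gspan_gideal)
    qed
  qed
  moreover have "X \<subseteq> monomials_deg (Suc i) (Suc D)"
    using std_subset monomials_mono[of i "Suc i"]
    by (auto simp: X_def monomials_deg_def single_in_monomials)
  ultimately have generic: "Poly_Mapping.single m 1 \<in> gspan c (Suc i) (Suc i) (Suc D) X"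
    if "m \<in> monomials_deg (Suc i) (Suc D)" for m
    using gspan_generic'[OF i] that by blast
  have lt: "d (Suc i) < sigma i"
    using gap by simp
  note tp = top_std[OF i lt, folded D_def, folded top_def]
  have std_X: "b + Poly_Mapping.single (Suc i) (Suc D - mdeg b) \<in> std_deg_set (Suc i) (Suc D)"
    if "b \<in> std i" "mdeg b \<le> D" "b \<noteq> top" for b
    using that gap by (intro std_Suc_degI) (auto simp: D_def top_def)
  have "top \<in> monomials_deg (Suc i) D"
    using tp(1,2) std_subset monomials_mono[of i "Suc i"] by (auto simp: monomials_deg_def)
  moreover have "spanning (Suc i) D"
    using spanning_small[OF sp i] lt by (simp add: D_def)
  ultimately have "Poly_Mapping.single top 1 \<in> gspan c (Suc i) (Suc i) D (std_deg_set (Suc i) D)"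
    by (simp add: spanning_def)
  then have "Poly_Mapping.single (Poly_Mapping.single (Suc i) 1) 1 * Poly_Mapping.single top 1 \<in>
      gspan c (Suc i) (Suc i) (mdeg (Poly_Mapping.single (Suc i) 1) + D) (std_deg_set (Suc i) (Suc D))"
  proof (rule gspan_single_mult)
    fix x assume "x \<in> std_deg_set (Suc i) D"
    then have x: "x \<in> std (Suc i)" "mdeg x = D"
      by (auto simp: std_deg_set_def)
    obtain b j where b: "b \<in> std i" "j < ht i b" "x = b + Poly_Mapping.single (Suc i) j"
      using x(1) by (rule std_SucE)
    \<comment> \<open>The string over \<open>top\<close> is empty, so the reduction of
      \<open>top\<close> does not lead back to it.\<close>
    have "b \<noteq> top"
      using b(2) lt by (auto simp: height_def top_def D_def)
    moreover have "mdeg b \<le> D" "Suc j = Suc D - mdeg b"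
      using x(2) b(3) by simp_all
    ultimately show "Poly_Mapping.single (Suc i) 1 + x \<in> std_deg_set (Suc i) (Suc D)"
      using std_X[OF b(1)] by (simp add: b(3) add_ac flip: single_add)
  qed (simp add: single_in_monomials)
  then have top: "Poly_Mapping.single (top + Poly_Mapping.single (Suc i) 1) 1 \<in>
      gspan c (Suc i) (Suc i) (Suc D) (std_deg_set (Suc i) (Suc D))"
    by (simp add: mult_single add.commute)
  have "Poly_Mapping.single m 1 \<in> gspan c (Suc i) (Suc i) (Suc D) (std_deg_set (Suc i) (Suc D))"
    if "m \<in> monomials_deg (Suc i) (Suc D)" for m
  proof (rule gspan_trans[OF generic[OF that]])
    fix x assume "x \<in> X"
    then obtain b where b: "b \<in> std i" "mdeg b \<le> D" "x = b + Poly_Mapping.single (Suc i) (Suc D - mdeg b)"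
      by (auto simp: X_def)
    show "Poly_Mapping.single x 1 \<in> gspan c (Suc i) (Suc i) (Suc D) (std_deg_set (Suc i) (Suc D))"
    proof (cases "b = top")
      case True
      then show ?thesis using top b tp(2) by simp
    next
      case False
      then show ?thesis using std_X[OF b(1,2)] b(3) by (intro gspan_keys) simp
    qed
  qed
  then show ?thesis
    by (simp add: spanning_def D_def)
qed

lemma binary_monomial_inj:
  "i \<noteq> k \<Longrightarrow> Poly_Mapping.single i a + Poly_Mapping.single k b = Poly_Mapping.single i a' + Poly_Mapping.single k b' \<longleftrightarrow>
    a = a' \<and> (b :: nat) = b'"
  by (auto dest!: arg_cong[of _ _ "\<lambda>m. (Poly_Mapping.lookup m i, Poly_Mapping.lookup m k)"]
      simp: lookup_add lookup_single when_def)

text \<open>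
  Here \<open>f_{i+1}\<close> is specialised to a generic binary form \<open>\<Sum>j t_j x_i^j x_{i+1}^(d-j)\<close>, and
  the earlier forms to the first \<open>i\<close> variables. Modulo the latter, \<open>x_i\<close> acts on a string of \<open>std i\<close>
  by shifting, up to strings that start in lower degree; so, by induction on the starting
  degree, multiplication by \<open>f_{i+1}\<close> becomes a Toeplitz matrix in the \<open>t_j\<close>. It is the identity
  when \<open>t\<close> is the indicator of its diagonal, hence invertible for generic \<open>t\<close>.
\<close>

lemma spanning_normal:
  assumes sp: "\<And>l. spanning i l" and i: "i < n" and k: "i = Suc k"
    and e: "d (Suc i) \<le> e" "sigma i \<le> e"
  shows "spanning (Suc i) e"
proof -
  define D where "D = d (Suc i)"
  define bin where "bin = (\<lambda>j. Poly_Mapping.single i j + Poly_Mapping.single (Suc i) (D - j))"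
  \<comment> \<open>The binary form keeps its generic coefficients: the Toeplitz matrix is inverted
    by algebraic independence within the specialised problem, and a second transfer at the end
    restores the remaining coefficients.\<close>
  define t where "t = (\<lambda>m. if m \<in> bin ` {..D} then c (Suc i, m) else 0)"
  define c0 where "c0 = specialize i t"
  define \<tau> where "\<tau> = (\<lambda>j. c (Suc i, bin j))"
  define X where "X = {b + Poly_Mapping.single (Suc i) (e - mdeg b) | b. b \<in> std i \<and> mdeg b + e < D + sigma i}"
  define V where "V = gspan c0 (Suc i) (Suc i) e X"
  \<comment> \<open>For \<open>mdeg b \<le> l \<le> e\<close> this is the monomial of degree
    \<open>e\<close> over the base \<open>b\<close> whose part in the first \<open>i\<close>
    variables has degree \<open>l\<close>.\<close>
  define z where "z = (\<lambda>b l. b + Poly_Mapping.single i (l - mdeg b) + Poly_Mapping.single (Suc i) (e - l))"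
  have bin_inj: "inj_on bin {..D}"
    by (auto simp: bin_def inj_on_def binary_monomial_inj)
  have bin_mem: "bin j \<in> monomials_deg (Suc i) D" if "j \<le> D" for j
    using that by (simp add: bin_def monomials_deg_def single_in_monomials k)
  have "gform c0 (Suc i) (Suc i) = (\<Sum>m\<in>bin ` {..D}. Poly_Mapping.single m (c0 (Suc i, m)))"
    by (rule gform_special) (use bin_mem in \<open>auto simp: D_def c0_def specialize_def t_def\<close>)
  also have "\<dots> = (\<Sum>j\<le>D. Poly_Mapping.single (bin j) (\<tau> j))"
    using bin_inj by (simp add: sum.reindex c0_def specialize_def t_def \<tau>_def)
  finally have gf: "gform c0 (Suc i) (Suc i) = (\<Sum>j\<le>D. Poly_Mapping.single (bin j) (\<tau> j))" .
  have X_std: "X \<subseteq> std_deg_set (Suc i) e"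
  proof
    fix x assume "x \<in> X"
    then obtain b where b: "b \<in> std i" "mdeg b + e < D + sigma i" "x = b + Poly_Mapping.single (Suc i) (e - mdeg b)"
      by (auto simp: X_def)
    have "mdeg b \<le> e"
      using std_deg[of i b] b(1) i e(2) by simp
    moreover have "\<not> (d (Suc i) < sigma i \<and> b = top_mon (std i) (d (Suc i)))"
      using top_std(2)[OF i] b(2) e(2) by (auto simp: D_def)
    ultimately show "x \<in> std_deg_set (Suc i) e"
      using b by (auto simp: D_def intro: std_Suc_degI)
  qed
  have strings: "Poly_Mapping.single (z b l) 1 \<in> V"
    if "b \<in> std k" "mdeg b = s" "0 < ht k b" "s \<le> l" "s + l \<le> sigma i" for b s l
    using that
  proof (induction s arbitrary: b l rule: less_induct)
    case (less s)
    note b = less.prems(1-3)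
    have ht: "ht k b + 2 * s = Suc (sigma i)"
      using height_pos[of k b] b i by (simp add: k)
    have bmon: "b \<in> monomials i" "b \<in> monomials (Suc i)"
      using std_subset[OF b(1)] monomials_mono[of k] by (simp_all add: k)
    have low: "Poly_Mapping.single (z b l) 1 \<in> V" if l: "s \<le> l" "s + l \<le> sigma i" "l + e < D + sigma i" for l
    proof -
      have "b + Poly_Mapping.single i (l - s) \<in> std i"
        unfolding k using std_SucI[OF b(1)] l ht by simp
      moreover have "mdeg (b + Poly_Mapping.single i (l - s)) = l"
        using l b(2) by simp
      ultimately have "z b l \<in> X"
        unfolding X_def using l b(2) by (intro CollectI exI[of _ "b + Poly_Mapping.single i (l - s)"]) (simp add: z_def)
      then show ?thesis
        unfolding V_def by (intro gspan_keys) simp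
    qed
    \<comment> \<open>Past the end of the string, the old forms rewrite the part of degree
      \<open>l\<close> in \<open>std i\<close>. Since \<open>sigma i < s + l\<close>, all strings of
      \<open>std i\<close> that meet degree \<open>l\<close> start below degree \<open>s\<close>, so
      the induction hypothesis applies.\<close>
    have high: "Poly_Mapping.single (z b l) 1 \<in> V" if l: "s \<le> l" "sigma i < s + l" "l \<le> e" for l
    proof -
      let ?a = "b + Poly_Mapping.single i (l - s)"
      have a: "?a \<in> monomials i" "mdeg ?a = l"
        using bmon l b(2) by (simp_all add: single_in_monomials k)
      define Y where "Y = {b' + Poly_Mapping.single (Suc i) (e - l) | b'. b' \<in> std i \<and> mdeg b' = mdeg ?a}"
      have "mdeg ?a + (e - l) = e"
        using l a(2) by linarith
      then have Y: "Poly_Mapping.single (?a + Poly_Mapping.single (Suc i) (e - l)) 1 \<in> gspan c0 (Suc i) (Suc i) e Y"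
        unfolding c0_def Y_def by (rule gspan_specialize_old[OF sp a(1)])
      have "Poly_Mapping.single (?a + Poly_Mapping.single (Suc i) (e - l)) 1 \<in> V"
        unfolding V_def
      proof (rule gspan_trans[OF Y])
        fix x assume "x \<in> Y"
        then obtain b' where b': "b' \<in> std i" "mdeg b' = l" "x = b' + Poly_Mapping.single (Suc i) (e - l)"
          unfolding Y_def a(2) by blast
        obtain b1 j where b1: "b1 \<in> std k" "j < ht k b1" "b' = b1 + Poly_Mapping.single i j"
          using b'(1) unfolding k by (rule std_SucE)
        have h1: "ht k b1 + 2 * mdeg b1 = Suc (sigma i)"
          using height_pos[of k b1] b1(2) i by (simp add: k)
        have deg: "mdeg b1 + j = l"
          using b'(2) b1(3) by simp
        have "Poly_Mapping.single (z b1 l) 1 \<in> V"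
          using deg h1 b1 l by (intro less.IH[of "mdeg b1"]) linarith+
        moreover have "z b1 l = x"
          using deg by (auto simp: z_def b'(3) b1(3))
        ultimately show "Poly_Mapping.single x 1 \<in> gspan c0 (Suc i) (Suc i) e X"
          by (simp add: V_def)
      qed
      then show ?thesis
        using b(2) by (simp add: z_def)
    qed
    show ?case
    proof (cases "l + e < D + sigma i")
      case True
      then show ?thesis using low less.prems by blast
    next
      case False
      define K where "K = e - D"
      have K: "e = D + K"
        using e(1) by (simp add: K_def D_def)
      have sK: "s \<le> K"
        using False less.prems(5) K by linarith
      \<comment> \<open>Positions below \<open>lo\<close> lie before the string or are covered by
        \<open>low\<close>, and \<open>lo + w\<close> is its last position. The \<open>w + 1\<close>
        unknown positions are matched by \<open>w + 1\<close> multipliers, with exponents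
        \<open>u \<le> w\<close> of \<open>x_i\<close>.\<close>
      define lo where "lo = max s (sigma i - K)"
      define w where "w = sigma i - s - lo"
      \<comment> \<open>\<open>sigma i \<le> e\<close> enters through \<open>lo - s \<le> D\<close>:
        the diagonal of the Toeplitz matrix carries an actual coefficient of the form.\<close>
      have lo: "s \<le> lo" "sigma i \<le> lo + K" "lo + w + s = sigma i" "lo - s \<le> D" "w + s \<le> K"
        using less.prems(4,5) False sK K e(2) unfolding lo_def w_def by linarith+
      define q where "q = (\<lambda>u v. if s + u \<le> lo + v \<and> lo + v \<le> s + u + D then Some (Suc i, bin (lo + v - (s + u))) else None)"
      define q0 where "q0 = (\<lambda>x. if x = (Suc i, bin (lo - s)) then 1 else 0 :: 'a)"
      have row: "(\<Sum>v\<le>w. Poly_Mapping.single (z b (lo + v)) (entry_eval c (q u v))) \<in> V" if u: "u \<le> w" for u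
      proof -
        let ?m = "b + Poly_Mapping.single i u + Poly_Mapping.single (Suc i) (K - s - u)"
        let ?f = "\<lambda>j. Poly_Mapping.single (z b (s + u + j)) (\<tau> j)"
        define J where "J = {j. j \<le> D \<and> lo \<le> s + u + j \<and> s + u + j \<le> lo + w}"
        have "?m + bin j = z b (s + u + j)" if "j \<le> D" for j
        proof -
          have "e - (s + u + j) = K - s - u + (D - j)"
            using that u lo K by linarith
          then have "Poly_Mapping.single (Suc i) (e - (s + u + j)) =
              Poly_Mapping.single (Suc i) (K - s - u) + Poly_Mapping.single (Suc i) (D - j)"
            by (simp add: single_add)
          moreover have "Poly_Mapping.single i (s + u + j - s) = Poly_Mapping.single i u + Poly_Mapping.single i j"
            by (simp add: single_add)
          ultimately show ?thesis
            unfolding z_def bin_def b(2) by (simp only: add_ac)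
        qed
        then have P: "Poly_Mapping.single ?m 1 * gform c0 (Suc i) (Suc i) = (\<Sum>j\<le>D. ?f j)"
          unfolding gf sum_distrib_left mult_single by (intro sum.cong) auto
        have "?m \<in> monomials (Suc i)"
          using bmon by (simp add: single_in_monomials k)
        then have "Poly_Mapping.single ?m 1 * gform c0 (Suc i) (Suc i) \<in>
            gideal c0 (Suc i) (Suc i) (mdeg ?m + d (Suc i))"
          by (intro gideal_generator) simp_all
        moreover have "mdeg ?m + d (Suc i) = e"
          using u lo K b(2) by (simp add: D_def)
        ultimately have "(\<Sum>j\<le>D. ?f j) \<in> V"
          unfolding V_def using P by (intro gspan_gideal) simp
        moreover have "(\<Sum>j\<in>{..D} - J. ?f j) \<in> V"
          unfolding V_def
        proof (rule gspan_sum)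
          fix j assume j: "j \<in> {..D} - J"
          have "Poly_Mapping.single (z b (s + u + j)) 1 \<in> V"
          proof (cases "s + u + j < lo")
            case True
            then have "s + u + j + e < D + sigma i"
              using K unfolding lo_def by linarith
            moreover have "s + (s + u + j) \<le> sigma i"
              using True lo by linarith
            ultimately show ?thesis
              by (intro low) auto
          next
            case False
            with j have "lo + w < s + u + j" "j \<le> D"
              by (auto simp: J_def)
            then show ?thesis
              using lo u K by (intro high) linarith+
          qed
          from gspan_smult[OF this[unfolded V_def], of "\<tau> j"]
          show "?f j \<in> gspan c0 (Suc i) (Suc i) e X"
            by (simp add: mult_single)
        qed
        moreover have "(\<Sum>j\<le>D. ?f j) = (\<Sum>j\<in>{..D} - J. ?f j) + (\<Sum>j\<in>J. ?f j)"
          by (rule sum.subset_diff) (auto simp: J_def)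
        ultimately have "(\<Sum>j\<in>J. ?f j) \<in> V"
          using gspan_diff[of "\<Sum>j\<le>D. ?f j" c0 "Suc i" "Suc i" e X "\<Sum>j\<in>{..D} - J. ?f j"] by (simp add: V_def)
        also have "(\<Sum>j\<in>J. ?f j) = (\<Sum>v | v \<le> w \<and> s + u \<le> lo + v \<and> lo + v \<le> s + u + D.
            Poly_Mapping.single (z b (lo + v)) (\<tau> (lo + v - (s + u))))"
          by (rule sum.reindex_bij_witness[of _ "\<lambda>v. lo + v - (s + u)" "\<lambda>j. s + u + j - lo"])
             (auto simp: J_def)
        also have "\<dots> = (\<Sum>v\<le>w. Poly_Mapping.single (z b (lo + v)) (entry_eval c (q u v)))"
          by (rule sum.mono_neutral_cong_left) (auto simp: q_def entry_eval_def \<tau>_def)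
        finally show ?thesis .
      qed
      have "\<exists>lam. \<forall>v\<in>{..w}. \<forall>v'\<in>{..w}.
          (\<Sum>u\<in>{..w}. lam v u * entry_eval c (q u v')) = (if v = v' then 1 else 0)"
      proof (rule generic_left_inverse[OF F indep_restrict[of "Suc i" "Suc i"],
            where ?c0.0 = q0 and lam = "\<lambda>v u. if v = u then 1 else 0"])
        show "x \<in> (SIGMA j:{1..Suc i}. monomials_deg (Suc i) (d j))" if "q u v = Some x" for u v x
          using that bin_mem by (auto simp: q_def D_def split: if_splits)
        fix v v' assume v: "v \<in> {..w}" "v' \<in> {..w}"
        have "entry_eval q0 (q v v') = (if v = v' then 1 else 0)"
        proof (cases "s + v \<le> lo + v' \<and> lo + v' \<le> s + v + D")
          case True
          then have "lo + v' - (s + v) \<le> D"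
            by linarith
          then have "bin (lo + v' - (s + v)) = bin (lo - s) \<longleftrightarrow> lo + v' - (s + v) = lo - s"
            using lo(4) by (intro inj_on_eq_iff[OF bin_inj]) simp_all
          also have "\<dots> \<longleftrightarrow> v = v'"
            using True lo(1) by linarith
          finally show ?thesis
            using True by (simp add: q_def q0_def entry_eval_def)
        next
          case False
          then show ?thesis
            using lo(1,4) by (auto simp: q_def entry_eval_def)
        qed
        then show "(\<Sum>u\<in>{..w}. (if v = u then 1 else 0) * entry_eval q0 (q u v')) = (if v = v' then 1 else 0)"
          using v by (simp add: if_distrib[of "\<lambda>x. x * _"] cong: if_cong)
      qed (use i in auto)
      then obtain lam where lam: "\<And>v v'. v \<le> w \<Longrightarrow> v' \<le> w \<Longrightarrow>
          (\<Sum>u\<le>w. lam v u * entry_eval c (q u v')) = (if v = v' then 1 else 0)"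
        by auto
      define v where "v = l - lo"
      have v: "v \<le> w" "l = lo + v"
        using lo less.prems(4,5) False K unfolding v_def lo_def by linarith+
      have "(\<Sum>u\<le>w. Poly_Mapping.single 0 (lam v u) *
          (\<Sum>v'\<le>w. Poly_Mapping.single (z b (lo + v')) (entry_eval c (q u v')))) \<in> V"
        unfolding V_def
      proof (rule gspan_sum, rule gspan_smult)
        fix u assume "u \<in> {..w}"
        then show "(\<Sum>v'\<le>w. Poly_Mapping.single (z b (lo + v')) (entry_eval c (q u v'))) \<in> gspan c0 (Suc i) (Suc i) e X"
          using row[of u] by (simp add: V_def)
      qed
      also have "(\<Sum>u\<le>w. Poly_Mapping.single 0 (lam v u) *
          (\<Sum>v'\<le>w. Poly_Mapping.single (z b (lo + v')) (entry_eval c (q u v')))) =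
          (\<Sum>v'\<le>w. \<Sum>u\<le>w. Poly_Mapping.single (z b (lo + v')) (lam v u * entry_eval c (q u v')))"
        unfolding sum_distrib_left mult_single by (subst sum.swap) simp
      also have "\<dots> = (\<Sum>v'\<le>w. Poly_Mapping.single (z b (lo + v')) (\<Sum>u\<le>w. lam v u * entry_eval c (q u v')))"
        by (intro sum.cong refl poly_mapping_eqI) (simp add: lookup_sum lookup_single when_def)
      also have "\<dots> = (\<Sum>v'\<le>w. if v = v' then Poly_Mapping.single (z b (lo + v')) 1 else 0)"
        using v by (intro sum.cong) (simp_all add: lam)
      also have "\<dots> = Poly_Mapping.single (z b l) 1"
        using v by simp
      finally show ?thesis .
    qed
  qed
  have "Poly_Mapping.single m 1 \<in> gspan (specialize i t) (Suc i) (Suc i) e (std_deg_set (Suc i) e)"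
    if "m \<in> monomials_deg (Suc i) e" for m
  proof (rule gspan_specialize_all[OF sp _ that])
    fix b assume b: "b \<in> std i" "mdeg b \<le> e"
    obtain b0 j where b0: "b0 \<in> std k" "j < ht k b0" "b = b0 + Poly_Mapping.single i j"
      using b(1) unfolding k by (rule std_SucE)
    have deg: "mdeg b0 + j = mdeg b"
      by (simp add: b0(3))
    have "Poly_Mapping.single (z b0 (mdeg b)) 1 \<in> V"
      using height_pos[of k b0] b0(1,2) i deg k by (intro strings[of _ "mdeg b0"]) auto
    moreover have "z b0 (mdeg b) = b + Poly_Mapping.single (Suc i) (e - mdeg b)"
      using deg by (auto simp: z_def b0(3))
    ultimately show "Poly_Mapping.single (b + Poly_Mapping.single (Suc i) (e - mdeg b)) 1 \<in>
        gspan (specialize i t) (Suc i) (Suc i) e (std_deg_set (Suc i) e)"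
      using gspan_mono[OF X_std] by (simp add: V_def c0_def)
  qed
  then show ?thesis
    unfolding spanning_def using gspan_generic'[OF i std_deg_set_subset] by blast
qed

lemma spanning_all: "i \<le> n \<Longrightarrow> spanning i e"
proof (induction i arbitrary: e)
  case (0 e)
  have "m \<in> std_deg_set 0 e" if "m \<in> monomials_deg 0 e" for m
    using that by (auto simp: std_deg_set_def monomials_deg_def monomials_def)
  then show ?case
    unfolding spanning_def by (intro ballI gspan_keys) auto
next
  case (Suc i e)
  then have sp: "\<And>l. spanning i l" and i: "i < n"
    by simp_all
  \<comment> \<open>By \<open>d_large\<close>, the only degree strictly between
    \<open>d (Suc i)\<close> and \<open>sigma i\<close> is \<open>d (Suc i) + 1\<close>, and it
    occurs only if they differ by 2.\<close>
  consider "e < d (Suc i) \<or> e = d (Suc i) \<and> d (Suc i) < sigma i"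
    | "d (Suc i) \<le> e" "sigma i \<le> e" | "e = Suc (d (Suc i))" "sigma i = d (Suc i) + 2"
    using d_large[OF i] by linarith
  then show ?case
  proof cases
    case 1
    then show ?thesis by (rule spanning_small[OF sp i])
  next
    case 2
    show ?thesis
    proof (cases i)
      case 0
      then show ?thesis
        using spanning_first[of e] 2 sp i by simp
    next
      case (Suc k)
      then show ?thesis
        using spanning_normal[OF sp i _ 2] by simp
    qed
  next
    case 3
    then show ?thesis using spanning_gap[OF sp i] by simp
  qed
qed

end

subsection \<open>Linear independence and leading monomials\<close>

lemma lookup_scalar_mult:
  fixes p :: "'a::semiring_0 mpol"
  shows "Poly_Mapping.lookup (Poly_Mapping.single 0 a * p) m = a * Poly_Mapping.lookup p m"
  using lookup_single_mult_add[of 0 a p m] by simp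

context form_degrees
begin

lemma gideal_SucE:
  assumes "p \<in> gideal c (Suc i) N e"
  obtains p' g where "p' \<in> gideal c i N e"
    "\<forall>\<mu>\<in>Poly_Mapping.keys g. \<mu> \<in> monomials N \<and> mdeg \<mu> + d (Suc i) = e"
    "p = p' + g * gform c N (Suc i)"
proof -
  obtain g where g: "gcoeffs (Suc i) N e g" "p = (\<Sum>j=1..Suc i. g j * gform c N j)"
    using assms by (rule gidealE)
  have "(\<Sum>j=1..i. g j * gform c N j) \<in> gideal c i N e"
    by (rule gidealI[of _ g]) (use gcoeffsD[OF g(1)] in auto)
  moreover have "p = (\<Sum>j=1..i. g j * gform c N j) + g (Suc i) * gform c N (Suc i)"
    using g(2) by simp
  ultimately show thesis
    using that gcoeffsD[OF g(1), of "Suc i"] by auto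
qed

lemma gideal_mult_form:
  assumes "p \<in> gideal c i N e" "Poly_Mapping.keys r \<subseteq> monomials_deg N l" "l + e = e'"
  shows "r * p \<in> gideal c i N e'"
proof -
  have "Poly_Mapping.single m (Poly_Mapping.lookup r m) * p \<in> gideal c i N e'" if "m \<in> Poly_Mapping.keys r" for m
    using gideal_single_mult[OF assms(1), of m] assms(2,3) that by (auto simp: monomials_deg_def)
  then have "(\<Sum>m\<in>Poly_Mapping.keys r. Poly_Mapping.single m (Poly_Mapping.lookup r m) * p) \<in> gideal c i N e'"
    by (rule gideal_sum)
  then show ?thesis
    by (simp flip: sum_distrib_right sum_singles)
qed

end

section \<open>Reduction to normal monomials that are not larger\<close>

context generic_setup
begin

text \<open>This strengthens \<open>spanning\<close> by controlling the order, and it allows more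
  variables than forms.\<close>

definition reduces :: "nat \<Rightarrow> nat \<Rightarrow> bool" where
  "reduces i N \<longleftrightarrow> (\<forall>m\<in>monomials N.
     Poly_Mapping.single m 1 \<in> gspan c i N (mdeg m) {x \<in> normals i N. grevlex_below x m})"

text \<open>Spanning alone says nothing about the order. By \<open>std_below_new\<close>, however,
  every standard monomial is smaller than every cut-off monomial of its degree, so any expression of
  the latter in standard monomials is decreasing.\<close>

lemma reduces_next_form:
  assumes i: "i < n" and red: "reduces i (Suc i)"
  shows "reduces (Suc i) (Suc i)"
  unfolding reduces_def
proof
  fix m assume m: "m \<in> monomials (Suc i)"
  have "Poly_Mapping.single m 1 \<in> gspan c (Suc i) (Suc i) (mdeg m) {x \<in> normals i (Suc i). grevlex_below x m}"
    by (rule gspan_mono_gideal[of i]) (use red m in \<open>auto simp: reduces_def\<close>)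
  then show "Poly_Mapping.single m 1 \<in> gspan c (Suc i) (Suc i) (mdeg m) {x \<in> normals (Suc i) (Suc i). grevlex_below x m}"
  proof (rule gspan_trans)
    fix x assume "x \<in> {x \<in> normals i (Suc i). grevlex_below x m}"
    then have x: "x \<in> normals i (Suc i)" "grevlex_below x m" by auto
    have mx: "mdeg x = mdeg m"
      using x(2) by (simp add: grevlex_below_def)
    have xm: "x \<in> monomials (Suc i)"
      using normals_subset[OF _ x(1)] by simp
    obtain b j where bj: "b \<in> monomials i" "x = b + Poly_Mapping.single (Suc i) j"
      using xm by (rule monomials_SucE)
    have b: "b \<in> std i"
      using x(1) normals_iff[OF bj(1), of "Poly_Mapping.single (Suc i) j" "Suc i"] bj(2) by simp
    show "Poly_Mapping.single x 1 \<in> gspan c (Suc i) (Suc i) (mdeg m) {x \<in> normals (Suc i) (Suc i). grevlex_below x m}"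
    proof (cases "j < ht i b")
      case True
      then have "x \<in> std (Suc i)"
        using std_SucI[OF b] bj(2) by simp
      then show ?thesis
        using x(2) by (intro gspan_keys) simp
    next
      case False
      have "Poly_Mapping.single x 1 \<in> gspan c (Suc i) (Suc i) (mdeg m) (std_deg_set (Suc i) (mdeg m))"
        using spanning_all[of "Suc i" "mdeg m"] i xm mx by (simp add: spanning_def monomials_deg_def)
      moreover have "std_deg_set (Suc i) (mdeg m) \<subseteq> {x \<in> normals (Suc i) (Suc i). grevlex_below x m}"
      proof
        fix y assume "y \<in> std_deg_set (Suc i) (mdeg m)"
        then have y: "y \<in> std (Suc i)" "mdeg y = mdeg m"
          by (auto simp: std_deg_set_def)
        obtain b' j' where b': "b' \<in> std i" "j' < ht i b'" "y = b' + Poly_Mapping.single (Suc i) j'"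
          using y(1) by (rule std_SucE)
        have "mdeg b + j = mdeg b' + j'"
          using y(2) mx bj(2) b'(3) by simp
        then have "grevlex_less y x"
          unfolding bj(2) b'(3) using False by (intro std_below_new[OF i b _ b'(1,2)]) simp_all
        then have "grevlex_below y x"
          using y(2) mx by (simp add: grevlex_below_def)
        then show "y \<in> {x \<in> normals (Suc i) (Suc i). grevlex_below x m}"
          using y(1) grevlex_below_trans[OF _ x(2)] by simp
      qed
      ultimately show ?thesis
        by (rule gspan_mono[rotated])
    qed
  qed
qed

text \<open>A multiple of the new variable is reduced after division by it. For other
  \<open>m\<close>, the reduction in \<open>N\<close> variables is lifted to the forms in one more
  variable; the error terms are multiples of the new variable, hence smaller than
  \<open>m\<close>.\<close>

lemma reduces_next_variable:
  assumes iN: "i \<le> N" and red: "reduces i N"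
  shows "reduces i (Suc N)"
proof -
  have "Poly_Mapping.single m 1 \<in> gspan c i (Suc N) (mdeg m) {x \<in> normals i (Suc N). grevlex_below x m}"
    if "m \<in> monomials (Suc N)" for m
    using that
  proof (induction "mdeg m" arbitrary: m rule: less_induct)
    case less
    \<comment> \<open>Stated for all multiples of the new variable in the degree of
      \<open>m\<close>, because the error terms below are of this kind.\<close>
    have divisible: "Poly_Mapping.single m' 1 \<in> gspan c i (Suc N) (mdeg m') {x \<in> normals i (Suc N). grevlex_below x m'}"
      if m': "m' \<in> monomials (Suc N)" "mdeg m' = mdeg m" "Poly_Mapping.lookup m' (Suc N) > 0" for m'
    proof -
      define y :: mon where "y = Poly_Mapping.single (Suc N) 1"
      obtain a j where a: "a \<in> monomials N" "m' = a + Poly_Mapping.single (Suc N) j"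
        using m'(1) by (rule monomials_SucE)
      have "Poly_Mapping.lookup a (Suc N) = 0"
        using a(1) by (simp add: monomials_iff)
      then have "j > 0"
        using m'(3) a(2) by (simp add: lookup_add)
      define m'' where "m'' = a + Poly_Mapping.single (Suc N) (j - 1)"
      have eq: "m' = m'' + y"
        using \<open>j > 0\<close> by (simp add: a(2) m''_def y_def add.assoc flip: single_add)
      have y: "mdeg y = 1" "y \<in> monomials (Suc N)"
        by (simp_all add: y_def single_in_monomials)
      have m'': "m'' \<in> monomials (Suc N)"
        using m'(1) eq by simp
      have "mdeg m'' < mdeg m"
        using eq m'(2) y by simp
      from less.hyps[OF this m'']
      have "Poly_Mapping.single y 1 * Poly_Mapping.single m'' 1 \<in>
          gspan c i (Suc N) (mdeg y + mdeg m'') {x \<in> normals i (Suc N). grevlex_below x m'}"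
      proof (rule gspan_single_mult[OF _ y(2)])
        fix x assume x: "x \<in> {x \<in> normals i (Suc N). grevlex_below x m''}"
        then have "x + y \<in> normals i (Suc N)"
          using iN by (intro normals_add[of x i "Suc N"]) (auto simp: y_def)
        moreover have "grevlex_below (x + y) m'"
          unfolding eq using x by (intro grevlex_below_add_right) simp
        ultimately show "y + x \<in> {x \<in> normals i (Suc N). grevlex_below x m'}"
          by (simp add: add.commute)
      qed
      then show ?thesis
        by (simp add: eq mult_single add.commute)
    qed
    show ?case
    proof (cases "Poly_Mapping.lookup m (Suc N) > 0")
      case True
      then show ?thesis using divisible less.prems by blast
    next
      case False
      then have mN: "m \<in> monomials N"
        using less.prems by (auto simp: monomials_iff not_less_eq_eq le_Suc_eq)
      let ?X = "{x \<in> normals i (Suc N). grevlex_below x m}"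
      have "Poly_Mapping.single m 1 \<in> gspan c i N (mdeg m) {x \<in> normals i N. grevlex_below x m}"
        using red mN by (simp add: reduces_def)
      then obtain p q where pq: "p \<in> gideal c i N (mdeg m)"
        "Poly_Mapping.keys q \<subseteq> {x \<in> normals i N. grevlex_below x m}" "Poly_Mapping.single m 1 = p + q"
        by (rule gspanE)
      obtain g where g: "gcoeffs i N (mdeg m) g" "p = (\<Sum>j=1..i. g j * gform c N j)"
        using pq(1) by (rule gidealE)
      define p' where "p' = (\<Sum>j=1..i. g j * gform c (Suc N) j)"
      have p': "p' \<in> gideal c i (Suc N) (mdeg m)"
      proof (rule gidealI[OF _ p'_def])
        show "\<mu> \<in> monomials (Suc N) \<and> mdeg \<mu> + d j = mdeg m"
          if "1 \<le> j" "j \<le> i" "\<mu> \<in> Poly_Mapping.keys (g j)" for j \<mu>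
          using gcoeffsD[OF g(1) that] monomials_mono[of N "Suc N" \<mu>] by simp
      qed
      have diff: "p - p' = (\<Sum>j=1..i. g j * (gform c N j - gform c (Suc N) j))"
        by (simp add: g(2) p'_def right_diff_distrib sum_subtractf)
      have "p - p' \<in> gspan c i (Suc N) (mdeg m) ?X"
      proof (rule gspan_of_keys)
        fix m' assume m'_key: "m' \<in> Poly_Mapping.keys (p - p')"
        obtain j where j: "j \<in> {1..i}" "m' \<in> Poly_Mapping.keys (g j * (gform c N j - gform c (Suc N) j))"
          using subsetD[OF keys_sum m'_key[unfolded diff]] by blast
        then obtain a b where ab: "a \<in> Poly_Mapping.keys (g j)"
          "b \<in> Poly_Mapping.keys (gform c N j - gform c (Suc N) j)" "m' = a + b"
          using keys_mult by blast
        have a: "a \<in> monomials N" "mdeg a + d j = mdeg m"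
          using gcoeffsD[OF g(1) _ _ ab(1)] j(1) by auto
        have b: "b \<in> monomials (Suc N)" "mdeg b = d j" "b \<notin> monomials N"
          using ab(2) monomials_mono[of N "Suc N" b]
          by (auto simp: in_keys_iff lookup_minus lookup_gform monomials_deg_def split: if_splits)
        then have "Poly_Mapping.lookup b (Suc N) > 0"
          by (auto simp: monomials_iff not_less_eq_eq le_Suc_eq)
        then have m': "m' \<in> monomials (Suc N)" "mdeg m' = mdeg m" "Poly_Mapping.lookup m' (Suc N) > 0"
          using a b monomials_mono[of N "Suc N" a] by (auto simp: ab(3) lookup_add)
        then have "grevlex_less m' m"
          using less.prems False by (intro grevlex_less_last[of _ _ N]) simp_all
        then have "{x \<in> normals i (Suc N). grevlex_below x m'} \<subseteq> ?X"
          using m'(2) grevlex_below_trans[of _ m' m] by (auto simp: grevlex_below_def)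
        with divisible[OF m'] show "Poly_Mapping.single m' 1 \<in> gspan c i (Suc N) (mdeg m) ?X"
          using gspan_mono m'(2) by metis
      qed
      moreover have "Poly_Mapping.keys q \<subseteq> ?X"
        using pq(2) normals_mono[of N "Suc N"] by auto
      ultimately have "p' + (p - p') + q \<in> gspan c i (Suc N) (mdeg m) ?X"
        by (rule gspan_add[OF gspan_add[OF gspan_gideal[OF p']] gspan_keys])
      then show ?thesis
        by (simp add: pq(3))
    qed
  qed
  then show ?thesis
    by (simp add: reduces_def)
qed

text \<open>A new form enters when there are as many variables as forms, where
  \<open>spanning_all\<close> applies; the remaining variables follow one at a time.\<close>

lemma reduces_all: "i \<le> n \<Longrightarrow> i \<le> N \<Longrightarrow> reduces i N"
proof (induction i arbitrary: N)
  case (0 N)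
  then show ?case
    unfolding reduces_def by (auto intro!: gspan_keys)
next
  case (Suc i N)
  from Suc.prems(2) show ?case
  proof (induction N rule: dec_induct)
    case base
    show ?case
      using Suc.IH[of "Suc i"] Suc.prems(1) by (intro reduces_next_form) auto
  next
    case (step N)
    then show ?case by (intro reduces_next_variable) auto
  qed
qed

lemma normal_form:
  assumes "i \<le> n" "Poly_Mapping.keys r \<subseteq> monomials_deg n e"
  shows "\<exists>v. Poly_Mapping.keys v \<subseteq> {x \<in> normals i n. mdeg x = e} \<and> r - v \<in> gideal c i n e"
proof -
  have "r \<in> gspan c i n e {x \<in> normals i n. mdeg x = e}"
  proof (rule gspan_of_keys)
    fix m assume "m \<in> Poly_Mapping.keys r"
    then have m: "m \<in> monomials n" "mdeg m = e"
      using assms(2) by (auto simp: monomials_deg_def)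
    then have "Poly_Mapping.single m 1 \<in> gspan c i n e {x \<in> normals i n. grevlex_below x m}"
      using reduces_all[OF assms(1,1)] by (auto simp: reduces_def)
    then show "Poly_Mapping.single m 1 \<in> gspan c i n e {x \<in> normals i n. mdeg x = e}"
      by (rule gspan_mono[rotated]) (use m in \<open>auto simp: grevlex_below_def\<close>)
  qed
  then show ?thesis
    by (auto elim!: gspanE)
qed

text \<open>An old standard monomial \<open>b + w\<close> is sent to \<open>\<phi> b\<close>, times
  the first power of the new variable that is cut off over \<open>\<phi> b\<close>, times
  \<open>w\<close>. The degree equation of \<open>\<phi>\<close> puts the image in degree
  \<open>e\<close>.\<close>

lemma card_new_leading:
  assumes i: "i < n"
  shows "card {x \<in> normals i n. mdeg x + d (Suc i) = e} \<le>
    card {x \<in> normals i n. mdeg x = e \<and> x \<notin> normals (Suc i) n}" (is "card ?U \<le> card ?T")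
proof -
  obtain \<phi> where \<phi>: "\<And>b. b \<in> std i \<Longrightarrow> \<phi> b \<in> std i" "inj_on \<phi> (std i)"
    "\<And>b. b \<in> std i \<Longrightarrow> mdeg (\<phi> b) + ht i (\<phi> b) = d (Suc i) + mdeg b"
    using std_shift_injection[OF i] by metis
  define P where "P = {(b, w). b \<in> std i \<and> Poly_Mapping.keys w \<subseteq> {i+1..n} \<and> mdeg b + mdeg w + d (Suc i) = e}"
  define s where "s = (\<lambda>b. Poly_Mapping.single (Suc i) (ht i (\<phi> b)))"
  define h where "h = (\<lambda>(b, w). \<phi> b + (s b + w))"
  have keys: "Poly_Mapping.keys (s b + w) \<subseteq> {i+1..n}" if "Poly_Mapping.keys w \<subseteq> {i+1..n}" for b w
    using Poly_Mapping.keys_add[of "s b" w] that i by (auto simp: s_def split: if_splits)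
  have "finite ?T"
    by (rule finite_subset[OF _ finite_monomials_deg[of n e]])
      (use normals_subset[of i n] i in \<open>auto simp: monomials_deg_def\<close>)
  moreover have "inj_on h P"
  proof (rule inj_onI)
    fix x y assume xy: "x \<in> P" "y \<in> P" "h x = h y"
    obtain b w b' w' where xy_eq: "x = (b, w)" "y = (b', w')"
      by (cases x, cases y)
    have b: "b \<in> std i" "b' \<in> std i"
      and w: "Poly_Mapping.keys w \<subseteq> {i+1..n}" "Poly_Mapping.keys w' \<subseteq> {i+1..n}"
      and eq: "\<phi> b + (s b + w) = \<phi> b' + (s b' + w')"
      using xy by (simp_all add: P_def h_def xy_eq)
    note split = monomials_split_unique[OF std_subset[OF \<phi>(1)[OF b(1)]] std_subset[OF \<phi>(1)[OF b(2)]]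
        keys[OF w(1)] keys[OF w(2)] eq]
    have "b = b'"
      using inj_onD[OF \<phi>(2) split(1) b] .
    with split(2) show "x = y"
      by (simp add: xy_eq)
  qed
  moreover have "h ` P \<subseteq> ?T"
  proof
    fix x assume "x \<in> h ` P"
    then obtain b w where x: "b \<in> std i" "Poly_Mapping.keys w \<subseteq> {i+1..n}" "mdeg b + mdeg w + d (Suc i) = e"
      "x = \<phi> b + (s b + w)"
      by (auto simp: P_def h_def)
    have "x \<notin> normals (Suc i) n"
      unfolding x(4) normals_Suc_iff[OF \<phi>(1)[OF x(1)] keys[OF x(2)]] by (simp add: s_def lookup_add)
    moreover have "x \<in> normals i n"
      unfolding x(4) normals_iff[OF std_subset[OF \<phi>(1)[OF x(1)]] keys[OF x(2)]] by (rule \<phi>(1)[OF x(1)])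
    moreover have "mdeg x = e"
      using \<phi>(3)[OF x(1)] x(3) by (simp add: x(4) s_def)
    ultimately show "x \<in> ?T" by simp
  qed
  ultimately have P: "finite P" "card P \<le> card ?T"
    by (auto intro: inj_on_finite card_inj_on_le)
  have "?U = (\<lambda>(b, w). b + w) ` P"
    unfolding P_def normals_def by (auto simp: image_iff)
  then show ?thesis
    using card_image_le[OF P(1), of "\<lambda>(b, w). b + w"] P(2) by simp
qed

text \<open>Let \<open>V u\<close> be the normal form, modulo the old forms, of \<open>u\<close>
  times the new form. Reducing each removed monomial in \<open>T\<close> shows that the
  \<open>T\<close>-coordinates of the \<open>V u\<close> have a matrix \<open>A\<close> with
  \<open>A V = 1\<close>. Since \<open>U\<close> is no larger than \<open>T\<close>, no nontrivial
  combination of the \<open>V u\<close> has vanishing \<open>T\<close>-coordinates, whereas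
  \<open>p\<close> is such a combination supported off \<open>T\<close>.\<close>

lemma normals_independent:
  "i \<le> n \<Longrightarrow> p \<in> gideal c i n e \<Longrightarrow> Poly_Mapping.keys p \<subseteq> normals i n \<Longrightarrow> p = 0"
proof (induction i arbitrary: p e)
  case (Suc i)
  have i: "i < n" "i \<le> n" using Suc.prems(1) by simp_all
  let ?f = "gform c n (Suc i)"
  let ?B = "{x \<in> normals i n. mdeg x = e}"
  define U where "U = {x \<in> normals i n. mdeg x + d (Suc i) = e}"
  define T where "T = {x \<in> normals i n. mdeg x = e \<and> x \<notin> normals (Suc i) n}"
  have "U \<subseteq> monomials_deg n (e - d (Suc i))" "T \<subseteq> monomials_deg n e"
    using normals_subset[OF i(2)] by (auto simp: U_def T_def monomials_deg_def)
  then have finU: "finite U" and finT: "finite T"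
    using finite_monomials_deg finite_subset by blast+
  have "\<exists>v. Poly_Mapping.keys v \<subseteq> ?B \<and> Poly_Mapping.single u 1 * ?f - v \<in> gideal c i n e" if "u \<in> U" for u
  proof (rule normal_form[OF i(2)])
    show "Poly_Mapping.keys (Poly_Mapping.single u 1 * ?f) \<subseteq> monomials_deg n e"
      using keys_single_mult[of u 1 ?f] keys_gform[of c n "Suc i"] that normals_subset[OF i(2)]
      by (fastforce simp: U_def monomials_deg_def)
  qed
  then have "\<exists>V. \<forall>u\<in>U. Poly_Mapping.keys (V u) \<subseteq> ?B \<and> Poly_Mapping.single u 1 * ?f - V u \<in> gideal c i n e"
    by (intro bchoice ballI)
  then obtain V where "\<forall>u\<in>U. Poly_Mapping.keys (V u) \<subseteq> ?B \<and> Poly_Mapping.single u 1 * ?f - V u \<in> gideal c i n e" ..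
  then have V: "Poly_Mapping.keys (V u) \<subseteq> ?B" "Poly_Mapping.single u 1 * ?f - V u \<in> gideal c i n e" if "u \<in> U" for u
    using that by simp_all
  \<comment> \<open>The multiplier of the new form is replaced by its normal form modulo the old
    ones. What remains lies in the old ideal and is supported on old normal monomials, so it
    vanishes by induction.\<close>
  have expand: "\<exists>b. r = (\<Sum>u\<in>U. Poly_Mapping.single 0 (b u) * V u) + s"
    if r: "r - s \<in> gideal c (Suc i) n e" "Poly_Mapping.keys r \<subseteq> normals i n" "Poly_Mapping.keys s \<subseteq> normals i n" for r s
  proof -
    obtain p' g where g: "p' \<in> gideal c i n e"
      "\<forall>\<mu>\<in>Poly_Mapping.keys g. \<mu> \<in> monomials n \<and> mdeg \<mu> + d (Suc i) = e" "r - s = p' + g * ?f"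
      using r(1) by (rule gideal_SucE)
    have "\<exists>q. Poly_Mapping.keys q \<subseteq> U \<and> (g - q) * ?f \<in> gideal c i n e"
    proof (cases "d (Suc i) \<le> e")
      case True
      have "Poly_Mapping.keys g \<subseteq> monomials_deg n (e - d (Suc i))"
        using g(2) by (force simp: monomials_deg_def)
      from normal_form[OF i(2) this] obtain q where
        q: "Poly_Mapping.keys q \<subseteq> {x \<in> normals i n. mdeg x = e - d (Suc i)}" "g - q \<in> gideal c i n (e - d (Suc i))"
        by blast
      have "?f * (g - q) \<in> gideal c i n e"
        using True by (intro gideal_mult_form[OF q(2) keys_gform]) simp
      then show ?thesis
        using q(1) True by (intro exI[of _ q]) (auto simp: U_def mult.commute)
    next
      case False
      then have "Poly_Mapping.keys g = {}"
        using g(2) by force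
      then show ?thesis
        by (intro exI[of _ 0]) simp
    qed
    then obtain q where q: "Poly_Mapping.keys q \<subseteq> U" "(g - q) * ?f \<in> gideal c i n e" by blast
    define b where "b = Poly_Mapping.lookup q"
    have "q * ?f = (\<Sum>u\<in>Poly_Mapping.keys q. Poly_Mapping.single u (b u) * ?f)"
      unfolding b_def by (simp flip: sum_distrib_right sum_singles)
    also have "\<dots> = (\<Sum>u\<in>U. Poly_Mapping.single 0 (b u) * (Poly_Mapping.single u 1 * ?f))"
      using q(1) finU
      by (intro sum.mono_neutral_cong_left) (auto simp: b_def in_keys_iff mult_single simp flip: mult.assoc)
    finally have qf: "q * ?f = (\<Sum>u\<in>U. Poly_Mapping.single 0 (b u) * (Poly_Mapping.single u 1 * ?f))" .
    have "(\<Sum>u\<in>U. Poly_Mapping.single 0 (b u) * (Poly_Mapping.single u 1 * ?f - V u)) \<in> gideal c i n e"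
      using V(2) by (intro gideal_sum gideal_smult)
    moreover have "r - s - (\<Sum>u\<in>U. Poly_Mapping.single 0 (b u) * V u) =
        p' + (g - q) * ?f + (\<Sum>u\<in>U. Poly_Mapping.single 0 (b u) * (Poly_Mapping.single u 1 * ?f - V u))"
      unfolding right_diff_distrib sum_subtractf qf[symmetric] g(3) by (simp add: algebra_simps)
    ultimately have mem: "r - s - (\<Sum>u\<in>U. Poly_Mapping.single 0 (b u) * V u) \<in> gideal c i n e"
      using gideal_add[OF gideal_add[OF g(1) q(2)]] by simp
    have "Poly_Mapping.lookup (r - s - (\<Sum>u\<in>U. Poly_Mapping.single 0 (b u) * V u)) m = 0"
      if "m \<notin> normals i n" for m
    proof -
      have "Poly_Mapping.lookup (Poly_Mapping.single 0 (b u) * V u) m = 0" if "u \<in> U" for u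
        using lookup_eq_0[OF V(1)[OF that], of m] \<open>m \<notin> normals i n\<close>
        by (simp add: lookup_scalar_mult)
      then show ?thesis
        using lookup_eq_0[OF r(2) that] lookup_eq_0[OF r(3) that] by (simp add: lookup_minus lookup_sum)
    qed
    then have "Poly_Mapping.keys (r - s - (\<Sum>u\<in>U. Poly_Mapping.single 0 (b u) * V u)) \<subseteq> normals i n"
      by (rule keys_subsetI)
    then have "r - s - (\<Sum>u\<in>U. Poly_Mapping.single 0 (b u) * V u) = 0"
      by (rule Suc.IH[OF i(2) mem])
    then show ?thesis
      by (intro exI[of _ b]) (simp add: algebra_simps)
  qed
  have sm: "Poly_Mapping.lookup (\<Sum>u\<in>U. Poly_Mapping.single 0 (b u) * V u) t = (\<Sum>u\<in>U. b u * Poly_Mapping.lookup (V u) t)" for b t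
    by (simp add: lookup_sum lookup_scalar_mult)
  have "\<exists>b. \<forall>t'\<in>T. (\<Sum>u\<in>U. b u * Poly_Mapping.lookup (V u) t') = (if t = t' then 1 else 0)" if t: "t \<in> T" for t
  proof -
    have tn: "t \<in> normals i n" "mdeg t = e" "t \<in> monomials n"
      using t normals_subset[OF i(2)] by (auto simp: T_def)
    then have "\<exists>v. Poly_Mapping.keys v \<subseteq> {x \<in> normals (Suc i) n. mdeg x = e} \<and>
        Poly_Mapping.single t 1 - v \<in> gideal c (Suc i) n e"
      using Suc.prems(1) by (intro normal_form) (auto simp: monomials_deg_def)
    then obtain v where v: "Poly_Mapping.keys v \<subseteq> {x \<in> normals (Suc i) n. mdeg x = e}"
      "Poly_Mapping.single t 1 - v \<in> gideal c (Suc i) n e"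
      by blast
    obtain b where b: "Poly_Mapping.single t 1 = (\<Sum>u\<in>U. Poly_Mapping.single 0 (b u) * V u) + v"
      using expand[OF v(2)] v(1) tn(1) normals_Suc_subset[OF _ i(1)] by auto
    have "(\<Sum>u\<in>U. b u * Poly_Mapping.lookup (V u) t') = (if t = t' then 1 else 0)" if "t' \<in> T" for t'
      using arg_cong[OF b, of "\<lambda>p. Poly_Mapping.lookup p t'"] lookup_eq_0[OF v(1), of t'] that
      by (simp add: lookup_add sm T_def lookup_single when_def split: if_splits)
    then show ?thesis by blast
  qed
  then have "\<exists>A. \<forall>t\<in>T. \<forall>t'\<in>T. (\<Sum>u\<in>U. A t u * Poly_Mapping.lookup (V u) t') = (if t = t' then 1 else 0)"
    by (intro bchoice ballI)
  then obtain A where "\<forall>t\<in>T. \<forall>t'\<in>T. (\<Sum>u\<in>U. A t u * Poly_Mapping.lookup (V u) t') = (if t = t' then 1 else 0)" ..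
  then have A: "(\<Sum>u\<in>U. A t u * Poly_Mapping.lookup (V u) t') = (if t = t' then 1 else 0)"
    if "t \<in> T" "t' \<in> T" for t t'
    using that by blast
  obtain b where b: "p = (\<Sum>u\<in>U. Poly_Mapping.single 0 (b u) * V u) + 0"
    using expand[of p 0] Suc.prems normals_Suc_subset[OF _ i(1)] by auto
  have "b u = 0" if "u \<in> U" for u
  proof (rule left_kernel_trivial_of_right_inverse[OF finT finU _ A _ that])
    show "card U \<le> card T"
      unfolding U_def T_def by (rule card_new_leading[OF i(1)])
    fix t assume "t \<in> T"
    then have "Poly_Mapping.lookup p t = 0"
      using lookup_eq_0[OF Suc.prems(3)] by (simp add: T_def)
    then show "(\<Sum>u\<in>U. b u * Poly_Mapping.lookup (V u) t) = 0"
      using b by (simp add: sm)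
  qed
  then show ?case
    using b by simp
qed simp

text \<open>Rewriting the smaller terms as smaller standard monomials leaves the coefficient of
  \<open>m\<close> unchanged. The result would be a nonzero element of the ideal supported on
  \<open>std n\<close>, against independence.\<close>

lemma leading_not_std:
  assumes p: "p \<in> gideal c n n e" and m: "m \<in> Poly_Mapping.keys p"
    and max: "\<And>m'. m' \<in> Poly_Mapping.keys p \<Longrightarrow> m' = m \<or> grevlex_less m' m"
  shows "m \<notin> std n"
proof
  assume ms: "m \<in> std n"
  define a where "a = Poly_Mapping.lookup p m"
  let ?X = "{x \<in> normals n n. grevlex_less x m}"
  have "p - Poly_Mapping.single m a \<in> gspan c n n e ?X"
  proof (rule gspan_of_keys)
    fix m' assume "m' \<in> Poly_Mapping.keys (p - Poly_Mapping.single m a)"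
    then have m': "m' \<in> Poly_Mapping.keys p" "m' \<noteq> m"
      by (auto simp: in_keys_iff lookup_minus lookup_single when_def a_def split: if_splits)
    then have "m' \<in> monomials n" "mdeg m' = e"
      using gideal_keys[OF p] by (auto simp: monomials_deg_def)
    then have "Poly_Mapping.single m' 1 \<in> gspan c n n e {x \<in> normals n n. grevlex_below x m'}"
      using reduces_all[of n n] by (auto simp: reduces_def)
    moreover have "{x \<in> normals n n. grevlex_below x m'} \<subseteq> ?X"
      using max[OF m'(1)] m'(2) grevlex_less_trans[of _ m' m] by (auto simp: grevlex_below_def)
    ultimately show "Poly_Mapping.single m' 1 \<in> gspan c n n e ?X"
      by (rule gspan_mono[rotated])
  qed
  then obtain p1 q1 where 1: "p1 \<in> gideal c n n e" "Poly_Mapping.keys q1 \<subseteq> ?X"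
    "p - Poly_Mapping.single m a = p1 + q1"
    by (rule gspanE)
  have eq: "p - p1 = q1 + Poly_Mapping.single m a"
    using 1(3) by (simp add: algebra_simps)
  have "Poly_Mapping.keys (q1 + Poly_Mapping.single m a) \<subseteq> normals n n"
    using Poly_Mapping.keys_add[of q1 "Poly_Mapping.single m a"] 1(2) ms by (auto split: if_splits)
  then have "p - p1 = 0"
    using normals_independent[OF _ gideal_diff[OF p 1(1)]] eq by simp
  then have "Poly_Mapping.lookup (q1 + Poly_Mapping.single m a) m = 0"
    using eq by simp
  moreover have "Poly_Mapping.lookup q1 m = 0"
    by (rule lookup_eq_0[OF 1(2)]) (simp add: grevlex_less_irrefl)
  ultimately show False
    using m by (simp add: lookup_add a_def in_keys_iff)
qed

lemma leading_form_exists: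
  assumes "s \<in> monomials n" "s \<notin> std n"
  obtains p where "p \<in> gideal c n n (mdeg s)" "s \<in> Poly_Mapping.keys p"
    "\<And>m'. m' \<in> Poly_Mapping.keys p \<Longrightarrow> m' = s \<or> grevlex_less m' s"
proof -
  have "Poly_Mapping.single s 1 \<in> gspan c n n (mdeg s) {x \<in> normals n n. grevlex_below x s}"
    using reduces_all[of n n] assms(1) by (auto simp: reduces_def)
  then obtain p q where pq: "p \<in> gideal c n n (mdeg s)" "Poly_Mapping.keys q \<subseteq> {x \<in> normals n n. grevlex_below x s}"
    "Poly_Mapping.single s 1 = p + q"
    by (rule gspanE)
  have p: "p = Poly_Mapping.single s 1 - q"
    using pq(3) by (simp add: algebra_simps)
  have "Poly_Mapping.lookup q s = 0"
    using lookup_eq_0[OF pq(2), of s] assms(2) by simp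
  then have "s \<in> Poly_Mapping.keys p"
    by (simp add: p in_keys_iff lookup_minus)
  moreover have "m' = s \<or> grevlex_less m' s" if "m' \<in> Poly_Mapping.keys p" for m'
    using that pq(2) by (auto simp: p in_keys_iff lookup_minus lookup_single when_def grevlex_below_def subset_iff split: if_splits)
  ultimately show thesis
    using that pq(1) by blast
qed

text \<open>The recursion for \<open>std\<close> does not show this directly. The monomials outside
  \<open>std n\<close> are leading monomials of forms in the ideal, and multiplying the form
  multiplies its leading monomial.\<close>

lemma nonstd_add:
  assumes "s \<in> monomials n" "s \<notin> std n" "\<mu> \<in> monomials n"
  shows "\<mu> + s \<notin> std n"
proof -
  obtain p where p: "p \<in> gideal c n n (mdeg s)" "s \<in> Poly_Mapping.keys p"
    "\<And>m'. m' \<in> Poly_Mapping.keys p \<Longrightarrow> m' = s \<or> grevlex_less m' s"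
    using leading_form_exists[OF assms(1,2)] by blast
  show ?thesis
  proof (rule leading_not_std[OF gideal_single_mult[OF p(1) assms(3), of 1]])
    show "\<mu> + s \<in> Poly_Mapping.keys (Poly_Mapping.single \<mu> 1 * p)"
      using p(2) by (simp add: in_keys_iff lookup_single_mult_add)
    fix m' assume "m' \<in> Poly_Mapping.keys (Poly_Mapping.single \<mu> 1 * p)"
    then obtain m where "m \<in> Poly_Mapping.keys p" "m' = \<mu> + m"
      using keys_single_mult by blast
    then show "m' = \<mu> + s \<or> grevlex_less m' (\<mu> + s)"
      using p(3)[of m] grevlex_less_add_right[of m \<mu> s] by (auto simp: add.commute)
  qed
qed

end

section \<open>Minimal monomials outside the candidate set\<close>

context balanced_degrees
begin

text \<open>Split off the last variable of \<open>a\<close>. If the rest is standard,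
  \<open>std_below_new\<close> puts every standard monomial of this degree below \<open>a\<close>.
  Otherwise minimality makes \<open>a\<close> free of the last variable; a larger \<open>b\<close>
  of the same degree is then free of it too, and the claim descends to fewer variables.\<close>

lemma minimal_nonstd_almost_revlex:
  assumes "i \<le> n" "a \<in> monomials i" "a \<notin> std i"
    and "\<And>s \<mu>. s \<in> monomials i \<Longrightarrow> s \<notin> std i \<Longrightarrow> a = \<mu> + s \<Longrightarrow> \<mu> = 0"
    and "b \<in> monomials i" "mdeg b = mdeg a" "grevlex_less a b"
  shows "b \<notin> std i"
  using assms
proof (induction i arbitrary: a b)
  case 0
  from "0.prems"(2,3) show ?case by (simp add: monomials_def)
next
  case (Suc i)
  show ?case
  proof
    assume "b \<in> std (Suc i)"
    then obtain b' j' where b': "b' \<in> std i" "j' < ht i b'" "b = b' + Poly_Mapping.single (Suc i) j'"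
      by (rule std_SucE)
    obtain a' j where a': "a' \<in> monomials i" "a = a' + Poly_Mapping.single (Suc i) j"
      using Suc.prems(2) by (rule monomials_SucE)
    have nless: "\<not> grevlex_less b a"
      using Suc.prems(7) grevlex_less_asym by blast
    show False
    proof (cases "a' \<in> std i")
      case True
      then have "ht i a' \<le> j"
        using Suc.prems(3) std_Suc_iff[OF a'(1), of j] a'(2) by simp
      moreover have "mdeg a' + j = mdeg b' + j'"
        using Suc.prems(6) a'(2) b'(3) by simp
      ultimately have "grevlex_less b a"
        unfolding a'(2) b'(3) using Suc.prems(1) True b' by (intro std_below_new) simp_all
      with nless show False ..
    next
      case False
      have lift: "s \<in> monomials (Suc i)" "s \<notin> std (Suc i)" if "s \<in> monomials i" "s \<notin> std i" for s
        using that monomials_mono[of i "Suc i"] std_Suc_iff[of s i 0] by auto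
      have "Poly_Mapping.single (Suc i) j = 0"
        using Suc.prems(4)[of a' "Poly_Mapping.single (Suc i) j"] lift[OF a'(1) False] a'(2) by (simp add: add.commute)
      then have a: "a = a'"
        using a'(2) by simp
      have "j' = 0"
      proof (rule ccontr)
        assume "j' \<noteq> 0"
        then have "grevlex_less b a"
          using Suc.prems(2,5,6) a'(1) a b'(3)
          by (intro grevlex_less_last[of _ _ i]) (auto simp: monomials_iff lookup_add)
        with nless show False ..
      qed
      then have b: "b \<in> std i"
        using b' by simp
      moreover have "b \<notin> std i"
      proof (rule Suc.IH)
        show "a \<in> monomials i" "a \<notin> std i"
          using a a'(1) False by simp_all
        show "\<mu> = 0" if "s \<in> monomials i" "s \<notin> std i" "a = \<mu> + s" for s \<mu>
          by (rule Suc.prems(4)[OF lift[OF that(1,2)] that(3)])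
      qed (use Suc.prems(1,6,7) std_subset[OF b] in simp_all)
      ultimately show False by simp
    qed
  qed
qed

end

subsection \<open>Initial ideals\<close>

lemma ideal_genI: "finite T \<Longrightarrow> T \<subseteq> S \<Longrightarrow> (\<And>s. s \<in> T \<Longrightarrow> g s \<in> poly_ring n) \<Longrightarrow> (\<Sum>s\<in>T. g s * s) \<in> ideal_gen n S"
  unfolding ideal_gen_def by blast

lemma ideal_genE:
  assumes "p \<in> ideal_gen n S"
  obtains T g where "finite T" "T \<subseteq> S" "\<forall>s\<in>T. g s \<in> poly_ring n" "p = (\<Sum>s\<in>T. g s * s)"
  using assms unfolding ideal_gen_def by blast

lemma ideal_gen_zero: "0 \<in> ideal_gen n S"
  using ideal_genI[of "{}" S "\<lambda>_. 0" n] by simp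

lemma ideal_gen_generator: "s \<in> S \<Longrightarrow> g \<in> poly_ring n \<Longrightarrow> g * s \<in> ideal_gen n S"
  using ideal_genI[of "{s}" S "\<lambda>_. g" n] by simp

lemma poly_ring_add: "p \<in> poly_ring n \<Longrightarrow> q \<in> poly_ring n \<Longrightarrow> p + q \<in> poly_ring n"
  unfolding poly_ring_def using Poly_Mapping.keys_add[of p q] by auto

lemma poly_ring_mult: "p \<in> poly_ring n \<Longrightarrow> q \<in> poly_ring n \<Longrightarrow> p * q \<in> poly_ring n"
  unfolding poly_ring_def using keys_mult[of p q] by fastforce

lemma poly_ring_single: "m \<in> monomials n \<Longrightarrow> Poly_Mapping.single m a \<in> poly_ring n"
  by (simp add: poly_ring_def)

lemma ideal_gen_add:
  assumes "p \<in> ideal_gen n S" "q \<in> ideal_gen n S"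
  shows "p + q \<in> ideal_gen n S"
proof -
  obtain T g where 1: "finite T" "T \<subseteq> S" "\<forall>s\<in>T. g s \<in> poly_ring n" "p = (\<Sum>s\<in>T. g s * s)"
    using assms(1) by (rule ideal_genE)
  obtain U h where 2: "finite U" "U \<subseteq> S" "\<forall>s\<in>U. h s \<in> poly_ring n" "q = (\<Sum>s\<in>U. h s * s)"
    using assms(2) by (rule ideal_genE)
  define g' where "g' = (\<lambda>s. if s \<in> T then g s else 0)"
  define h' where "h' = (\<lambda>s. if s \<in> U then h s else 0)"
  have "p = (\<Sum>s\<in>T \<union> U. g' s * s)"
    unfolding 1(4) g'_def using 1(1) 2(1) by (intro sum.mono_neutral_cong_left) auto
  moreover have "q = (\<Sum>s\<in>T \<union> U. h' s * s)"
    unfolding 2(4) h'_def using 1(1) 2(1) by (intro sum.mono_neutral_cong_left) auto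
  ultimately have "p + q = (\<Sum>s\<in>T \<union> U. (g' s + h' s) * s)"
    by (simp add: distrib_right sum.distrib)
  moreover have "g' s + h' s \<in> poly_ring n" for s
    using 1(3) 2(3) by (intro poly_ring_add) (auto simp: g'_def h'_def poly_ring_def)
  ultimately show ?thesis
    using ideal_genI[of "T \<union> U" S "\<lambda>s. g' s + h' s" n] 1(1,2) 2(1,2) by simp
qed

lemma ideal_gen_sum: "(\<And>x. x \<in> X \<Longrightarrow> g x \<in> ideal_gen n S) \<Longrightarrow> (\<Sum>x\<in>X. g x) \<in> ideal_gen n S"
  by (induction X rule: infinite_finite_induct) (auto intro: ideal_gen_add ideal_gen_zero)

lemma ideal_gen_mult:
  assumes "p \<in> ideal_gen n S" "q \<in> poly_ring n"
  shows "q * p \<in> ideal_gen n S"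
proof -
  obtain T g where 1: "finite T" "T \<subseteq> S" "\<forall>s\<in>T. g s \<in> poly_ring n" "p = (\<Sum>s\<in>T. g s * s)"
    using assms(1) by (rule ideal_genE)
  have "(\<Sum>s\<in>T. (q * g s) * s) \<in> ideal_gen n S"
    using 1 assms(2) by (intro ideal_genI poly_ring_mult) auto
  then show ?thesis
    by (simp add: 1(4) sum_distrib_left mult.assoc)
qed

lemma ideal_gen_subset:
  assumes "S \<subseteq> ideal_gen n S'"
  shows "ideal_gen n S \<subseteq> ideal_gen n S'"
proof
  fix p assume "p \<in> ideal_gen n S"
  then obtain T g where 1: "finite T" "T \<subseteq> S" "\<forall>s\<in>T. g s \<in> poly_ring n" "p = (\<Sum>s\<in>T. g s * s)"
    by (rule ideal_genE)
  show "p \<in> ideal_gen n S'"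
    unfolding 1(4) by (rule ideal_gen_sum, rule ideal_gen_mult) (use 1(2,3) assms in auto)
qed

text \<open>Distinct indices may give equal generators; a subset of \<open>J\<close> on which
  \<open>f\<close> is injective turns the sum over generators into one over indices.\<close>

lemma ideal_gen_image:
  "p \<in> ideal_gen n (f ` J) \<Longrightarrow> finite J \<Longrightarrow> \<exists>g. (\<forall>j\<in>J. g j \<in> poly_ring n) \<and> p = (\<Sum>j\<in>J. g j * f j)"
proof -
  assume "p \<in> ideal_gen n (f ` J)" and J: "finite J"
  then obtain T g where 1: "finite T" "T \<subseteq> f ` J" "\<forall>s\<in>T. g s \<in> poly_ring n" "p = (\<Sum>s\<in>T. g s * s)"
    by (blast elim: ideal_genE)
  obtain K where K: "K \<subseteq> J" "inj_on f K" "T = f ` K"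
    using 1(2) subset_image_inj by metis
  have "p = (\<Sum>j\<in>K. g (f j) * f j)"
    unfolding 1(4) K(3) using K(2) by (simp add: sum.reindex)
  also have "\<dots> = (\<Sum>j\<in>J. (if j \<in> K then g (f j) else 0) * f j)"
    using K(1) J by (intro sum.mono_neutral_cong_left) auto
  finally show ?thesis
    using 1(3) K(3) by (intro exI[of _ "\<lambda>j. if j \<in> K then g (f j) else 0"]) (auto simp: poly_ring_def)
qed

lemma xpow_in_monomial_ideal_iff:
  assumes b: "b \<in> monomials n"
  shows "(xpow b :: 'a::field mpol) \<in> ideal_gen n (xpow ` A) \<longleftrightarrow> (\<exists>a\<in>A. \<exists>\<mu>\<in>monomials n. b = \<mu> + a)"
proof
  assume "(xpow b :: 'a mpol) \<in> ideal_gen n (xpow ` A)"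
  then obtain T g where 1: "T \<subseteq> xpow ` A" "\<forall>s\<in>T. g s \<in> poly_ring n" "(xpow b :: 'a mpol) = (\<Sum>s\<in>T. g s * s)"
    by (rule ideal_genE)
  have "b \<in> Poly_Mapping.keys (\<Sum>s\<in>T. g s * s)"
    unfolding 1(3)[symmetric] by (simp add: xpow_def)
  from subsetD[OF keys_sum this] obtain s where s: "s \<in> T" "b \<in> Poly_Mapping.keys (g s * s)"
    by blast
  obtain a where a: "a \<in> A" "s = xpow a"
    using 1(1) s(1) by blast
  obtain \<mu> where "\<mu> \<in> Poly_Mapping.keys (g s)" "b = \<mu> + a"
    using keys_mult[of "g s" s] s(2) by (auto simp: a(2) xpow_def)
  then show "\<exists>a\<in>A. \<exists>\<mu>\<in>monomials n. b = \<mu> + a"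
    using a(1) 1(2) s(1) by (auto simp: poly_ring_def)
next
  assume "\<exists>a\<in>A. \<exists>\<mu>\<in>monomials n. b = \<mu> + a"
  then obtain a \<mu> where a: "a \<in> A" "\<mu> \<in> monomials n" "b = \<mu> + a"
    by blast
  have "Poly_Mapping.single \<mu> 1 * (xpow a :: 'a mpol) \<in> ideal_gen n (xpow ` A)"
    using a by (intro ideal_gen_generator poly_ring_single) auto
  then show "(xpow b :: 'a mpol) \<in> ideal_gen n (xpow ` A)"
    by (simp add: xpow_def mult_single a(3))
qed

lemma lead_mon:
  fixes p :: "'a::field mpol"
  assumes "p \<noteq> 0"
  shows "lead_mon p \<in> Poly_Mapping.keys p" "m \<in> Poly_Mapping.keys p \<Longrightarrow> m = lead_mon p \<or> grevlex_less m (lead_mon p)"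
  using theI'[OF lead_mon_ex1[OF assms]] unfolding lead_mon_def[symmetric] by auto

lemma lead_mon_eqI:
  fixes p :: "'a::field mpol"
  assumes "m \<in> Poly_Mapping.keys p" "\<And>m'. m' \<in> Poly_Mapping.keys p \<Longrightarrow> m' = m \<or> grevlex_less m' m"
  shows "lead_mon p = m"
proof -
  have "p \<noteq> 0"
    using assms(1) by auto
  then show ?thesis
    using lead_mon[of p] assms grevlex_less_asym by metis
qed

text \<open>\<open>N\<close> is the set of monomials outside the monomial ideal.\<close>

lemma almost_revlex_of_complement:
  fixes n :: nat and N :: "mon set"
  defines "S \<equiv> monomials n - N"
  assumes bounded: "\<And>b. b \<in> N \<Longrightarrow> mdeg b \<le> l"
    and add: "\<And>s \<mu>. s \<in> S \<Longrightarrow> \<mu> \<in> monomials n \<Longrightarrow> \<mu> + s \<in> S"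
    and minimal: "\<And>a b. a \<in> S \<Longrightarrow> (\<And>s \<mu>. s \<in> S \<Longrightarrow> a = \<mu> + s \<Longrightarrow> \<mu> = 0) \<Longrightarrow>
      b \<in> monomials n \<Longrightarrow> mdeg b = mdeg a \<Longrightarrow> grevlex_less a b \<Longrightarrow> b \<in> S"
  shows "almost_revlex n (ideal_gen n (xpow ` S) :: 'a::field mpol set)"
proof -
  let ?J = "ideal_gen n (xpow ` S) :: 'a mpol set"
  define A where "A = {a \<in> S. \<forall>s\<in>S. \<forall>\<mu>. a = \<mu> + s \<longrightarrow> \<mu> = 0}"
  have S_monomials: "s \<in> monomials n" if "s \<in> S" for s
    using that by (simp add: S_def)
  have J_iff: "(xpow b :: 'a mpol) \<in> ?J \<longleftrightarrow> b \<in> S" if "b \<in> monomials n" for b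
    unfolding xpow_in_monomial_ideal_iff[OF that]
    using add that by (metis add_0 zero_in_monomials)
  have factor: "\<exists>a\<in>A. \<exists>\<mu>\<in>monomials n. s = \<mu> + a" if "s \<in> S" for s
    using that
  proof (induction "mdeg s" arbitrary: s rule: less_induct)
    case less
    show ?case
    proof (cases "s \<in> A")
      case True
      then show ?thesis by (intro bexI[of _ s] bexI[of _ 0]) simp_all
    next
      case False
      then obtain s' \<mu> where s': "s' \<in> S" "s = \<mu> + s'" "\<mu> \<noteq> 0"
        using less.prems by (auto simp: A_def)
      then have "mdeg s' < mdeg s"
        using mdeg_eq_0_iff[of \<mu>] by simp
      from less.hyps[OF this s'(1)] obtain a \<nu> where "a \<in> A" "\<nu> \<in> monomials n" "s' = \<nu> + a"
        by blast
      moreover have "\<mu> \<in> monomials n"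
        using S_monomials[OF less.prems] s'(2) by simp
      ultimately show ?thesis
        by (intro bexI[of _ a] bexI[of _ "\<mu> + \<nu>"]) (simp_all add: s'(2) add.assoc)
    qed
  qed
  have "A \<subseteq> (\<Union>e\<le>l + 1. monomials_deg n e)"
  proof
    fix a assume a: "a \<in> A"
    \<comment> \<open>A minimal \<open>a\<close> divided by one of its variables lies in
      \<open>N\<close>, where degrees are at most \<open>l\<close>.\<close>
    have "mdeg a \<le> l + 1"
    proof (rule ccontr)
      assume deg: "\<not> mdeg a \<le> l + 1"
      then have "a \<noteq> 0"
        by (auto simp: mdeg_def)
      then obtain i where i: "i \<in> Poly_Mapping.keys a"
        by (metis all_not_in_conv keys_eq_empty)
      define s where "s = a - Poly_Mapping.single i 1"
      have eq: "a = Poly_Mapping.single i 1 + s"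
        using i by (intro poly_mapping_eqI) (auto simp: s_def lookup_add lookup_minus lookup_single when_def in_keys_iff)
      have "s \<in> monomials n"
        using a eq S_monomials[of a] by (simp add: A_def)
      moreover have "s \<notin> N"
        using bounded[of s] deg arg_cong[OF eq, of mdeg] by auto
      ultimately have "Poly_Mapping.single i (1::nat) = 0"
        using a eq by (auto simp: A_def S_def)
      then show False
        by (metis lookup_single_eq lookup_zero zero_neq_one)
    qed
    then show "a \<in> (\<Union>e\<le>l + 1. monomials_deg n e)"
      using a S_monomials by (auto simp: A_def monomials_deg_def)
  qed
  then have "finite A"
    by (rule finite_subset) (simp add: finite_monomials_deg)
  moreover have "A \<subseteq> monomials n"
    using S_monomials by (auto simp: A_def)
  moreover have "?J = ideal_gen n (xpow ` A)"
  proof (intro antisym ideal_gen_subset)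
    show "xpow ` S \<subseteq> ideal_gen n (xpow ` A :: 'a mpol set)"
      using factor xpow_in_monomial_ideal_iff S_monomials by blast
    show "xpow ` A \<subseteq> ?J"
      using J_iff S_monomials by (auto simp: A_def)
  qed
  moreover have "ideal_gen n (xpow ` B) \<noteq> ?J" if "B \<subset> A" for B
  proof
    assume eq: "ideal_gen n (xpow ` B) = ?J"
    obtain a where a: "a \<in> A" "a \<notin> B"
      using \<open>B \<subset> A\<close> by blast
    then have aS: "a \<in> S" "a \<in> monomials n"
      using S_monomials by (auto simp: A_def)
    then have "(xpow a :: 'a mpol) \<in> ideal_gen n (xpow ` B)"
      using J_iff eq by blast
    then obtain b \<mu> where b: "b \<in> B" "a = \<mu> + b"
      using xpow_in_monomial_ideal_iff[OF aS(2)] by blast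
    then have "b \<in> S"
      using \<open>B \<subset> A\<close> by (auto simp: A_def)
    then have "\<mu> = 0"
      using a(1) b(2) by (auto simp: A_def)
    then show False
      using a(2) b by simp
  qed
  ultimately have "minimal_mon_gens n ?J A"
    unfolding minimal_mon_gens_def by blast
  moreover have "(xpow b :: 'a mpol) \<in> ?J" if "a \<in> A" "b \<in> monomials n" "mdeg b = mdeg a" "grevlex_less a b" for a b
    using minimal[of a b] that J_iff by (auto simp: A_def)
  ultimately show ?thesis
    unfolding almost_revlex_def by blast
qed

section \<open>From arbitrary ideal elements to graded pieces\<close>

context form_degrees
begin

text \<open>As the forms are homogeneous, the terms of \<open>g j\<close> of the wrong degree
  contribute only to other degrees. This reduces leading monomials of arbitrary ideal elements to
  those of forms.\<close>

lemma homogeneous_component: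
  fixes c :: "nat \<times> mon \<Rightarrow> 'a::field"
  assumes "\<forall>j\<in>{1..i}. g j \<in> poly_ring N"
  obtains p' where "p' \<in> gideal c i N e"
    "\<And>m. mdeg m = e \<Longrightarrow> Poly_Mapping.lookup p' m = Poly_Mapping.lookup (\<Sum>j=1..i. g j * gform c N j) m"
proof -
  define low where "low = (\<lambda>j. {\<mu> \<in> Poly_Mapping.keys (g j). mdeg \<mu> + d j = e})"
  define h where "h = (\<lambda>j. \<Sum>\<mu>\<in>low j. Poly_Mapping.single \<mu> (Poly_Mapping.lookup (g j) \<mu>))"
  have fin: "finite (low j)" for j
    by (simp add: low_def)
  have h: "Poly_Mapping.lookup (h j) \<mu> = (if mdeg \<mu> + d j = e then Poly_Mapping.lookup (g j) \<mu> else 0)" for j \<mu>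
    using fin[of j] by (auto simp: h_def lookup_sum lookup_single when_def low_def in_keys_iff)
  have "Poly_Mapping.lookup ((g j - h j) * gform c N j) m = 0" if "mdeg m = e" for j m
  proof -
    have "m \<notin> Poly_Mapping.keys ((g j - h j) * gform c N j)"
    proof
      assume "m \<in> Poly_Mapping.keys ((g j - h j) * gform c N j)"
      then obtain a b where ab: "a \<in> Poly_Mapping.keys (g j - h j)" "b \<in> Poly_Mapping.keys (gform c N j)" "m = a + b"
        using keys_mult by blast
      have "mdeg a + d j \<noteq> e"
        using ab(1) by (auto simp: in_keys_iff lookup_minus h)
      moreover have "mdeg b = d j"
        using ab(2) keys_gform[of c N j] by (auto simp: monomials_deg_def)
      ultimately show False
        using that ab(3) by simp
    qed
    then show ?thesis
      by (simp add: in_keys_iff)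
  qed
  then have "Poly_Mapping.lookup (\<Sum>j=1..i. h j * gform c N j) m = Poly_Mapping.lookup (\<Sum>j=1..i. g j * gform c N j) m"
    if "mdeg m = e" for m
    using that by (simp add: lookup_sum left_diff_distrib lookup_minus)
  moreover have "(\<Sum>j=1..i. h j * gform c N j) \<in> gideal c i N e"
  proof (rule gidealI[of _ h])
    fix j \<mu> assume j: "1 \<le> j" "j \<le> i" and "\<mu> \<in> Poly_Mapping.keys (h j)"
    then have \<mu>: "\<mu> \<in> Poly_Mapping.keys (g j)" "mdeg \<mu> + d j = e"
      by (auto simp: in_keys_iff h split: if_splits)
    moreover have "Poly_Mapping.keys (g j) \<subseteq> monomials N"
      using assms j by (simp add: poly_ring_def)
    ultimately show "\<mu> \<in> monomials N \<and> mdeg \<mu> + d j = e"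
      by blast
  qed simp
  ultimately show thesis
    using that by blast
qed

lemma gideal_subset_ideal_gen:
  assumes "p \<in> gideal c i N e"
  shows "p \<in> ideal_gen N (gform c N ` {1..i})"
proof -
  obtain g where g: "gcoeffs i N e g" "p = (\<Sum>j=1..i. g j * gform c N j)"
    using assms by (rule gidealE)
  show ?thesis
    unfolding g(2)
    by (rule ideal_gen_sum, rule ideal_gen_generator) (use gcoeffsD[OF g(1)] in \<open>auto simp: poly_ring_def\<close>)
qed

end

context generic_setup
begin

lemma initial_ideal_generic:
  "initial_ideal n (ideal_gen n (gform c n ` {1..n})) = ideal_gen n (xpow ` (monomials n - std n))"
proof -
  let ?I = "ideal_gen n (gform c n ` {1..n})"
  have "lead_mon p \<in> monomials n - std n" if p: "p \<in> ?I" "p \<noteq> 0" for p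
  proof -
    obtain g where g: "\<forall>j\<in>{1..n}. g j \<in> poly_ring n" "p = (\<Sum>j=1..n. g j * gform c n j)"
      using ideal_gen_image[OF p(1)] by auto
    define m where "m = lead_mon p"
    obtain p' where p': "p' \<in> gideal c n n (mdeg m)"
      "\<And>m'. mdeg m' = mdeg m \<Longrightarrow> Poly_Mapping.lookup p' m' = Poly_Mapping.lookup p m'"
      using homogeneous_component[OF g(1), of c "mdeg m"] unfolding g(2) by metis
    have m: "m \<in> Poly_Mapping.keys p'"
      using lead_mon(1)[OF p(2)] p'(2)[of m] by (simp add: m_def in_keys_iff)
    moreover have "m' = m \<or> grevlex_less m' m" if "m' \<in> Poly_Mapping.keys p'" for m'
    proof -
      have "mdeg m' = mdeg m"
        using gideal_keys[OF p'(1)] that by (auto simp: monomials_deg_def)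
      then have "m' \<in> Poly_Mapping.keys p"
        using that p'(2)[of m'] by (simp add: in_keys_iff)
      then show ?thesis
        using lead_mon(2)[OF p(2)] by (simp add: m_def)
    qed
    ultimately have "m \<notin> std n"
      by (rule leading_not_std[OF p'(1)])
    moreover have "m \<in> monomials n"
      using gideal_keys[OF p'(1)] m by (auto simp: monomials_deg_def)
    ultimately show ?thesis
      by (simp add: m_def)
  qed
  moreover have "\<exists>p\<in>?I. p \<noteq> 0 \<and> lead_mon p = s" if s: "s \<in> monomials n" "s \<notin> std n" for s
  proof -
    obtain p where p: "p \<in> gideal c n n (mdeg s)" "s \<in> Poly_Mapping.keys p"
      "\<And>m'. m' \<in> Poly_Mapping.keys p \<Longrightarrow> m' = s \<or> grevlex_less m' s"
      using leading_form_exists[OF s] by blast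
    have "lead_mon p = s"
      by (rule lead_mon_eqI[OF p(2,3)])
    moreover have "p \<noteq> 0"
      using p(2) by auto
    ultimately show ?thesis
      using gideal_subset_ideal_gen[OF p(1)] by blast
  qed
  ultimately have "{xpow (lead_mon p) | p. p \<in> ?I \<and> p \<noteq> 0} = (xpow ` (monomials n - std n) :: 'a mpol set)"
    by blast
  then show ?thesis
    by (simp add: initial_ideal_def)
qed

end

theorem theorem3p19:
  fixes F :: "'a::field set" and n :: nat and d :: "nat \<Rightarrow> nat" and f :: "nat \<Rightarrow> 'a mpol"
  assumes "infinite (UNIV :: 'a set)"
    and "is_subfield F"
    and "n \<ge> 1"
    and "\<And>i. i \<in> {1..n} \<Longrightarrow> d i \<ge> 1"
    and "generic_forms F n n d f"
    and "\<And>i. i \<in> {1..n} \<Longrightarrow> int (d i) \<ge> (\<Sum>j=1..<i. int (d j)) - int i - 1"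
  shows "almost_revlex n (initial_ideal n (ideal_gen n (f ` {1..n})))"
proof -
  obtain c where c: "alg_indep F (SIGMA i:{1..n}. monomials_deg n (d i)) c"
    "\<forall>i\<in>{1..n}. f i = (\<Sum>m\<in>monomials_deg n (d i). Poly_Mapping.single m (c (i, m)))"
    using assms(5) unfolding generic_forms_def by blast
  interpret form_degrees d .
  \<comment> \<open>\<open>sigma i\<close> is the sum of the first \<open>i\<close> degrees minus
    \<open>i\<close>; the hypothesis at index \<open>i + 1\<close> subtracts \<open>i + 2\<close>
    from that sum, which leaves \<open>sigma i - 2\<close>.\<close>
  have large: "sigma i \<le> d (Suc i) + 2" if "i < n" for i
  proof -
    have "int (sigma i) = (\<Sum>j=1..i. int (d j) - 1)"
      unfolding sigma_def of_nat_sum using assms(4) that by (intro sum.cong) (auto simp: of_nat_diff)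
    also have "\<dots> = (\<Sum>j=1..<Suc i. int (d j)) - int i"
      by (simp add: sum_subtractf atLeastLessThanSuc_atLeastAtMost)
    finally show ?thesis
      using assms(6)[of "Suc i"] that by simp
  qed
  interpret generic_setup d n F c
    by unfold_locales (use assms(2,4) large c(1) in auto)
  have "f ` {1..n} = gform c n ` {1..n}"
    using c(2) by (intro image_cong) (auto simp: gform_def)
  moreover have "almost_revlex n (ideal_gen n (xpow ` (monomials n - std n)) :: 'a mpol set)"
  proof (rule almost_revlex_of_complement)
    show "mdeg b \<le> sigma n" if "b \<in> std n" for b
      using std_deg that by simp
    show "\<mu> + s \<in> monomials n - std n" if "s \<in> monomials n - std n" "\<mu> \<in> monomials n" for s \<mu>
      using nonstd_add that by simp
    show "b \<in> monomials n - std n" if "a \<in> monomials n - std n"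
      "\<And>s \<mu>. s \<in> monomials n - std n \<Longrightarrow> a = \<mu> + s \<Longrightarrow> \<mu> = 0"
      "b \<in> monomials n" "mdeg b = mdeg a" "grevlex_less a b" for a b
      using minimal_nonstd_almost_revlex[of n a b] that by simp
  qed
  ultimately show ?thesis
    by (simp only: initial_ideal_generic)
qed

end
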